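(* For any $x,y\in\dot{\mathbf U}_{\widehat I}$ and any $\varepsilon\in\{\pm1\}$, $$(x,y)_{\widehat I}=(\dot\Psi_\varepsilon(x),\dot\Psi_{-\varepsilon}(y))_I .$$
   Context: A Cartan datum $(I,\cdot)$ is a finite set $I$ with a $\mathbb Z$-valued symmetric bilinear form $\cdot$ on $\mathbb Z[I]$ such that $i\cdot i\in\{2,4,6,\dots\}$ and $2\frac{i\cdot j}{i\cdot i}\in\{0,-1,-2,\dots\}$ for $i\neq j$ in $I$. Fix $i_+,i_-\in I$ with $i_+\cdot i_+=i_-\cdot i_-=-2\,i_+\cdot i_-$. Put $i_0=i_++i_-$, $\widehat I=(I\setminus\{i_+,i_-\})\cup\{i_0\}$; with the restricted form $(\widehat I,\cdot)$ is a Cartan datum (the edge contraction). A root datum of type $(I,\cdot)$: finitely generated free abelian groups $Y,X$, a perfect pairing $\langle\,,\rangle:Y\times X\to\mathbb Z$, embeddings $I\hookrightarrow Y$, $i\mapsto i$, $I\hookrightarrow X$, $i\mapsto i'$, with $\langle i,j'\rangle=2\frac{i\cdot j}{i\cdot i}$. Fix one; the same $Y,X$ with $i_0\mapsto i_++i_-\in Y$, $i_0'=i_+'+i_-'\in X$ is a root datum of type $(\widehat I,\cdot)$. Let $v$ be an indeterminate, $v_i=v^{i\cdot i/2}$, $[n]_i=\frac{v_i^n-v_i^{-n}}{v_i-v_i^{-1}}$, $x_i^{(n)}=x_i^n/[n]_i^!$. $\mathbf U_I$ is the $\mathbb Q(v)$-algebra with generators $E_i,F_i$ ($i\in I$), $K_\mu$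 ($\mu\in Y$) and relations $K_0=1$, $K_\mu K_{\mu'}=K_{\mu+\mu'}$, $K_\mu E_i=v^{\langle\mu,i'\rangle}E_iK_\mu$, $K_\mu F_i=v^{-\langle\mu,i'\rangle}F_iK_\mu$, $E_iF_j-F_jE_i=\delta_{ij}\frac{\tilde K_i-\tilde K_i^{-1}}{v_i-v_i^{-1}}$ with $\tilde K_i=K_{\frac{i\cdot i}{2}i}$, and $\sum_{r+s=1-\langle i,j'\rangle}(-1)^rx_i^{(s)}x_jx_i^{(r)}=0$ for $x=E,F$, $i\neq j$. $\mathbf U_{\widehat I}$ is defined likewise for $(\widehat I,\cdot)$; generators $\widehat E_i,\widehat F_i,\widehat K_\mu$. Modified quantum group: $\dot{\mathbf U}_I=\bigoplus_{\lambda',\lambda''\in X}{}_{\lambda'}\mathbf U^I_{\lambda''}$, ${}_{\lambda'}\mathbf U^I_{\lambda''}=\mathbf U_I/\big(\sum_\mu(K_\mu-v^{\langle\mu,\lambda'\rangle})\mathbf U_I+\sum_\mu\mathbf U_I(K_\mu-v^{\langle\mu,\lambda''\rangle})\big)$, with projections $\pi_{\lambda',\lambda''}$, $1_\lambda=\pi_{\lambda,\lambda}(1)$, and its standard algebra and $\mathbf U_I$-bimodule structures: for monomials $s,t',t''$ in the generators, with degree $\|\cdot\|\in\mathbb Z[I]$ viewed in $X$ via $i\mapsto i'$ ($E_i$: $i$; $F_i$: $-i$; $K_\mu$: $0$), $t'\pi_{\lambda',\lambda''}(s)t''=\pi_{\lambda'+\|t'\|,\lambda''-\|t''\|}(t'st'')$,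 and $\pi_{\lambda_1',\lambda_1''}(s)\pi_{\lambda_2',\lambda_2''}(t)=\delta_{\lambda_1'',\lambda_2'}\pi_{\lambda_1',\lambda_2''}(st)$ when $\|s\|=\lambda_1'-\lambda_1''$, $\|t\|=\lambda_2'-\lambda_2''$. $\dot{\mathbf U}_{\widehat I}$ is the analogue for $\mathbf U_{\widehat I}$. For $\varepsilon=\pm1$, $\dot\Psi_\varepsilon:\dot{\mathbf U}_{\widehat I}\to\dot{\mathbf U}_I$ is $\pi_{\lambda',\lambda''}(u)\mapsto\pi_{\lambda',\lambda''}(\Psi_\varepsilon(u))$, where $\Psi_\varepsilon:\mathbf U_{\widehat I}\to\mathbf U_I$ is the algebra embedding $\widehat E_i\mapsto E_i$, $\widehat F_i\mapsto F_i$ ($i\ne i_0$), $\widehat K_\mu\mapsto K_\mu$, $\widehat E_{i_0}\mapsto E_{i_+}E_{i_-}-v_{i_0}^{-\varepsilon}E_{i_-}E_{i_+}$, $\widehat F_{i_0}\mapsto F_{i_-}F_{i_+}-v_{i_0}^{\varepsilon}F_{i_+}F_{i_-}$. Bilinear forms. $\mathbf f_I$ is the $\mathbb Q(v)$-algebra generated by $\theta_i$ ($i\in I$) with relations $\sum_{r+s=1-\langle i,j'\rangle}(-1)^r\theta_i^{(s)}\theta_j\theta_i^{(r)}=0$, $\mathbb N[I]$-graded; $x\mapsto x^-$ is the algebra embedding $\mathbf f_I\to\mathbf U_I$, $\theta_i\mapsto F_i$. With the product $(x\otimes y)(x'\otimes y')=v^{|y|\cdot|x'|}xx'\otimes yy'$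 on $\mathbf f_I\otimes\mathbf f_I$ and the algebra map $r$ with $r(\theta_i)=\theta_i\otimes1+1\otimes\theta_i$, $\mathbf f_I$ has the unique symmetric bilinear form with $(1,1)=1$, $(\theta_i,\theta_j)=\delta_{ij}(1-v_i^{-2})^{-1}$, $(xx',y)=(x\otimes x',r(y))$. Let $\rho:\mathbf U_I\to\mathbf U_I^{opp}$ be the algebra isomorphism $\rho(E_i)=v_i\tilde K_iF_i$, $\rho(F_i)=v_i\tilde K_i^{-1}E_i$, $\rho(K_\mu)=K_\mu$. Then $(\,,)_I$ is the unique $\mathbb Q(v)$-bilinear form on $\dot{\mathbf U}_I$ such that: $(1_{\lambda_1}x1_{\lambda_2},1_{\lambda_1'}x'1_{\lambda_2'})=0$ for $x,x'\in\mathbf U_I$ unless $\lambda_1=\lambda_1'$ and $\lambda_2=\lambda_2'$; $(ux,y)=(x,\rho(u)y)$ for $x,y\in\dot{\mathbf U}_I$, $u\in\mathbf U_I$; $(x^-1_\lambda,x'^-1_\lambda)=(x,x')$ for $x,x'\in\mathbf f_I$, $\lambda\in X$. $(\,,)_{\widehat I}$ is the same form for $\dot{\mathbf U}_{\widehat I}$. *)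

theory Defs
  imports
    "HOL-Library.Poly_Mapping"
    "HOL-Computational_Algebra.Polynomial"
    "HOL-Computational_Algebra.Fraction_Field"
    "HOL-Algebra.QuotRing"
    "HOL-Algebra.Generated_Groups"
    "HOL-Algebra.Product_Groups"
    "HOL-Algebra.Free_Abelian_Groups"
begin

section \<open>Cartan data, root data and the edge contraction\<close>

text \<open>
  The lattices Y and X are the additive groups of the types \<open>'y\<close> and \<open>'x\<close>; \<open>coroot i\<close> is the
  element i of Y and \<open>root i\<close> the element i' of X.  The form on Z[I] is given by its values
  \<open>dot i j\<close> on the basis I.
\<close>

record ('i, 'y, 'x) rdatum =
  idx :: "'i set"
  dot :: "'i \<Rightarrow> 'i \<Rightarrow> int"
  pairing :: "'y \<Rightarrow> 'x \<Rightarrow> int"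
  coroot :: "'i \<Rightarrow> 'y"
  root :: "'i \<Rightarrow> 'x"

definition cartan_datum :: "'i set \<Rightarrow> ('i \<Rightarrow> 'i \<Rightarrow> int) \<Rightarrow> bool" where
  "cartan_datum I d \<longleftrightarrow>
     finite I \<and>
     (\<forall>i\<in>I. \<forall>j\<in>I. d i j = d j i) \<and>
     (\<forall>i\<in>I. 0 < d i i \<and> even (d i i)) \<and>
     (\<forall>i\<in>I. \<forall>j\<in>I. i \<noteq> j \<longrightarrow> d i i dvd 2 * d i j \<and> d i j \<le> 0)"

definition fg_free_abelian :: "'a::ab_group_add itself \<Rightarrow> bool" where
  "fg_free_abelian _ \<longleftrightarrow>
     (\<exists>S::nat set. finite S \<and>
        \<lparr>carrier = (UNIV :: 'a set), mult = (+), one = 0\<rparr> \<cong> free_Abelian_group S)"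

definition perfect_pairing :: "('y::ab_group_add \<Rightarrow> 'x::ab_group_add \<Rightarrow> int) \<Rightarrow> bool" where
  "perfect_pairing b \<longleftrightarrow>
     (\<forall>x. additive (\<lambda>y. b y x)) \<and> (\<forall>y. additive (b y)) \<and>
     (\<forall>h. additive h \<longrightarrow> (\<exists>!x. h = (\<lambda>y. b y x))) \<and>
     (\<forall>h. additive h \<longrightarrow> (\<exists>!y. h = b y))"

definition root_datum :: "('i, 'y::ab_group_add, 'x::ab_group_add) rdatum \<Rightarrow> bool" where
  "root_datum D \<longleftrightarrow>
     cartan_datum (idx D) (dot D) \<and>
     fg_free_abelian TYPE('y) \<and> fg_free_abelian TYPE('x) \<and>
     perfect_pairing (pairing D) \<and>
     inj_on (coroot D) (idx D) \<and> inj_on (root D) (idx D) \<and>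
     (\<forall>i\<in>idx D. \<forall>j\<in>idx D.
        dot D i i * pairing D (coroot D i) (root D j) = 2 * dot D i j)"

text \<open>
  In the contracted datum \<open>None\<close> is the new vertex and \<open>Some i\<close> an old one.  The function
  \<open>vertex_sum\<close> lists the summands of a vertex as an element of Z[I]; form, coroots and roots
  are transported along it.
\<close>

fun vertex_sum :: "'i \<Rightarrow> 'i \<Rightarrow> 'i option \<Rightarrow> 'i list" where
  "vertex_sum ip im None = [ip, im]"
| "vertex_sum ip im (Some i) = [i]"

definition contraction ::
  "('i, 'y::ab_group_add, 'x::ab_group_add) rdatum \<Rightarrow> 'i \<Rightarrow> 'i \<Rightarrow> ('i option, 'y, 'x) rdatum" where
  "contraction D ip im =
     \<lparr>idx = Some ` (idx D - {ip, im}) \<union> {None},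
      dot = (\<lambda>k l. \<Sum>i\<leftarrow>vertex_sum ip im k. \<Sum>j\<leftarrow>vertex_sum ip im l. dot D i j),
      pairing = pairing D,
      coroot = (\<lambda>k. \<Sum>i\<leftarrow>vertex_sum ip im k. coroot D i),
      root = (\<lambda>k. \<Sum>i\<leftarrow>vertex_sum ip im k. root D i)\<rparr>"


section \<open>The field Q(v) and quantum integers\<close>

type_synonym Qv = "rat poly fract"

definition v :: Qv where
  "v = Fract [:0, 1:] 1"

definition vi :: "('i, 'y, 'x) rdatum \<Rightarrow> 'i \<Rightarrow> Qv" where
  "vi D i = v powi (dot D i i div 2)"

definition qint :: "('i, 'y, 'x) rdatum \<Rightarrow> 'i \<Rightarrow> nat \<Rightarrow> Qv" where
  "qint D i n = (vi D i ^ n - inverse (vi D i) ^ n) / (vi D i - inverse (vi D i))"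

definition qfact :: "('i, 'y, 'x) rdatum \<Rightarrow> 'i \<Rightarrow> nat \<Rightarrow> Qv" where
  "qfact D i n = (\<Prod>m=1..n. qint D i m)"


section \<open>Free algebras\<close>

text \<open>
  The free algebra is the monoid algebra of the monoid of words.  Words are wrapped lists, so that
  concatenation can serve as the addition required by the convolution product on \<open>\<Rightarrow>\<^sub>0\<close>.
\<close>

datatype 'g word = Word (letters: "'g list")

instantiation word :: (type) monoid_add
begin

definition zero_word :: "'a word" where
  "0 = Word []"

definition plus_word :: "'a word \<Rightarrow> 'a word \<Rightarrow> 'a word" where
  "u + w = Word (letters u @ letters w)"

instance
  by standard (simp_all add: zero_word_def plus_word_def)

end

type_synonym 'g free = "'g word \<Rightarrow>\<^sub>0 Qv"

abbreviation scal :: "Qv \<Rightarrow> 'g free" where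
  "scal c \<equiv> Poly_Mapping.single 0 c"

abbreviation gen :: "'g \<Rightarrow> 'g free" where
  "gen g \<equiv> Poly_Mapping.single (Word [g]) 1"

definition free_alg :: "'g set \<Rightarrow> 'g free ring" where
  "free_alg G =
     \<lparr>carrier = {p. \<forall>w\<in>Poly_Mapping.keys p. set (letters w) \<subseteq> G},
      mult = (*), one = 1, ring.zero = 0, ring.add = (+)\<rparr>"

text \<open>The algebra map, respectively the algebra antihomomorphism, extending a map on generators.\<close>

definition free_hom :: "('g \<Rightarrow> 'h free) \<Rightarrow> 'g free \<Rightarrow> 'h free" where
  "free_hom h p =
     (\<Sum>w\<in>Poly_Mapping.keys p. scal (Poly_Mapping.lookup p w) * prod_list (map h (letters w)))"

definition free_antihom :: "('g \<Rightarrow> 'h free) \<Rightarrow> 'g free \<Rightarrow> 'h free" where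
  "free_antihom h p =
     (\<Sum>w\<in>Poly_Mapping.keys p. scal (Poly_Mapping.lookup p w) * prod_list (rev (map h (letters w))))"

definition div_power :: "('i, 'y, 'x) rdatum \<Rightarrow> ('i \<Rightarrow> 'g) \<Rightarrow> 'i \<Rightarrow> nat \<Rightarrow> 'g free" where
  "div_power D x i n = scal (1 / qfact D i n) * gen (x i) ^ n"

definition serre :: "('i, 'y, 'x) rdatum \<Rightarrow> ('i \<Rightarrow> 'g) \<Rightarrow> 'i \<Rightarrow> 'i \<Rightarrow> 'g free" where
  "serre D x i j =
     (let n = nat (1 - pairing D (coroot D i) (root D j))
      in \<Sum>r\<le>n. (-1) ^ r * div_power D x i (n - r) * gen (x j) * div_power D x i r)"

text \<open>A chosen representative of a coset.\<close>

definition rep :: "'a set \<Rightarrow> 'a" where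
  "rep C = (SOME p. p \<in> C)"


section \<open>The quantum group\<close>

datatype ('i, 'y) qgen = E 'i | F 'i | K 'y

definition qgens :: "('i, 'y, 'x) rdatum \<Rightarrow> ('i, 'y) qgen set" where
  "qgens D = E ` idx D \<union> F ` idx D \<union> range K"

definition Kt :: "('i, 'y::ab_group_add, 'x) rdatum \<Rightarrow> 'i \<Rightarrow> ('i, 'y) qgen" where
  "Kt D i = K (sum_list (replicate (nat (dot D i i div 2)) (coroot D i)))"

definition Kt_inv :: "('i, 'y::ab_group_add, 'x) rdatum \<Rightarrow> 'i \<Rightarrow> ('i, 'y) qgen" where
  "Kt_inv D i = K (- sum_list (replicate (nat (dot D i i div 2)) (coroot D i)))"

definition qrels :: "('i, 'y::ab_group_add, 'x) rdatum \<Rightarrow> ('i, 'y) qgen free set" where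
  "qrels D =
     {gen (K 0) - 1}
     \<union> {gen (K \<mu>) * gen (K \<nu>) - gen (K (\<mu> + \<nu>)) | \<mu> \<nu>. True}
     \<union> {gen (K \<mu>) * gen (E i)
           - scal (v powi pairing D \<mu> (root D i)) * gen (E i) * gen (K \<mu>) | \<mu> i. i \<in> idx D}
     \<union> {gen (K \<mu>) * gen (F i)
           - scal (v powi (- pairing D \<mu> (root D i))) * gen (F i) * gen (K \<mu>) | \<mu> i. i \<in> idx D}
     \<union> {gen (E i) * gen (F j) - gen (F j) * gen (E i)
           - (if i = j then scal (1 / (vi D i - inverse (vi D i))) * (gen (Kt D i) - gen (Kt_inv D i))
              else 0) | i j. i \<in> idx D \<and> j \<in> idx D}
     \<union> {serre D E i j | i j. i \<in> idx D \<and> j \<in> idx D \<and> i \<noteq> j}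
     \<union> {serre D F i j | i j. i \<in> idx D \<and> j \<in> idx D \<and> i \<noteq> j}"

definition qideal :: "('i, 'y::ab_group_add, 'x) rdatum \<Rightarrow> ('i, 'y) qgen free set" where
  "qideal D = Idl\<^bsub>free_alg (qgens D)\<^esub> (qrels D)"

definition UQ :: "('i, 'y::ab_group_add, 'x) rdatum \<Rightarrow> ('i, 'y) qgen free set ring" where
  "UQ D = free_alg (qgens D) Quot qideal D"

definition ucls :: "('i, 'y::ab_group_add, 'x) rdatum \<Rightarrow> ('i, 'y) qgen free \<Rightarrow> ('i, 'y) qgen free set" where
  "ucls D p = qideal D +>\<^bsub>free_alg (qgens D)\<^esub> p"

text \<open>The degree of a monomial, in X, and the homogeneous components for this X-grading.\<close>

fun gdeg :: "('i, 'y, 'x::ab_group_add) rdatum \<Rightarrow> ('i, 'y) qgen \<Rightarrow> 'x" where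
  "gdeg D (E i) = root D i"
| "gdeg D (F i) = - root D i"
| "gdeg D (K \<mu>) = 0"

definition wdeg :: "('i, 'y, 'x::ab_group_add) rdatum \<Rightarrow> ('i, 'y) qgen word \<Rightarrow> 'x" where
  "wdeg D w = sum_list (map (gdeg D) (letters w))"

definition hcomp :: "('i, 'y::ab_group_add, 'x::ab_group_add) rdatum \<Rightarrow> 'x
    \<Rightarrow> ('i, 'y) qgen free set \<Rightarrow> ('i, 'y) qgen free set" where
  "hcomp D d u =
     ucls D (\<Sum>w\<in>{w \<in> Poly_Mapping.keys (rep u). wdeg D w = d}.
               Poly_Mapping.single w (Poly_Mapping.lookup (rep u) w))"


section \<open>The modified quantum group\<close>

type_synonym ('i, 'y, 'x) dot_elt = "'x \<times> 'x \<Rightarrow> ('i, 'y) qgen free set set"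

text \<open>The subspace of U by which the component of weights \<open>a\<close>, \<open>b\<close> is divided.\<close>

definition wt_rel :: "('i, 'y::ab_group_add, 'x) rdatum \<Rightarrow> 'x \<Rightarrow> 'x \<Rightarrow> ('i, 'y) qgen free set set" where
  "wt_rel D a b = generate (add_monoid (UQ D))
     ({ucls D (gen (K \<mu>) - scal (v powi pairing D \<mu> a)) \<otimes>\<^bsub>UQ D\<^esub> u | \<mu> u. u \<in> carrier (UQ D)}
      \<union> {u \<otimes>\<^bsub>UQ D\<^esub> ucls D (gen (K \<mu>) - scal (v powi pairing D \<mu> b)) | \<mu> u. u \<in> carrier (UQ D)})"

text \<open>
  The additive group of the modified quantum group.  Direct sums are written multiplicatively in
  the library: \<open>x \<otimes>\<^bsub>Udot D\<^esub> y\<close> is the sum of \<open>x\<close> and \<open>y\<close>.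
\<close>

definition Udot :: "('i, 'y::ab_group_add, 'x) rdatum \<Rightarrow> ('i, 'y, 'x) dot_elt monoid" where
  "Udot D = sum_group UNIV (\<lambda>(a, b). UQ D A_Mod wt_rel D a b)"

definition dpi :: "('i, 'y::ab_group_add, 'x) rdatum \<Rightarrow> 'x \<Rightarrow> 'x
    \<Rightarrow> ('i, 'y) qgen free set \<Rightarrow> ('i, 'y, 'x) dot_elt" where
  "dpi D a b u = (\<lambda>(a', b'). if a' = a \<and> b' = b then wt_rel D a b +>\<^bsub>UQ D\<^esub> u else wt_rel D a' b')"

definition idem :: "('i, 'y::ab_group_add, 'x) rdatum \<Rightarrow> 'x \<Rightarrow> ('i, 'y, 'x) dot_elt" where
  "idem D l = dpi D l l \<one>\<^bsub>UQ D\<^esub>"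

text \<open>
  Bimodule structure and product, written out in components.  For \<open>t\<close> homogeneous of degree \<open>d\<close>,
  \<open>t \<pi>\<^bsub>c,b\<^esub>(s) = \<pi>\<^bsub>c+d,b\<^esub>(t s)\<close>, so the component (a, b) of \<open>u x\<close> collects, for every weight
  \<open>c\<close>, the component of \<open>u\<close> of degree \<open>a - c\<close> times a representative of \<open>x (c, b)\<close>; similarly
  on the right.  In the product, \<open>\<pi>\<^bsub>a,b\<^esub>(s)\<close> only depends on the component of \<open>s\<close> of degree
  \<open>a - b\<close> (the other components lie in \<open>wt_rel D a b\<close>).
\<close>

definition lact :: "('i, 'y::ab_group_add, 'x::ab_group_add) rdatum
    \<Rightarrow> ('i, 'y) qgen free set \<Rightarrow> ('i, 'y, 'x) dot_elt \<Rightarrow> ('i, 'y, 'x) dot_elt" where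
  "lact D u x = (\<lambda>(a, b). wt_rel D a b +>\<^bsub>UQ D\<^esub>
     (\<Oplus>\<^bsub>UQ D\<^esub>c\<in>{c. x (c, b) \<noteq> wt_rel D c b}. hcomp D (a - c) u \<otimes>\<^bsub>UQ D\<^esub> rep (x (c, b))))"

definition ract :: "('i, 'y::ab_group_add, 'x::ab_group_add) rdatum
    \<Rightarrow> ('i, 'y, 'x) dot_elt \<Rightarrow> ('i, 'y) qgen free set \<Rightarrow> ('i, 'y, 'x) dot_elt" where
  "ract D x u = (\<lambda>(a, b). wt_rel D a b +>\<^bsub>UQ D\<^esub>
     (\<Oplus>\<^bsub>UQ D\<^esub>c\<in>{c. x (a, c) \<noteq> wt_rel D a c}. rep (x (a, c)) \<otimes>\<^bsub>UQ D\<^esub> hcomp D (c - b) u))"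

definition dmult :: "('i, 'y::ab_group_add, 'x::ab_group_add) rdatum
    \<Rightarrow> ('i, 'y, 'x) dot_elt \<Rightarrow> ('i, 'y, 'x) dot_elt \<Rightarrow> ('i, 'y, 'x) dot_elt" where
  "dmult D x y = (\<lambda>(a, b). wt_rel D a b +>\<^bsub>UQ D\<^esub>
     (\<Oplus>\<^bsub>UQ D\<^esub>c\<in>{c. x (a, c) \<noteq> wt_rel D a c \<and> y (c, b) \<noteq> wt_rel D c b}.
        hcomp D (a - c) (rep (x (a, c))) \<otimes>\<^bsub>UQ D\<^esub> hcomp D (c - b) (rep (y (c, b)))))"

definition dscale :: "('i, 'y::ab_group_add, 'x::ab_group_add) rdatum
    \<Rightarrow> Qv \<Rightarrow> ('i, 'y, 'x) dot_elt \<Rightarrow> ('i, 'y, 'x) dot_elt" where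
  "dscale D c x = lact D (ucls D (scal c)) x"


section \<open>The algebra f and its form\<close>

definition fideal :: "('i, 'y, 'x) rdatum \<Rightarrow> 'i free set" where
  "fideal D = Idl\<^bsub>free_alg (idx D)\<^esub>
     {serre D (\<lambda>i. i) i j | i j. i \<in> idx D \<and> j \<in> idx D \<and> i \<noteq> j}"

definition falg :: "('i, 'y, 'x) rdatum \<Rightarrow> 'i free set ring" where
  "falg D = free_alg (idx D) Quot fideal D"

definition fcls :: "('i, 'y, 'x) rdatum \<Rightarrow> 'i free \<Rightarrow> 'i free set" where
  "fcls D p = fideal D +>\<^bsub>free_alg (idx D)\<^esub> p"

definition wdot :: "('i, 'y, 'x) rdatum \<Rightarrow> 'i word \<Rightarrow> 'i word \<Rightarrow> int" where
  "wdot D u w = (\<Sum>i\<leftarrow>letters u. \<Sum>j\<leftarrow>letters w. dot D i j)"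

text \<open>
  The tensor square of the free algebra, with basis the pairs of words, its twisted product, and
  the coproduct r of a word.
\<close>

definition twist_mult :: "('i, 'y, 'x) rdatum
    \<Rightarrow> ('i word \<times> 'i word \<Rightarrow>\<^sub>0 Qv) \<Rightarrow> ('i word \<times> 'i word \<Rightarrow>\<^sub>0 Qv) \<Rightarrow> ('i word \<times> 'i word \<Rightarrow>\<^sub>0 Qv)" where
  "twist_mult D s t =
     (\<Sum>(x, y)\<in>Poly_Mapping.keys s. \<Sum>(x', y')\<in>Poly_Mapping.keys t.
        Poly_Mapping.single (x + x', y + y')
          (v powi wdot D y x' * Poly_Mapping.lookup s (x, y) * Poly_Mapping.lookup t (x', y')))"

fun coprod_word :: "('i, 'y, 'x) rdatum \<Rightarrow> 'i list \<Rightarrow> ('i word \<times> 'i word \<Rightarrow>\<^sub>0 Qv)" where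
  "coprod_word D [] = Poly_Mapping.single (0, 0) 1"
| "coprod_word D (i # is) =
     twist_mult D (Poly_Mapping.single (Word [i], 0) 1 + Poly_Mapping.single (0, Word [i]) 1)
       (coprod_word D is)"

text \<open>
  The pairing of \<open>x \<otimes> x'\<close> with \<open>r(q)\<close>, for \<open>q\<close> in the free algebra, with respect to the form
  on the tensor square induced by \<open>Bf\<close>.
\<close>

definition coprod_pairing :: "('i, 'y, 'x) rdatum \<Rightarrow> ('i free set \<Rightarrow> 'i free set \<Rightarrow> Qv)
    \<Rightarrow> 'i free set \<Rightarrow> 'i free set \<Rightarrow> 'i free \<Rightarrow> Qv" where
  "coprod_pairing D Bf x x' q =
     (\<Sum>w\<in>Poly_Mapping.keys q. Poly_Mapping.lookup q w *
        (\<Sum>(a, b)\<in>Poly_Mapping.keys (coprod_word D (letters w)).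
           Poly_Mapping.lookup (coprod_word D (letters w)) (a, b)
             * Bf x (fcls D (Poly_Mapping.single a 1)) * Bf x' (fcls D (Poly_Mapping.single b 1))))"

text \<open>
  Here and in \<open>dot_form\<close> below, an algebra map on a presented algebra is given on the free algebra
  and the axiom is imposed for all representatives.  The maps in question descend to the
  quotients, so this is the same as an axiom for all elements.
\<close>

definition f_form :: "('i, 'y, 'x) rdatum \<Rightarrow> ('i free set \<Rightarrow> 'i free set \<Rightarrow> Qv) \<Rightarrow> bool" where
  "f_form D Bf \<longleftrightarrow>
     (\<forall>x\<in>carrier (falg D). \<forall>y\<in>carrier (falg D). Bf x y = Bf y x) \<and>
     (\<forall>x\<in>carrier (falg D). \<forall>x'\<in>carrier (falg D). \<forall>y\<in>carrier (falg D).
        Bf (x \<oplus>\<^bsub>falg D\<^esub> x') y = Bf x y + Bf x' y) \<and>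
     (\<forall>c. \<forall>x\<in>carrier (falg D). \<forall>y\<in>carrier (falg D).
        Bf (fcls D (scal c) \<otimes>\<^bsub>falg D\<^esub> x) y = c * Bf x y) \<and>
     Bf \<one>\<^bsub>falg D\<^esub> \<one>\<^bsub>falg D\<^esub> = 1 \<and>
     (\<forall>i\<in>idx D. \<forall>j\<in>idx D.
        Bf (fcls D (gen i)) (fcls D (gen j)) = (if i = j then inverse (1 - vi D i powi (-2)) else 0)) \<and>
     (\<forall>x\<in>carrier (falg D). \<forall>x'\<in>carrier (falg D). \<forall>q\<in>carrier (free_alg (idx D)).
        Bf (x \<otimes>\<^bsub>falg D\<^esub> x') (fcls D q) = coprod_pairing D Bf x x' q)"


section \<open>The form on the modified quantum group\<close>

fun rho_gen :: "('i, 'y::ab_group_add, 'x) rdatum \<Rightarrow> ('i, 'y) qgen \<Rightarrow> ('i, 'y) qgen free" where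
  "rho_gen D (E i) = scal (vi D i) * gen (Kt D i) * gen (F i)"
| "rho_gen D (F i) = scal (vi D i) * gen (Kt_inv D i) * gen (E i)"
| "rho_gen D (K \<mu>) = gen (K \<mu>)"

definition rho :: "('i, 'y::ab_group_add, 'x) rdatum \<Rightarrow> ('i, 'y) qgen free \<Rightarrow> ('i, 'y) qgen free" where
  "rho D = free_antihom (rho_gen D)"

definition minus_emb :: "'i free \<Rightarrow> ('i, 'y) qgen free" where
  "minus_emb = free_hom (\<lambda>i. gen (F i))"

definition dot_form :: "('i, 'y::ab_group_add, 'x::ab_group_add) rdatum
    \<Rightarrow> (('i, 'y, 'x) dot_elt \<Rightarrow> ('i, 'y, 'x) dot_elt \<Rightarrow> Qv) \<Rightarrow> bool" where
  "dot_form D B \<longleftrightarrow>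
     (\<forall>x\<in>carrier (Udot D). \<forall>x'\<in>carrier (Udot D). \<forall>y\<in>carrier (Udot D).
        B (x \<otimes>\<^bsub>Udot D\<^esub> x') y = B x y + B x' y \<and> B y (x \<otimes>\<^bsub>Udot D\<^esub> x') = B y x + B y x') \<and>
     (\<forall>c. \<forall>x\<in>carrier (Udot D). \<forall>y\<in>carrier (Udot D).
        B (dscale D c x) y = c * B x y \<and> B x (dscale D c y) = c * B x y) \<and>
     (\<forall>u\<in>carrier (UQ D). \<forall>u'\<in>carrier (UQ D). \<forall>a b a' b'.
        \<not> (a = a' \<and> b = b') \<longrightarrow>
        B (dmult D (ract D (idem D a) u) (idem D b)) (dmult D (ract D (idem D a') u') (idem D b')) = 0) \<and>
     (\<forall>p\<in>carrier (free_alg (qgens D)). \<forall>x\<in>carrier (Udot D). \<forall>y\<in>carrier (Udot D).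
        B (lact D (ucls D p) x) y = B x (lact D (ucls D (rho D p)) y)) \<and>
     (\<exists>Bf. f_form D Bf \<and>
        (\<forall>p\<in>carrier (free_alg (idx D)). \<forall>q\<in>carrier (free_alg (idx D)). \<forall>l.
           B (lact D (ucls D (minus_emb p)) (idem D l)) (lact D (ucls D (minus_emb q)) (idem D l))
             = Bf (fcls D p) (fcls D q)))"


section \<open>The embedding attached to the edge contraction\<close>

fun Psi_gen :: "('i, 'y::ab_group_add, 'x::ab_group_add) rdatum \<Rightarrow> 'i \<Rightarrow> 'i \<Rightarrow> int
    \<Rightarrow> ('i option, 'y) qgen \<Rightarrow> ('i, 'y) qgen free" where
  "Psi_gen D ip im \<epsilon> (E (Some i)) = gen (E i)"
| "Psi_gen D ip im \<epsilon> (F (Some i)) = gen (F i)"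
| "Psi_gen D ip im \<epsilon> (K \<mu>) = gen (K \<mu>)"
| "Psi_gen D ip im \<epsilon> (E None) =
     gen (E ip) * gen (E im)
       - scal (vi (contraction D ip im) None powi (- \<epsilon>)) * gen (E im) * gen (E ip)"
| "Psi_gen D ip im \<epsilon> (F None) =
     gen (F im) * gen (F ip)
       - scal (vi (contraction D ip im) None powi \<epsilon>) * gen (F ip) * gen (F im)"

text \<open>
  The map induced on the quotient algebras.  It is evaluated on a representative, the result being
  independent of the choice because the images of the generators satisfy the defining relations of
  the source.
\<close>

definition Psi :: "('i, 'y::ab_group_add, 'x::ab_group_add) rdatum \<Rightarrow> 'i \<Rightarrow> 'i \<Rightarrow> int
    \<Rightarrow> ('i option, 'y) qgen free set \<Rightarrow> ('i, 'y) qgen free set" where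
  "Psi D ip im \<epsilon> u = ucls D (free_hom (Psi_gen D ip im \<epsilon>) (rep u))"

definition Psi_dot :: "('i, 'y::ab_group_add, 'x::ab_group_add) rdatum \<Rightarrow> 'i \<Rightarrow> 'i \<Rightarrow> int
    \<Rightarrow> ('i option, 'y, 'x) dot_elt \<Rightarrow> ('i, 'y, 'x) dot_elt" where
  "Psi_dot D ip im \<epsilon> x = (\<lambda>(a, b). wt_rel D a b +>\<^bsub>UQ D\<^esub> Psi D ip im \<epsilon> (rep (x (a, b))))"

end

theory Submission
  imports Defs
begin

text \<open>
  Write \<open>p\<close>, \<open>m\<close> for the contracted vertices, \<open>0\<close> for the new one, \<open>q\<close> for the common value of
  \<open>v\<^sub>p\<close>, \<open>v\<^sub>m\<close> and \<open>v\<^sub>0\<close>, and \<open>\<Psi>\<^sub>\<epsilon>\<close> for the embedding.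

  The form on the modified quantum group is determined by the orthogonality of the components, by its
  adjunction with respect to \<open>rho\<close>, and by its values on \<open>F\<close>-words (\<open>form_unique\<close>): the
  adjunction moves all generators to one argument, there the relations between the \<open>E\<close>, \<open>F\<close> and
  \<open>K\<close> produce a combination of products of an \<open>E\<close>-word and an \<open>F\<close>-word, and the \<open>E\<close>-word
  goes back as an \<open>F\<close>-word.  So it suffices to see that the form of the large quantum group, pulled
  back along \<open>\<Psi>\<^sub>\<epsilon>\<close> in one argument and \<open>\<Psi>\<close> with sign \<open>- \<epsilon>\<close> in the other, has the same
  properties.  The adjunction is inherited because \<open>rho\<close> exchanges the two signs (\<open>rho_\<Psi>\<close>).

  On \<open>F\<close>-words the form is that of the algebra f, where left multiplication by \<open>\<theta>\<^sub>i\<close> is adjoint to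
  a multiple of a twisted derivation \<open>\<partial>\<^sub>i\<close> (\<open>b_adjoint\<close>).  The image of the map with sign \<open>- 1\<close> is
  killed by \<open>\<partial>\<^sub>p\<close>, and there \<open>\<partial>\<^sub>p \<partial>\<^sub>m\<close> is the twisted derivation that corresponds to
  \<open>\<partial>\<^sub>0\<close>, up to the scalar that compares the norms of the generators.  This gives the
  equality of the two forms on words by induction (\<open>half_form_contraction\<close>).

  All this is a computation in free algebras.  The embedding must moreover be defined on the quantum
  group, that is, the images of the generators must satisfy the relations of the contracted datum
  (\<open>quantum_rep_contraction\<close>).  The hard case is the Serre relation between \<open>E\<^sub>0\<close> and \<open>E\<^sub>j\<close>
  (\<open>contracted_serre\<close>).  A Serre relation says that a twisted derivation, the adjoint action
  \<open>\<delta>\<^sub>i\<close> of \<open>E\<^sub>i\<close>, is nilpotent on \<open>E\<^sub>j\<close> of a certain order.  Since \<open>E\<^sub>j\<close> is a lowest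
  weight vector for the sl2 of the vertex \<open>0\<close>, any order of nilpotency implies the right one
  (\<open>\<delta>_pow_lowest_weight\<close>).  To see nilpotency, let \<open>z\<close> be the last nonzero vector among the images of
  \<open>E\<^sub>j\<close> under the powers of \<open>\<delta>\<^sub>p\<close>.  If \<open>\<delta>\<^sub>m\<close> is taken with the opposite twist, its commutator
  with \<open>\<delta>\<^sub>p\<close> is a twisted commutator with \<open>E\<^sub>0\<close>.  Applying a high power of \<open>\<delta>\<^sub>m\<close>
  and then of \<open>\<delta>\<^sub>p\<close> to \<open>z\<close> therefore gives, on the one hand, zero and, on the other hand, a multiple
  of a power of \<open>\<delta>\<^sub>0\<close> applied to \<open>z\<close> (\<open>p_pow_mb_pow\<close>).  Finally \<open>E\<^sub>j\<close> is recovered from \<open>z\<close>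
  by commutators with \<open>F\<^sub>p K\<^sub>p\<close>, on which \<open>\<delta>\<^sub>0\<close> is nilpotent, and nilpotent elements form a
  subalgebra.
\<close>


section \<open>Free algebras and evaluation\<close>

lemma letters_add [simp]: "letters (u + w) = letters u @ letters w"
  by (simp add: plus_word_def)

lemma letters_zero [simp]: "letters 0 = []"
  by (simp add: zero_word_def)

lemma scal_mult_single: "scal c * Poly_Mapping.single w d = Poly_Mapping.single w (c * d)"
  by (simp add: mult_single)

abbreviation wmon :: "'g list \<Rightarrow> Qv \<Rightarrow> 'g free" where
  "wmon w \<equiv> Poly_Mapping.single (Word w)"

lemma single_Word_Cons:
  "wmon (g # w) c = gen g * wmon w c"
  by (simp add: mult_single plus_word_def)

lemma free_alg_carrier_iff:
  "p \<in> carrier (free_alg G) \<longleftrightarrow> (\<forall>w\<in>Poly_Mapping.keys p. set (letters w) \<subseteq> G)"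
  by (simp add: free_alg_def)

lemma sum_monomials: "p = (\<Sum>w\<in>Poly_Mapping.keys p. Poly_Mapping.single w (Poly_Mapping.lookup p w))"
proof (rule poly_mapping_eqI)
  fix k
  show "Poly_Mapping.lookup p k = Poly_Mapping.lookup
     (\<Sum>w\<in>Poly_Mapping.keys p. Poly_Mapping.single w (Poly_Mapping.lookup p w)) k"
    by (simp add: lookup_sum lookup_single when_def not_in_keys_iff_lookup_eq_zero)
qed

lemma monomial_induct [consumes 1, case_names zero single add]:
  assumes p: "p \<in> carrier (free_alg G)"
    and zero: "P 0"
    and single: "\<And>w c. set w \<subseteq> G \<Longrightarrow> P (wmon w c)"
    and add: "\<And>p q. p \<in> carrier (free_alg G) \<Longrightarrow> q \<in> carrier (free_alg G) \<Longrightarrow> P p \<Longrightarrow> P q \<Longrightarrow> P (p + q)"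
  shows "P p"
proof -
  let ?m = "\<lambda>w. Poly_Mapping.single w (Poly_Mapping.lookup p w)"
  have "A \<subseteq> Poly_Mapping.keys p \<Longrightarrow> P (sum ?m A) \<and> sum ?m A \<in> carrier (free_alg G)"
    if "finite A" for A
    using that
  proof (induction A rule: finite_induct)
    case empty
    then show ?case by (simp add: zero free_alg_def)
  next
    case (insert w A)
    have w: "set (letters w) \<subseteq> G"
      using p insert.prems by (auto simp: free_alg_carrier_iff)
    have "?m w \<in> carrier (free_alg G)"
      using w by (auto simp: free_alg_carrier_iff)
    moreover have "P (?m w)"
      using single[OF w, of "Poly_Mapping.lookup p w"] by simp
    moreover have "?m w + sum ?m A \<in> carrier (free_alg G)"
      using insert w keys_add[of "?m w" "sum ?m A"] by (fastforce simp: free_alg_carrier_iff split: if_splits)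
    ultimately show ?case
      using insert by (auto intro: add)
  qed
  from this[of "Poly_Mapping.keys p"] show ?thesis
    using sum_monomials[of p] by simp
qed

lemma free_alg_UNIV: "p \<in> carrier (free_alg UNIV)"
  by (simp add: free_alg_def)

text \<open>
  A ring with a central copy of the field, that is, an algebra over it.  The locale serves the free
  algebras, arbitrary rings in which the relations of the quantum group hold, and the field itself.
\<close>

locale central_scalars =
  fixes s :: "Qv \<Rightarrow> 'a::ring_1"
  assumes s_add: "s (c + d) = s c + s d"
    and s_mult: "s (c * d) = s c * s d"
    and s_one [simp]: "s 1 = 1"
    and s_comm: "x * s c = s c * x"
begin

lemma s_zero [simp]: "s 0 = 0"
  using s_add[of 0 0] by simp

lemma s_minus: "s (- c) = - s c"
  using s_add[of c "- c"] by (simp add: eq_neg_iff_add_eq_0 add.commute)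

lemma s_diff: "s (c - d) = s c - s d"
  using s_add[of c "- d"] by (simp add: s_minus)

lemma s_left_comm: "x * (s c * y) = s c * (x * y)"
  by (metis mult.assoc s_comm)

lemma s_assoc: "s c * (s d * x) = s (c * d) * x"
  by (simp add: s_mult mult.assoc)

lemma s_power: "s (c ^ n) = s c ^ n"
  by (induction n) (simp_all add: s_mult)

end

text \<open>
  Extending a function on words linearly.  Evaluation homomorphisms, and the antihomomorphisms,
  are the extensions of (anti)multiplicative functions.
\<close>

definition word_sum :: "(Qv \<Rightarrow> 'a::ring_1) \<Rightarrow> ('w \<Rightarrow> 'a) \<Rightarrow> ('w \<Rightarrow>\<^sub>0 Qv) \<Rightarrow> 'a" where
  "word_sum s \<phi> p = (\<Sum>w\<in>Poly_Mapping.keys p. s (Poly_Mapping.lookup p w) * \<phi> w)"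

definition evl :: "(Qv \<Rightarrow> 'a::ring_1) \<Rightarrow> ('g \<Rightarrow> 'a) \<Rightarrow> 'g free \<Rightarrow> 'a" where
  "evl s h = word_sum s (\<lambda>w. prod_list (map h (letters w)))"

context central_scalars
begin

lemma word_sum_superset:
  assumes "finite A" "Poly_Mapping.keys p \<subseteq> A"
  shows "word_sum s \<phi> p = (\<Sum>w\<in>A. s (Poly_Mapping.lookup p w) * \<phi> w)"
  unfolding word_sum_def
  by (rule sum.mono_neutral_left) (use assms in \<open>auto simp: not_in_keys_iff_lookup_eq_zero\<close>)

lemma word_sum_add: "word_sum s \<phi> (p + q) = word_sum s \<phi> p + word_sum s \<phi> q"
proof -
  let ?A = "Poly_Mapping.keys p \<union> Poly_Mapping.keys q"
  have "word_sum s \<phi> (p + q) = (\<Sum>w\<in>?A. s (Poly_Mapping.lookup (p + q) w) * \<phi> w)"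
    by (rule word_sum_superset) (auto dest: keys_add[THEN subsetD])
  then show ?thesis
    by (simp add: word_sum_superset[of ?A] lookup_add s_add algebra_simps sum.distrib)
qed

lemma word_sum_zero [simp]: "word_sum s \<phi> 0 = 0"
  by (simp add: word_sum_def)

lemma word_sum_single: "word_sum s \<phi> (Poly_Mapping.single w c) = s c * \<phi> w"
  by (simp add: word_sum_def)

lemma word_sum_minus: "word_sum s \<phi> (- p) = - word_sum s \<phi> p"
  using word_sum_add[of \<phi> p "- p"] by (simp add: eq_neg_iff_add_eq_0 add.commute)

lemma word_sum_diff: "word_sum s \<phi> (p - q) = word_sum s \<phi> p - word_sum s \<phi> q"
  using word_sum_add[of \<phi> p "- q"] by (simp add: word_sum_minus)

lemma evl_add: "evl s h (p + q) = evl s h p + evl s h q"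
  and evl_diff: "evl s h (p - q) = evl s h p - evl s h q"
  and evl_minus: "evl s h (- p) = - evl s h p"
  and evl_zero [simp]: "evl s h 0 = 0"
  by (simp_all add: evl_def word_sum_add word_sum_diff word_sum_minus)

lemma evl_single: "evl s h (Poly_Mapping.single w c) = s c * prod_list (map h (letters w))"
  by (simp add: evl_def word_sum_single)

lemma evl_scal: "evl s h (scal c) = s c"
  and evl_gen: "evl s h (gen g) = h g"
  and evl_one: "evl s h 1 = 1"
  by (simp_all add: evl_single single_one[symmetric] del: single_one)

lemma evl_mult: "evl s h (p * q) = evl s h p * evl s h q"
proof (induction p rule: monomial_induct[OF free_alg_UNIV])
  case (2 w c)
  show ?case
  proof (induction q rule: monomial_induct[OF free_alg_UNIV])
    case (2 w' c')
    have "evl s h (wmon w c * wmon w' c') =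
       s (c * c') * (prod_list (map h w) * prod_list (map h w'))"
      by (simp add: mult_single evl_single)
    also have "\<dots> = s c * (s c' * prod_list (map h w)) * prod_list (map h w')"
      by (simp add: s_mult mult.assoc)
    also have "\<dots> = s c * prod_list (map h w) * (s c' * prod_list (map h w'))"
      using s_left_comm[of "prod_list (map h w)" c' "prod_list (map h w')"] by (simp add: mult.assoc)
    finally show ?case
      by (simp add: evl_single)
  qed (simp_all add: evl_add distrib_left)
qed (simp_all add: evl_add distrib_right)

lemma evl_power: "evl s h (p ^ n) = evl s h p ^ n"
  by (induction n) (simp_all add: evl_mult evl_one)

lemma evl_sum: "evl s h (sum f A) = (\<Sum>a\<in>A. evl s h (f a))"
  by (induction A rule: infinite_finite_induct) (simp_all add: evl_add)

lemma evl_prod_list: "evl s h (prod_list ps) = prod_list (map (evl s h) ps)"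
  by (induction ps) (simp_all add: evl_mult evl_one)

lemmas evl_simps = evl_add evl_diff evl_minus evl_zero evl_scal evl_gen evl_one evl_mult evl_power
  evl_sum evl_prod_list

end

lemma scal_commute: "p * scal c = scal c * p"
proof (induction p rule: monomial_induct[OF free_alg_UNIV])
  case (2 w d)
  show ?case by (simp add: mult_single mult.commute)
qed (simp_all add: algebra_simps)

interpretation free: central_scalars scal
  by unfold_locales (simp_all add: single_add mult_single, rule scal_commute)

lemma free_hom_evl: "free_hom h = evl scal h"
  by (simp add: fun_eq_iff free_hom_def evl_def word_sum_def)

lemma free_antihom_word_sum:
  "free_antihom h = word_sum scal (\<lambda>w. prod_list (rev (map h (letters w))))"
  by (simp add: fun_eq_iff free_antihom_def word_sum_def)

lemma (in central_scalars) evl_free_hom: "evl s h (free_hom f p) = evl s (evl s h \<circ> f) p"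
proof (induction p rule: monomial_induct[OF free_alg_UNIV])
  case (2 w c)
  show ?case by (simp add: free_hom_evl free.evl_single evl_mult evl_scal evl_single evl_prod_list comp_def)
qed (simp_all add: free_hom_evl free.evl_add evl_add)

lemma ring_free_alg: "ring (free_alg G)"
proof (rule ringI)
  have add: "p + q \<in> carrier (free_alg G)" if "p \<in> carrier (free_alg G)" "q \<in> carrier (free_alg G)" for p q
    using that keys_add[of p q] by (fastforce simp: free_alg_carrier_iff)
  have uminus: "- p \<in> carrier (free_alg G)" if "p \<in> carrier (free_alg G)" for p
    using that by (simp add: free_alg_carrier_iff in_keys_iff)
  show "abelian_group (free_alg G)"
  proof (rule abelian_groupI)
    fix p assume p: "p \<in> carrier (free_alg G)"
    show "\<exists>q\<in>carrier (free_alg G). q \<oplus>\<^bsub>free_alg G\<^esub> p = \<zero>\<^bsub>free_alg G\<^esub>"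
      using uminus[OF p] by (intro bexI[of _ "- p"]) (simp_all add: free_alg_def)
  next
    fix p q assume "p \<in> carrier (free_alg G)" "q \<in> carrier (free_alg G)"
    then show "p \<oplus>\<^bsub>free_alg G\<^esub> q \<in> carrier (free_alg G)"
      using add[of p q] by (simp add: free_alg_def)
  qed (simp_all add: free_alg_def add.assoc add.commute)
  have mult: "p * q \<in> carrier (free_alg G)" if "p \<in> carrier (free_alg G)" "q \<in> carrier (free_alg G)" for p q
    using that keys_mult[of p q] by (fastforce simp: free_alg_carrier_iff)
  show "monoid (free_alg G)"
  proof (rule monoidI)
    fix p q assume "p \<in> carrier (free_alg G)" "q \<in> carrier (free_alg G)"
    then show "p \<otimes>\<^bsub>free_alg G\<^esub> q \<in> carrier (free_alg G)"
      using mult[of p q] by (simp add: free_alg_def)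
  qed (simp_all add: free_alg_def mult.assoc)
qed (simp_all add: free_alg_def algebra_simps)

section \<open>Quantum integers\<close>

lemma v_nonzero: "v \<noteq> 0"
  by (simp add: v_def Zero_fract_def eq_fract)

lemma v_power: "v ^ n = Fract (monom 1 n) 1"
proof (induction n)
  case (Suc n)
  have "[:0, 1:] = monom (1::rat) 1" by (simp add: monom_altdef)
  then show ?case using Suc by (simp add: v_def mult_monom)
qed (simp add: One_fract_def)

lemma v_powi_eq_one: "v powi n = 1 \<longleftrightarrow> n = 0"
proof -
  have *: "v ^ m = 1 \<longleftrightarrow> m = 0" for m
    by (simp add: v_power One_fract_def eq_fract monom_eq_1_iff)
  show ?thesis
    by (cases "n \<ge> 0") (auto simp: power_int_def * power_inverse)
qed

definition qi :: "Qv \<Rightarrow> int \<Rightarrow> Qv" where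
  "qi q n = (q powi n - q powi (- n)) / (q - inverse q)"

definition qf :: "Qv \<Rightarrow> nat \<Rightarrow> Qv" where
  "qf q n = (\<Prod>m=1..n. qi q (int m))"

text \<open>A parameter that is not a root of unity; then no nonzero quantum integer vanishes.\<close>

locale generic =
  fixes q :: Qv
  assumes q_nonzero [simp]: "q \<noteq> 0"
    and q_generic: "q powi n = 1 \<Longrightarrow> n = 0"
begin

lemma q_cancel [simp]: "q * (inverse q * c) = c" "inverse q * (q * c) = c"
  by (simp_all flip: mult.assoc)

lemma q_diff_nonzero: "q - inverse q \<noteq> 0"
proof
  assume "q - inverse q = 0"
  then have "q * q = q * inverse q" by simp
  then have "q powi 2 = 1" by (simp add: power2_eq_square)
  from q_generic[OF this] show False by simp
qed

lemma q_powi_diff_nonzero: "q powi n - q powi (- n) = 0 \<Longrightarrow> n = 0"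
proof -
  assume "q powi n - q powi (- n) = 0"
  then have "q powi n * q powi n = q powi n * q powi (- n)" by simp
  then have "q powi (n + n) = 1" by (simp flip: power_int_add)
  from q_generic[OF this] show ?thesis by simp
qed

lemma qi_eq_0_iff: "qi q n = 0 \<longleftrightarrow> n = 0"
  using q_diff_nonzero q_powi_diff_nonzero[of n] by (auto simp: qi_def)

lemma qi_0 [simp]: "qi q 0 = 0" and qi_1 [simp]: "qi q 1 = 1"
  using q_diff_nonzero by (simp_all add: qi_def power_int_minus)

lemma qf_nonzero: "qf q n \<noteq> 0"
  by (simp add: qf_def qi_eq_0_iff)

lemma qf_0 [simp]: "qf q 0 = 1" and qf_Suc: "qf q (Suc n) = qi q (int (Suc n)) * qf q n"
  by (simp_all add: qf_def)

lemma qi_add: "qi q (m + n) = q powi (- n) * qi q m + q powi m * qi q n"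
proof -
  have "q powi (m + n) - q powi (- (m + n))
      = q powi (- n) * (q powi m - q powi (- m)) + q powi m * (q powi n - q powi (- n))"
    by (simp add: algebra_simps flip: power_int_add)
  then show ?thesis by (simp add: qi_def add_divide_distrib)
qed

lemma qi_add': "qi q (m + n) = q powi n * qi q m + q powi (- m) * qi q n"
  using qi_add[of n m] by (simp add: add.commute)

lemma generic_inverse: "generic (inverse q)"
  by unfold_locales (auto dest: q_generic simp: power_int_inverse)

lemma qi_inverse: "qi (inverse q) n = qi q n"
proof -
  have "(q powi (- n) - q powi n) / (inverse q - q) = (q powi n - q powi (- n)) / (q - inverse q)"
    using q_diff_nonzero by (metis minus_diff_eq minus_divide_divide)
  moreover have "inverse q powi n = q powi (- n)" "inverse q powi (- n) = q powi n"
    by (simp_all add: power_int_inverse power_int_minus)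
  ultimately show ?thesis by (simp only: qi_def inverse_inverse_eq)
qed

lemma qf_inverse: "qf (inverse q) n = qf q n"
  by (simp add: qf_def qi_inverse)

end

section \<open>Twisted adjoint operators\<close>

context central_scalars
begin

definition scl :: "Qv \<Rightarrow> 'a \<Rightarrow> 'a"  (infixr \<open>\<bullet>\<close> 75) where
  "c \<bullet> x = s c * x"

lemma scl_simps [simp]:
  "(c \<bullet> x) * y = c \<bullet> (x * y)" "x * (c \<bullet> y) = c \<bullet> (x * y)" "c \<bullet> d \<bullet> x = (c * d) \<bullet> x"
  "1 \<bullet> x = x" "0 \<bullet> x = 0" "c \<bullet> 0 = 0" "c \<bullet> (- x) = - (c \<bullet> x)" "(- c) \<bullet> x = - (c \<bullet> x)"
  using s_left_comm[of x c y] by (simp_all add: scl_def mult.assoc s_mult s_minus)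

lemma scl_right: "c \<bullet> (x + y) = c \<bullet> x + c \<bullet> y" "c \<bullet> (x - y) = c \<bullet> x - c \<bullet> y"
  and scl_left: "(c + d) \<bullet> x = c \<bullet> x + d \<bullet> x" "(c - d) \<bullet> x = c \<bullet> x - d \<bullet> x"
  by (simp_all add: scl_def algebra_simps s_add s_diff)

lemma scl_sum: "c \<bullet> sum g A = (\<Sum>a\<in>A. c \<bullet> g a)"
  by (simp add: scl_def sum_distrib_left)

lemma scl_eq_0: "c \<bullet> x = 0 \<Longrightarrow> c \<noteq> 0 \<Longrightarrow> x = 0"
  by (metis scl_simps(3,4,6) left_inverse)

end

text \<open>
  The adjoint action of the positive half of quantum sl2, written with the twist explicit.
\<close>

locale borel = central_scalars s + generic q for s :: "Qv \<Rightarrow> 'a::ring_1" and q +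
  fixes E K L :: 'a
  assumes KL: "K * L = 1" and LK: "L * K = 1" and KE: "K * E = q^2 \<bullet> (E * K)"
begin

definition \<sigma> :: "'a \<Rightarrow> 'a" where "\<sigma> x = K * x * L"
definition \<delta> :: "'a \<Rightarrow> 'a" where "\<delta> x = E * x - \<sigma> x * E"

lemma KL_assoc: "K * (L * x) = x" and LK_assoc: "L * (K * x) = x"
  by (simp_all add: KL LK flip: mult.assoc)

lemma \<sigma>_mult: "\<sigma> (x * y) = \<sigma> x * \<sigma> y"
  by (simp add: \<sigma>_def mult.assoc LK_assoc)

lemma \<sigma>_linear: "\<sigma> (x + y) = \<sigma> x + \<sigma> y" "\<sigma> (x - y) = \<sigma> x - \<sigma> y" "\<sigma> (c \<bullet> x) = c \<bullet> \<sigma> x" "\<sigma> 0 = 0"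
  by (simp_all add: \<sigma>_def algebra_simps)

lemma \<sigma>_E: "\<sigma> E = q^2 \<bullet> E"
  by (simp add: \<sigma>_def KE mult.assoc KL)

lemma LE: "L * E = inverse (q^2) \<bullet> (E * L)"
proof -
  have "E * L = L * (K * E) * L" by (simp add: LK_assoc)
  also have "\<dots> = q^2 \<bullet> (L * E)" by (simp add: KE mult.assoc KL)
  finally show ?thesis by simp
qed

lemma \<delta>_linear: "\<delta> (x + y) = \<delta> x + \<delta> y" "\<delta> (x - y) = \<delta> x - \<delta> y" "\<delta> (c \<bullet> x) = c \<bullet> \<delta> x" "\<delta> 0 = 0"
  by (simp_all add: \<delta>_def \<sigma>_linear algebra_simps scl_right)

lemma \<delta>_mult: "\<delta> (x * y) = \<delta> x * y + \<sigma> x * \<delta> y"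
  by (simp add: \<delta>_def \<sigma>_mult algebra_simps)

lemma \<sigma>_\<delta>: "\<sigma> (\<delta> x) = q^2 \<bullet> \<delta> (\<sigma> x)"
  by (simp add: \<delta>_def \<sigma>_linear \<sigma>_mult \<sigma>_E scl_right)

lemma \<delta>_pow_linear: "(\<delta> ^^ n) (x + y) = (\<delta> ^^ n) x + (\<delta> ^^ n) y"
  "(\<delta> ^^ n) (x - y) = (\<delta> ^^ n) x - (\<delta> ^^ n) y"
  "(\<delta> ^^ n) (c \<bullet> x) = c \<bullet> (\<delta> ^^ n) x" "(\<delta> ^^ n) 0 = 0"
  by (induction n) (simp_all add: \<delta>_linear)

lemma \<delta>_pow_\<sigma>: "(\<delta> ^^ n) (\<sigma> x) = inverse (q^2) ^ n \<bullet> \<sigma> ((\<delta> ^^ n) x)"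
  by (induction n) (simp_all add: \<sigma>_\<delta> \<delta>_linear field_simps)

text \<open>
  The twisted Leibniz rule lowers the order of nilpotency of one factor at a time, so the
  nilpotent elements form a subalgebra.
\<close>

lemma \<delta>_pow_mult:
  "m + n \<le> Suc k \<Longrightarrow> (\<delta> ^^ m) x = 0 \<Longrightarrow> (\<delta> ^^ n) y = 0 \<Longrightarrow> (\<delta> ^^ k) (x * y) = 0"
proof (induction k arbitrary: m n x y)
  case 0
  then have "x = 0 \<or> y = 0" by (cases m; cases n) auto
  then show ?case by auto
next
  case (Suc k)
  show ?case
  proof (cases "m = 0 \<or> n = 0")
    case True
    then show ?thesis using Suc.prems by (auto simp: \<delta>_pow_linear simp del: funpow.simps)
  next
    case False
    then obtain m' n' where mn: "m = Suc m'" "n = Suc n'" by (metis not0_implies_Suc)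
    have "(\<delta> ^^ k) (\<delta> x * y) = 0"
      using Suc.prems mn by (intro Suc.IH[of m' n]) (auto simp: funpow_Suc_right simp del: funpow.simps)
    moreover have "(\<delta> ^^ k) (\<sigma> x * \<delta> y) = 0"
      using Suc.prems mn
      by (intro Suc.IH[of m n']) (auto simp: \<delta>_pow_\<sigma>[of "Suc m'"] \<sigma>_linear funpow_Suc_right[of n'] simp del: funpow.simps(2))
    ultimately show ?thesis
      by (simp add: funpow_Suc_right \<delta>_mult \<delta>_pow_linear del: funpow.simps)
  qed
qed

definition dpow :: "nat \<Rightarrow> 'a" where "dpow n = (1 / qf q n) \<bullet> E ^ n"

lemma E_dpow: "E * dpow n = qi q (int (Suc n)) \<bullet> dpow (Suc n)"
  and dpow_E: "dpow n * E = qi q (int (Suc n)) \<bullet> dpow (Suc n)"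
  using qi_eq_0_iff[of "int (Suc n)"] qf_nonzero[of n]
  by (simp_all add: dpow_def qf_Suc power_commutes)

lemma \<sigma>_\<delta>_pow: "\<sigma> y = \<kappa> \<bullet> y \<Longrightarrow> \<sigma> ((\<delta> ^^ n) y) = (\<kappa> * (q^2) ^ n) \<bullet> (\<delta> ^^ n) y"
  by (induction n) (simp_all add: \<sigma>_\<delta> \<delta>_linear mult_ac)

text \<open>
  The q-binomial formula.  In divided powers the coefficients are monomials in \<open>q\<close>, and the
  induction step is the addition formula for quantum integers.
\<close>

lemma \<delta>_pow_expand:
  assumes "\<sigma> y = \<kappa> \<bullet> y"
  shows "(\<delta> ^^ n) y
    = qf q n \<bullet> (\<Sum>r\<le>n. ((- \<kappa>) ^ r * q powi (int r * (int n - 1))) \<bullet> (dpow (n - r) * y * dpow r))"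
proof (induction n)
  case 0
  then show ?case by (simp add: dpow_def)
next
  case (Suc n)
  define c where "c n r = (- \<kappa>) ^ r * q powi (int r * (int n - 1))" for n r
  define m where "m t r = dpow t * y * dpow r" for t r
  define S where "S n = (\<Sum>r\<le>n. c n r \<bullet> m (n - r) r)" for n
  have Em: "E * m t r = qi q (int (Suc t)) \<bullet> m (Suc t) r" for t r
    by (simp add: m_def E_dpow flip: mult.assoc)
  have mE: "m t r * E = qi q (int (Suc r)) \<bullet> m t (Suc r)" for t r
    by (simp add: m_def dpow_E mult.assoc)
  have ES: "E * S n = (\<Sum>r\<le>Suc n. (c n r * qi q (int (Suc n) - int r)) \<bullet> m (Suc n - r) r)"
  proof -
    have "E * S n = (\<Sum>r\<le>n. (c n r * qi q (int (Suc n) - int r)) \<bullet> m (Suc n - r) r)"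
      unfolding S_def sum_distrib_left
      by (rule sum.cong) (auto simp: Em Suc_diff_le algebra_simps of_nat_diff)
    then show ?thesis by simp
  qed
  have SE: "S n * E = (\<Sum>r\<le>Suc n. (c n (r - 1) * qi q (int r)) \<bullet> m (Suc n - r) r)"
  proof -
    have "S n * E = (\<Sum>r\<le>n. (c n r * qi q (int (Suc r))) \<bullet> m (n - r) (Suc r))"
      unfolding S_def sum_distrib_right by (rule sum.cong) (auto simp: mE)
    then show ?thesis by (subst sum.atMost_Suc_shift) simp
  qed
  have coeff: "c n r * qi q (int (Suc n) - int r) - \<kappa> * (q^2) ^ n * (c n (r - 1) * qi q (int r))
      = qi q (int (Suc n)) * c (Suc n) r" (is "?l = ?r") for r
  proof (cases r)
    case 0
    then show ?thesis by (simp add: c_def)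
  next
    case (Suc t)
    have "\<kappa> * (q^2) ^ n * (c n (r - 1) * qi q (int r))
       = - ((- \<kappa>) ^ r * (q powi (int n * 2) * q powi (int t * (int n - 1)))) * qi q (int r)"
      using power_int_power'[of q 2 n] by (simp add: c_def Suc mult.commute)
    also have "q powi (int n * 2) * q powi (int t * (int n - 1))
      = q powi (int r * int n) * q powi (int (Suc n) - int r)"
      unfolding power_int_add[symmetric, OF disjI1[OF q_nonzero]]
      by (rule arg_cong[where f = "(powi) q"]) (simp add: Suc algebra_simps)
    finally have 1: "\<kappa> * (q^2) ^ n * (c n (r - 1) * qi q (int r))
       = - ((- \<kappa>) ^ r * q powi (int r * int n)) * (q powi (int (Suc n) - int r) * qi q (int r))"
      by (simp add: algebra_simps)
    have 2: "c n r = (- \<kappa>) ^ r * q powi (int r * int n) * q powi (- int r)"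
      by (simp add: c_def mult.assoc algebra_simps flip: power_int_add)
    have 3: "qi q (int (Suc n)) = q powi (- int r) * qi q (int (Suc n) - int r)
        + q powi (int (Suc n) - int r) * qi q (int r)"
      using qi_add[of "int (Suc n) - int r" "int r"] by simp
    show ?thesis
      unfolding 1 2 3 by (simp add: c_def algebra_simps)
  qed
  have "(\<delta> ^^ Suc n) y = E * (qf q n \<bullet> S n) - (\<kappa> * (q^2) ^ n) \<bullet> ((qf q n \<bullet> S n) * E)"
    unfolding S_def c_def m_def Suc[symmetric]
    by (simp add: \<delta>_def[of "(\<delta> ^^ n) y"] \<sigma>_\<delta>_pow[OF assms])
  also have "\<dots> = qf q n \<bullet> (E * S n - (\<kappa> * (q^2) ^ n) \<bullet> (S n * E))"
    by (simp add: scl_right mult.commute)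
  also have "E * S n - (\<kappa> * (q^2) ^ n) \<bullet> (S n * E)
      = (\<Sum>r\<le>Suc n. (c n r * qi q (int (Suc n) - int r) - \<kappa> * (q^2) ^ n * (c n (r - 1) * qi q (int r)))
           \<bullet> m (Suc n - r) r)"
    unfolding ES SE scl_sum sum_subtractf[symmetric]
    by (rule sum.cong) (auto simp: scl_left)
  also have "\<dots> = (\<Sum>r\<le>Suc n. qi q (int (Suc n)) \<bullet> c (Suc n) r \<bullet> m (Suc n - r) r)"
    unfolding coeff by simp
  also have "\<dots> = qi q (int (Suc n)) \<bullet> S (Suc n)"
    by (simp only: S_def scl_sum)
  finally show ?case by (simp add: qf_Suc S_def c_def m_def mult.commute)
qed

definition serre_sum :: "nat \<Rightarrow> 'a \<Rightarrow> 'a" where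
  "serre_sum n y = (\<Sum>r\<le>n. (- 1) ^ r * dpow (n - r) * y * dpow r)"

text \<open>
  At the weight that occurs in the quantum Serre relation the powers of \<open>q\<close> in the expansion
  cancel, so that the relation is a statement about nilpotency.
\<close>

lemma serre_sum_\<delta>_pow:
  assumes "\<sigma> y = q powi (1 - int n) \<bullet> y"
  shows "(\<delta> ^^ n) y = qf q n \<bullet> serre_sum n y"
proof -
  have "(- (q powi (1 - int n))) ^ r * q powi (int r * (int n - 1)) = (- 1) ^ r" for r
  proof -
    have "(- (q powi (1 - int n))) ^ r = (-1) ^ r * q powi (int r * (1 - int n))"
      by (subst power_minus) (simp add: power_int_power' mult.commute)
    then show ?thesis by (simp add: mult.assoc algebra_simps flip: power_int_add)
  qed
  moreover have "(- 1) ^ r \<bullet> x = (- 1) ^ r * x" for r and x :: 'a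
    by (induction r) (simp_all add: scl_def s_mult s_minus)
  ultimately show ?thesis
    unfolding \<delta>_pow_expand[OF assms] serre_sum_def by (simp add: mult.assoc)
qed

lemma serre_sum_eq_0_iff:
  assumes "\<sigma> y = q powi (1 - int n) \<bullet> y"
  shows "serre_sum n y = 0 \<longleftrightarrow> (\<delta> ^^ n) y = 0"
  using qf_nonzero[of n] by (auto simp: serre_sum_\<delta>_pow[OF assms] dest: scl_eq_0)

text \<open>
  The Serre sum does not change when \<open>q\<close> is replaced by its inverse.  Hence a Serre relation
  gives nilpotency for the opposite twist as well.
\<close>

lemma borel_bar: "borel s (inverse q) E L K"
proof -
  interpret i: generic "inverse q" by (rule generic_inverse)
  show ?thesis by unfold_locales (simp_all add: KL LK LE power_inverse)
qed

lemma serre_sum_bar: "borel.serre_sum s (inverse q) E n y = serre_sum n y"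
proof -
  interpret i: borel s "inverse q" E L K by (rule borel_bar)
  show ?thesis
    by (simp add: i.serre_sum_def serre_sum_def i.dpow_def dpow_def qf_inverse)
qed

end

locale sl2 = borel +
  fixes F :: 'a
  assumes EF: "E * F - F * E = (1 / (q - inverse q)) \<bullet> (K - L)"
begin

text \<open>
  Of the two Cartan terms that \<open>E F - F E\<close> contributes, the twist cancels the one with \<open>K\<close>.
\<close>

lemma commutator_\<delta>:
  assumes \<sigma>: "\<sigma> x = \<kappa> \<bullet> x" and "\<kappa> \<noteq> 0"
  shows "\<delta> x * F - F * \<delta> x = (E * (x * F - F * x) - \<kappa> \<bullet> ((x * F - F * x) * E))
     + ((\<kappa> - inverse \<kappa>) / (q - inverse q)) \<bullet> (x * L)"
proof -
  define d where "d = 1 / (q - inverse q)"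
  have Kx: "K * x = \<kappa> \<bullet> (x * K)"
  proof -
    have "K * x = \<sigma> x * K" by (simp add: \<sigma>_def mult.assoc LK)
    then show ?thesis using \<sigma> by simp
  qed
  have Lx: "L * x = inverse \<kappa> \<bullet> (x * L)"
  proof -
    have "x * L = L * (K * x) * L" by (simp add: LK_assoc)
    also have "\<dots> = \<kappa> \<bullet> (L * x)" by (simp add: Kx mult.assoc KL)
    finally show ?thesis using \<open>\<kappa> \<noteq> 0\<close> by simp
  qed
  have FE: "F * E = E * F - d \<bullet> (K - L)"
    using EF by (simp add: algebra_simps d_def)
  have "\<delta> x * F - F * \<delta> x = E * x * F - \<kappa> \<bullet> (x * (E * F)) - F * E * x + \<kappa> \<bullet> (F * x * E)"
    by (simp add: \<delta>_def \<sigma> algebra_simps scl_right)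
  also have "F * E * x = E * F * x - d \<bullet> (K * x - L * x)"
    by (simp add: FE algebra_simps)
  also have "x * (E * F) = x * F * E + d \<bullet> (x * K - x * L)"
    using arg_cong[OF EF, of "\<lambda>t. x * t"] by (simp add: algebra_simps d_def)
  finally have *: "\<delta> x * F - F * \<delta> x = (E * (x * F - F * x) - \<kappa> \<bullet> ((x * F - F * x) * E))
     + (d \<bullet> (K * x - L * x) - \<kappa> \<bullet> d \<bullet> (x * K - x * L))"
    by (simp add: algebra_simps scl_right)
  have "d \<bullet> (K * x - L * x) - \<kappa> \<bullet> d \<bullet> (x * K - x * L)
     = (d * (\<kappa> - inverse \<kappa>)) \<bullet> (x * L)"
    by (simp add: Kx Lx scl_right scl_left right_diff_distrib mult.commute)
  then show ?thesis using * by (simp add: d_def)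
qed

lemma commutator_\<delta>_pow:
  assumes y: "\<sigma> y = q powi (- m) \<bullet> y" and F: "y * F = F * y"
  shows "(\<delta> ^^ Suc n) y * F - F * (\<delta> ^^ Suc n) y
     = (qi q (int (Suc n)) * qi q (int n - m)) \<bullet> ((\<delta> ^^ n) y * L)"
proof (induction n)
  case 0
  show ?case
    using commutator_\<delta>[OF y] F by (simp add: qi_def power_int_minus)
next
  case (Suc n)
  define x where "x = (\<delta> ^^ n) y"
  define c where "c = qi q (int (Suc n)) * qi q (int n - m)"
  have \<kappa>: "q powi (- m) * (q^2) ^ n = q powi (2 * int n - m)" for n
  proof -
    have "(q^2) ^ n = q powi (2 * int n)" using power_int_power'[of q 2 n] by simp
    then show ?thesis by (simp add: algebra_simps flip: power_int_add)
  qed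
  have \<sigma>x: "\<sigma> x = q powi (2 * int n - m) \<bullet> x"
    and \<sigma>x': "\<sigma> (\<delta> x) = q powi (2 * int (Suc n) - m) \<bullet> \<delta> x"
    using \<sigma>_\<delta>_pow[OF y, of n] \<sigma>_\<delta>_pow[OF y, of "Suc n"] by (simp_all add: x_def \<kappa> del: power_Suc)
  have IH: "\<delta> x * F - F * \<delta> x = c \<bullet> (x * L)"
    using Suc by (simp add: x_def c_def)
  have "q powi (2 * int (Suc n) - m) * inverse (q^2) = q powi (2 * int n - m)"
  proof -
    have "inverse (q^2) = q powi (- 2)" by (simp add: power_int_minus)
    then show ?thesis by (simp flip: power_int_add)
  qed
  then have "E * (x * L) - q powi (2 * int (Suc n) - m) \<bullet> (x * L * E) = \<delta> x * L"
    by (simp add: mult.assoc LE \<delta>_def \<sigma>x algebra_simps)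
  moreover have "E * (c \<bullet> (x * L)) - q powi (2 * int (Suc n) - m) \<bullet> ((c \<bullet> (x * L)) * E)
      = c \<bullet> (E * (x * L) - q powi (2 * int (Suc n) - m) \<bullet> (x * L * E))"
    by (simp add: scl_right mult.commute)
  ultimately have "\<delta> (\<delta> x) * F - F * \<delta> (\<delta> x) = c \<bullet> (\<delta> x * L)
      + ((q powi (2 * int (Suc n) - m) - inverse (q powi (2 * int (Suc n) - m))) / (q - inverse q)) \<bullet> (\<delta> x * L)"
    unfolding commutator_\<delta>[OF \<sigma>x' power_int_not_zero[OF disjI1[OF q_nonzero]]] IH
    by simp
  also have "\<dots> = (c + qi q (2 * int (Suc n) - m)) \<bullet> (\<delta> x * L)"
    using power_int_minus[of q "2 * int (Suc n) - m"] by (simp only: scl_left(1) qi_def)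
  also have "c + qi q (2 * int (Suc n) - m) = qi q (int (Suc (Suc n))) * qi q (int (Suc n) - m)"
  proof -
    define A where "A = int (Suc n)"
    define M where "M = A - m"
    have 1: "qi q (A + 1) = q powi 1 * qi q A + q powi (- A)"
      using qi_add'[of A 1] by simp
    have 2: "qi q (A + M) = q powi (- A) * qi q M + q powi M * qi q A"
      using qi_add[of M A] by (simp add: add.commute)
    have 3: "qi q (M - 1) = q powi 1 * qi q M + q powi M * qi q (- 1)"
      using qi_add[of M "- 1"] by simp
    have 4: "qi q (- 1) = - 1"
    proof -
      have "q * (1 + qi q (- 1)) = 0"
        using qi_add[of 1 "- 1"] by (simp add: distrib_left)
      then show ?thesis by (simp add: add_eq_0_iff)
    qed
    have "qi q A * qi q (M - 1) + qi q (A + M) = qi q (A + 1) * qi q M"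
      unfolding 1 2 3 4 by (simp add: algebra_simps)
    moreover have "int n - m = M - 1" "2 * int (Suc n) - m = A + M" "int (Suc (Suc n)) = A + 1"
      "int (Suc n) = A" "int (Suc n) - m = M"
      by (simp_all add: A_def M_def)
    ultimately show ?thesis by (simp only: c_def)
  qed
  finally show ?case by (simp add: x_def)
qed

text \<open>
  Commutation with \<open>F\<close> turns the vanishing of one power into the vanishing of the preceding one,
  unless the coefficient in the last lemma is zero; that happens only when the power is \<open>m + 1\<close>.
  So any bound for the nilpotency improves to the sharp one.
\<close>

lemma \<delta>_pow_lowest_weight:
  assumes y: "\<sigma> y = q powi (- int m) \<bullet> y" and F: "y * F = F * y" and nil: "(\<delta> ^^ n) y = 0"
  shows "(\<delta> ^^ Suc m) y = 0"
  using nil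
proof (induction n)
  case 0
  then show ?case by (simp add: \<delta>_linear \<delta>_pow_linear)
next
  case (Suc n)
  show ?case
  proof (cases "n = m")
    case False
    have "(qi q (int (Suc n)) * qi q (int n - int m)) \<bullet> ((\<delta> ^^ n) y * L) = 0"
      using commutator_\<delta>_pow[OF y F, of n] Suc.prems by simp
    moreover have "qi q (int (Suc n)) * qi q (int n - int m) \<noteq> 0"
      using False by (simp add: qi_eq_0_iff)
    ultimately have "(\<delta> ^^ n) y * L = 0" by (rule scl_eq_0)
    then have "(\<delta> ^^ n) y * L * K = 0" by simp
    then have "(\<delta> ^^ n) y = 0" by (simp add: mult.assoc LK)
    then show ?thesis by (rule Suc.IH)
  qed (use Suc.prems in simp)
qed

end

section \<open>The contracted root vector in rank two\<close>

text \<open>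
  The letters \<open>p\<close> and \<open>m\<close> stand for the two contracted vertices, \<open>Lp\<close> and \<open>Lm\<close> for the inverses
  of \<open>Kp\<close> and \<open>Km\<close>.  The vertices span a root system of type A2, whose third positive root vector
  is \<open>E0\<close>.
\<close>

locale rank2 = central_scalars s + generic q for s :: "Qv \<Rightarrow> 'a::ring_1" and q +
  fixes Ep Em Fp Fm Kp Km Lp Lm :: 'a
  assumes KLp: "Kp * Lp = 1" "Lp * Kp = 1" and KLm: "Km * Lm = 1" "Lm * Km = 1"
    and KK: "Km * Kp = Kp * Km"
    and KE: "Kp * Ep = q^2 \<bullet> (Ep * Kp)" "Km * Em = q^2 \<bullet> (Em * Km)"
      "Kp * Em = inverse q \<bullet> (Em * Kp)" "Km * Ep = inverse q \<bullet> (Ep * Km)"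
    and KF: "Kp * Fp = inverse (q^2) \<bullet> (Fp * Kp)" "Km * Fm = inverse (q^2) \<bullet> (Fm * Km)"
      "Kp * Fm = q \<bullet> (Fm * Kp)" "Km * Fp = q \<bullet> (Fp * Km)"
    and EF: "Ep * Fp - Fp * Ep = (1 / (q - inverse q)) \<bullet> (Kp - Lp)"
      "Em * Fm - Fm * Em = (1 / (q - inverse q)) \<bullet> (Km - Lm)"
      "Ep * Fm = Fm * Ep" "Em * Fp = Fp * Em"
    and serre: "Ep * (Ep * Em) + Em * (Ep * Ep) = (q + inverse q) \<bullet> (Ep * (Em * Ep))"
      "Em * (Em * Ep) + Ep * (Em * Em) = (q + inverse q) \<bullet> (Em * (Ep * Em))"
begin

lemma assoc_rule: "a * b = c \<Longrightarrow> a * (b * x) = c * x" for a b c x :: 'a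
  by (simp flip: mult.assoc)

lemma shift_inverse:
  assumes "k * l = 1" "l * k = 1" "k * x = c \<bullet> (x * k)" "c \<noteq> 0"
  shows "l * x = inverse c \<bullet> (x * l)"
proof -
  have "x * l = l * (k * x) * l" using assms(2) by (simp flip: mult.assoc)
  also have "\<dots> = c \<bullet> (l * x)" using assms(1,3) by (simp add: mult.assoc)
  finally show ?thesis using \<open>c \<noteq> 0\<close> by simp
qed

lemma LE: "Lp * Ep = inverse (q^2) \<bullet> (Ep * Lp)" "Lm * Em = inverse (q^2) \<bullet> (Em * Lm)"
    "Lp * Em = q \<bullet> (Em * Lp)" "Lm * Ep = q \<bullet> (Ep * Lm)"
  using shift_inverse[OF KLp KE(1)] shift_inverse[OF KLm KE(2)] shift_inverse[OF KLp KE(3)]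
    shift_inverse[OF KLm KE(4)] by simp_all

lemma LF: "Lp * Fp = q^2 \<bullet> (Fp * Lp)" "Lm * Fm = q^2 \<bullet> (Fm * Lm)"
    "Lp * Fm = inverse q \<bullet> (Fm * Lp)" "Lm * Fp = inverse q \<bullet> (Fp * Lm)"
  using shift_inverse[OF KLp KF(1)] shift_inverse[OF KLm KF(2)] shift_inverse[OF KLp KF(3)]
    shift_inverse[OF KLm KF(4)] by simp_all

lemma LK_commute: "Lm * Kp = Kp * Lm" "Lp * Km = Km * Lp" "Lp * Lm = Lm * Lp"
proof -
  have mp: "Km * Kp = 1 \<bullet> (Kp * Km)" and pm: "Kp * Km = 1 \<bullet> (Km * Kp)"
    by (simp_all add: KK)
  show "Lm * Kp = Kp * Lm" using shift_inverse[OF KLm mp] by simp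
  show pm': "Lp * Km = Km * Lp" using shift_inverse[OF KLp pm] by simp
  then have "Km * Lp = 1 \<bullet> (Lp * Km)" by simp
  from shift_inverse[OF KLm this] show "Lp * Lm = Lm * Lp" by simp
qed

lemmas comm = KLp KLm KK KE KF LE LF LK_commute
lemmas comm_rules = comm comm[THEN assoc_rule] mult.assoc

definition E0 :: 'a where "E0 = Ep * Em - inverse q \<bullet> (Em * Ep)"
definition F0 :: 'a where "F0 = Fm * Fp - q \<bullet> (Fp * Fm)"
definition K0 :: 'a where "K0 = Kp * Km"
definition L0 :: 'a where "L0 = Lm * Lp"

lemma KL0: "K0 * L0 = 1" "L0 * K0 = 1"
  by (simp_all add: K0_def L0_def comm_rules)

lemma KE0: "Kp * E0 = q \<bullet> (E0 * Kp)" "Km * E0 = q \<bullet> (E0 * Km)" "Lm * E0 = inverse q \<bullet> (E0 * Lm)"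
    "K0 * E0 = q^2 \<bullet> (E0 * K0)"
  by (simp_all add: E0_def K0_def comm_rules algebra_simps scl_right power2_eq_square)

lemma Ep_E0: "Ep * E0 = q \<bullet> (E0 * Ep)" and E0_Em: "E0 * Em = q \<bullet> (Em * E0)"
proof -
  have "Ep * (Ep * Em) = (q + inverse q) \<bullet> (Ep * (Em * Ep)) - Em * (Ep * Ep)"
    using serre(1) by (simp add: algebra_simps)
  then show "Ep * E0 = q \<bullet> (E0 * Ep)"
    by (simp add: E0_def algebra_simps scl_right scl_left)
  have "Ep * (Em * Em) = (q + inverse q) \<bullet> (Em * (Ep * Em)) - Em * (Em * Ep)"
    using serre(2) by (simp add: algebra_simps)
  then show "E0 * Em = q \<bullet> (Em * E0)"
    by (simp add: E0_def algebra_simps scl_right scl_left)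
qed

sublocale p: sl2 s q Ep Kp Lp Fp
  by unfold_locales (simp_all add: KLp KE EF)

text \<open>
  For the second vertex the inverse twist is used.  With this choice \<open>E0\<close> is killed by the twisted
  derivations of both vertices, so that multiplications by \<open>E0\<close> can be moved past them.
\<close>

sublocale mb: borel s "inverse q" Em Lm Km
proof -
  interpret i: generic "inverse q" by (rule generic_inverse)
  show "borel s (inverse q) Em Lm Km"
    by unfold_locales (simp_all add: KLm LE power_inverse)
qed

text \<open>
  The two commutators with the old lowering operators leave only one of the two Cartan terms; this
  is what the twist in the contracted root vectors is made for.
\<close>

lemma E0_Fp: "E0 * Fp - Fp * E0 = - (Em * Lp)"
  and E0_Fm: "E0 * Fm - Fm * E0 = inverse q \<bullet> (Ep * Km)"
proof -
  define d where "d = 1 / (q - inverse q)"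
  have "d * (q - inverse q) = 1"
    using q_diff_nonzero by (simp add: d_def)
  then have d: "d * q - d * inverse q = 1"
    by (simp only: right_diff_distrib)
  have d': "d - d * inverse (q^2) = inverse q"
    using arg_cong[OF d, of "\<lambda>c. inverse q * c"] by (simp add: right_diff_distrib power2_eq_square mult_ac)
  have EFp: "Ep * Fp = Fp * Ep + (d \<bullet> Kp - d \<bullet> Lp)" and EFm: "Em * Fm = Fm * Em + (d \<bullet> Km - d \<bullet> Lm)"
    using EF by (simp_all add: d_def algebra_simps scl_right)
  note EF' = EFp EFm EF(3,4)
  note rules = EF' EF'[THEN assoc_rule] comm_rules
  have "E0 * Fp - Fp * E0 = - (d * q - d * inverse q) \<bullet> (Em * Lp)"
    by (simp add: E0_def rules algebra_simps scl_right scl_left)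
  then show "E0 * Fp - Fp * E0 = - (Em * Lp)" by (simp add: d)
  have "E0 * Fm - Fm * E0 = (d - d * inverse (q^2)) \<bullet> (Ep * Km)"
    by (simp add: E0_def rules algebra_simps scl_right scl_left power2_eq_square)
  then show "E0 * Fm - Fm * E0 = inverse q \<bullet> (Ep * Km)" by (simp add: d')
qed

lemma E0_F0: "E0 * F0 - F0 * E0 = (1 / (q - inverse q)) \<bullet> (K0 - L0)"
proof -
  define d where "d = 1 / (q - inverse q)"
  have "E0 * F0 - F0 * E0 = (E0 * Fm - Fm * E0) * Fp + Fm * (E0 * Fp - Fp * E0)
     - q \<bullet> ((E0 * Fp - Fp * E0) * Fm + Fp * (E0 * Fm - Fm * E0))"
    by (simp add: F0_def algebra_simps scl_right)
  also have "\<dots> = (Ep * Fp - Fp * Ep) * Km + (Em * Fm - Fm * Em) * Lp"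
    by (simp add: E0_Fp E0_Fm comm_rules algebra_simps scl_right)
  also have "\<dots> = d \<bullet> (K0 - L0)"
    unfolding EF(1,2) d_def[symmetric] by (simp add: K0_def L0_def comm_rules algebra_simps scl_right)
  finally show ?thesis by (simp add: d_def)
qed

sublocale z: sl2 s q E0 K0 L0 F0
  by unfold_locales (simp_all add: KL0 KE0 E0_F0)

lemma z_\<sigma>: "z.\<sigma> x = Kp * (Km * (x * (Lm * Lp)))"
  by (simp only: z.\<sigma>_def) (simp add: K0_def L0_def mult.assoc)

lemma shifts:
  "p.\<sigma> Ep = q^2 \<bullet> Ep" "p.\<sigma> Em = inverse q \<bullet> Em" "mb.\<sigma> Ep = q \<bullet> Ep" "mb.\<sigma> Em = inverse (q^2) \<bullet> Em"
  "p.\<sigma> E0 = q \<bullet> E0" "mb.\<sigma> E0 = inverse q \<bullet> E0" "z.\<sigma> Em = q \<bullet> Em" "z.\<sigma> Ep = q \<bullet> Ep"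
  by (simp_all add: p.\<sigma>_def mb.\<sigma>_def z_\<sigma> KE0 comm_rules power2_eq_square)

lemma \<delta>_E0: "p.\<delta> E0 = 0" "mb.\<delta> E0 = 0"
  by (simp_all add: p.\<delta>_def mb.\<delta>_def shifts Ep_E0 E0_Em)

lemma \<delta>_Ep: "(mb.\<delta> ^^ 2) Ep = 0"
proof -
  have "Em * (Em * Ep) = (q + inverse q) \<bullet> (Em * (Ep * Em)) - Ep * (Em * Em)"
    using serre(2) by (simp add: algebra_simps)
  moreover have "(mb.\<delta> ^^ 2) Ep = mb.\<delta> (mb.\<delta> Ep)"
    by (simp add: numeral_2_eq_2)
  ultimately show ?thesis
    by (simp add: mb.\<delta>_def mb.\<sigma>_linear mb.\<sigma>_mult shifts algebra_simps scl_right scl_left power2_eq_square)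
qed

lemma \<delta>_times_E0:
  "p.\<delta> (E0 * x) = q \<bullet> (E0 * p.\<delta> x)" "p.\<delta> (x * E0) = p.\<delta> x * E0"
  "mb.\<delta> (E0 * x) = inverse q \<bullet> (E0 * mb.\<delta> x)" "mb.\<delta> (x * E0) = mb.\<delta> x * E0"
  by (simp_all add: p.\<delta>_mult mb.\<delta>_mult \<delta>_E0 shifts)

definition q_comm :: "Qv \<Rightarrow> 'a \<Rightarrow> 'a" where "q_comm c x = E0 * x - c \<bullet> (x * E0)"

text \<open>
  Since the two twists are opposite, all mixed terms cancel and the commutator of the two
  derivations is a twisted commutator with \<open>E0\<close>.
\<close>

lemma \<delta>_commute:
  assumes "p.\<sigma> x = \<kappa> \<bullet> x" "mb.\<sigma> x = \<mu> \<bullet> x"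
  shows "p.\<delta> (mb.\<delta> x) = inverse q \<bullet> mb.\<delta> (p.\<delta> x) + q_comm (\<kappa> * \<mu>) x"
  unfolding p.\<delta>_def mb.\<delta>_def q_comm_def E0_def
  by (simp add: assms shifts p.\<sigma>_linear mb.\<sigma>_linear p.\<sigma>_mult mb.\<sigma>_mult algebra_simps scl_right)

lemma weight_mb_pow: "p.\<sigma> x = \<kappa> \<bullet> x \<Longrightarrow> p.\<sigma> ((mb.\<delta> ^^ n) x) = (\<kappa> * inverse q ^ n) \<bullet> (mb.\<delta> ^^ n) x"
proof (induction n)
  case (Suc n)
  have "p.\<sigma> (mb.\<sigma> w) = mb.\<sigma> (p.\<sigma> w)" for w
    by (simp add: p.\<sigma>_def mb.\<sigma>_def comm_rules)
  then have "p.\<sigma> (mb.\<delta> w) = inverse q \<bullet> (Em * p.\<sigma> w - mb.\<sigma> (p.\<sigma> w) * Em)" for w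
    by (simp add: mb.\<delta>_def p.\<sigma>_mult p.\<sigma>_linear shifts scl_right)
  then show ?case
    using Suc by (simp add: mb.\<delta>_linear mb.\<delta>_def[symmetric] mult_ac flip: scl_right)
qed simp

text \<open>
  The analogue of the formula for \<open>e f\<^sup>n\<close> on a highest weight vector of sl2; the Cartan
  element is replaced by a twisted commutator with \<open>E0\<close>.
\<close>

lemma p_mb_pow:
  assumes \<kappa>: "p.\<sigma> x = \<kappa> \<bullet> x" and \<mu>: "mb.\<sigma> x = \<mu> \<bullet> x" and x: "p.\<delta> x = 0"
  shows "p.\<delta> ((mb.\<delta> ^^ Suc n) x)
     = qi q (int (Suc n)) \<bullet> (mb.\<delta> ^^ n) (q_comm (\<kappa> * \<mu> * q powi (- 2 * int n)) x)"
proof -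
  have pow: "(mb.\<delta> ^^ n) (q_comm c x) = inverse q ^ n \<bullet> (E0 * (mb.\<delta> ^^ n) x) - c \<bullet> ((mb.\<delta> ^^ n) x * E0)" for n c
    by (induction n) (simp_all add: q_comm_def mb.\<delta>_linear \<delta>_times_E0 mult_ac)
  have weights: "\<kappa> * inverse q ^ n * (\<mu> * (inverse q)\<^sup>2 ^ n) = \<kappa> * \<mu> * q powi (- 3 * int n)" for n
  proof -
    have "inverse q ^ n * ((inverse q)\<^sup>2) ^ n = inverse q ^ (n + 2 * n)"
      by (simp only: power_add power_mult)
    also have "\<dots> = inverse (q ^ (3 * n))"
      by (simp add: power_inverse)
    also have "\<dots> = q powi (- int (3 * n))"
      by (simp only: power_int_minus power_int_of_nat)
    finally show ?thesis by (simp add: mult_ac)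
  qed
  show ?thesis
  proof (induction n)
    case 0
    show ?case using \<delta>_commute[OF \<kappa> \<mu>] by (simp add: x mb.\<delta>_linear)
  next
    case (Suc n)
    define w where "w = (mb.\<delta> ^^ Suc n) x"
    define i where "i = int (Suc n)"
    define c where "c = \<kappa> * \<mu>"
    have comm: "p.\<delta> (mb.\<delta> w) = inverse q \<bullet> mb.\<delta> (p.\<delta> w) + q_comm (c * q powi (- 3 * i)) w"
      unfolding c_def i_def weights[of "Suc n", symmetric]
      by (rule \<delta>_commute) (use weight_mb_pow[OF \<kappa>] mb.\<sigma>_\<delta>_pow[OF \<mu>] in \<open>simp_all add: w_def del: funpow.simps power_Suc\<close>)
    have IH: "mb.\<delta> (p.\<delta> w) = qi q i \<bullet> (mb.\<delta> ^^ Suc n) (q_comm (c * q powi (- 2 * int n)) x)"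
      using arg_cong[OF Suc, of mb.\<delta>] by (simp add: w_def i_def c_def mb.\<delta>_linear)
    have qE: "inverse q ^ Suc n = q powi (- i)"
      by (simp only: i_def power_int_minus power_int_of_nat power_inverse)
    have A: "inverse q * qi q i * q powi (- i) + 1 = qi q (i + 1) * q powi (- i)"
    proof -
      have "qi q (i + 1) = inverse q * qi q i + q powi i"
        using qi_add[of i 1] by (simp add: power_int_minus)
      then show ?thesis by (simp add: algebra_simps flip: power_int_add)
    qed
    have B: "inverse q * qi q i * q powi (- 2 * int n) + q powi (- 3 * i) = qi q (i + 1) * q powi (- 2 * i)"
    proof -
      have "qi q (i + 1) = q * qi q i + q powi (- i)"
        using qi_add'[of i 1] by simp
      moreover have "inverse q * q powi (- 2 * int n) = q * q powi (- 2 * i)"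
      proof -
        have "inverse q * q powi (- 2 * int n) = q powi (- 1 + - 2 * int n)"
          by (simp only: power_int_add[OF disjI1[OF q_nonzero]] power_int_minus power_int_1_right)
        also have "- 1 + - 2 * int n = 1 + - 2 * i" by (simp add: i_def)
        also have "q powi \<dots> = q * q powi (- 2 * i)"
          by (simp only: power_int_add[OF disjI1[OF q_nonzero]] power_int_1_right)
        finally show ?thesis .
      qed
      moreover have "q powi (- 3 * i) = q powi (- i) * q powi (- 2 * i)"
        by (simp flip: power_int_add)
      ultimately show ?thesis by (simp add: algebra_simps)
    qed
    have "p.\<delta> (mb.\<delta> w) = (inverse q * qi q i * q powi (- i) + 1) \<bullet> (E0 * w)
        - (c * (inverse q * qi q i * q powi (- 2 * int n) + q powi (- 3 * i))) \<bullet> (w * E0)"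
      unfolding comm IH pow qE w_def[symmetric] by (simp add: q_comm_def scl_right scl_left algebra_simps)
    also have "\<dots> = qi q (i + 1) \<bullet> (q powi (- i) \<bullet> (E0 * w) - (c * q powi (- 2 * i)) \<bullet> (w * E0))"
      unfolding A B by (simp add: scl_right mult_ac)
    also have "q powi (- i) \<bullet> (E0 * w) - (c * q powi (- 2 * i)) \<bullet> (w * E0)
        = (mb.\<delta> ^^ Suc n) (q_comm (c * q powi (- 2 * i)) x)"
      unfolding pow qE w_def ..
    finally show ?case by (simp add: w_def c_def i_def add.commute)
  qed
qed

text \<open>
  Repeated use of the preceding lemma produces a product of twisted commutators with \<open>E0\<close> whose
  twists are consecutive even powers of \<open>q\<close>.  The hypothesis on the weights says that they are the
  twists occurring in a power of the twisted adjoint action of \<open>E0\<close>.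
\<close>

lemma p_pow_mb_pow:
  assumes "p.\<sigma> x = \<kappa> \<bullet> x" "mb.\<sigma> x = \<mu> \<bullet> x" "p.\<delta> x = 0" "z.\<sigma> x = \<nu> \<bullet> x"
    and "\<kappa> * \<mu> * q^2 = \<nu> * (q^2) ^ n"
  shows "(p.\<delta> ^^ n) ((mb.\<delta> ^^ n) x) = qf q n \<bullet> (z.\<delta> ^^ n) x"
  using assms
proof (induction n arbitrary: x \<kappa> \<mu> \<nu>)
  case (Suc n)
  define x' where "x' = q_comm \<nu> x"
  have \<nu>: "\<kappa> * \<mu> * q powi (- 2 * int n) = \<nu>"
  proof -
    have "\<kappa> * \<mu> = \<nu> * (q^2) ^ n" using Suc.prems(5) by simp
    moreover have "(q^2) ^ n = q powi (2 * int n)" using power_int_power'[of q 2 n] by simp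
    ultimately show ?thesis by (simp add: mult.assoc flip: power_int_add)
  qed
  have x': "z.\<delta> x = x'"
    by (simp add: x'_def q_comm_def z.\<delta>_def Suc.prems)
  have "(p.\<delta> ^^ Suc n) ((mb.\<delta> ^^ Suc n) x) = qi q (int (Suc n)) \<bullet> (p.\<delta> ^^ n) ((mb.\<delta> ^^ n) x')"
    unfolding funpow_Suc_right[of n p.\<delta>] comp_def p_mb_pow[OF Suc.prems(1-3)] \<nu> x'_def[symmetric]
    by (simp add: p.\<delta>_pow_linear)
  also have "(p.\<delta> ^^ n) ((mb.\<delta> ^^ n) x') = qf q n \<bullet> (z.\<delta> ^^ n) x'"
  proof (rule Suc.IH)
    show "p.\<sigma> x' = (q * \<kappa>) \<bullet> x'" "mb.\<sigma> x' = (inverse q * \<mu>) \<bullet> x'"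
      by (simp_all add: x'_def q_comm_def p.\<sigma>_linear p.\<sigma>_mult mb.\<sigma>_linear mb.\<sigma>_mult shifts Suc.prems scl_right mult_ac)
    show "p.\<delta> x' = 0"
      by (simp add: x'_def q_comm_def p.\<delta>_linear \<delta>_times_E0 Suc.prems)
    show "z.\<sigma> x' = (q^2 * \<nu>) \<bullet> x'"
      by (simp add: z.\<sigma>_\<delta> Suc.prems z.\<delta>_linear flip: x')
    show "q * \<kappa> * (inverse q * \<mu>) * q^2 = q^2 * \<nu> * (q^2) ^ n"
      using Suc.prems(5) by (simp add: mult.left_commute[of \<kappa>])
  qed
  finally show ?case
    by (simp add: x' qf_Suc funpow_Suc_right[of n z.\<delta>] del: funpow.simps(2))
qed simp

text \<open>
  The factor \<open>Kp\<close> makes the commutator of \<open>E0\<close> with \<open>Fp\<close> one with the right twist.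
\<close>

lemma z_nil_FK: "(z.\<delta> ^^ 2) (Fp * Kp) = 0"
proof -
  have "z.\<delta> (Fp * Kp) = (E0 * Fp - Fp * E0) * Kp"
    by (simp add: z.\<delta>_def z.\<sigma>_mult algebra_simps z_\<sigma> KE0 comm_rules power2_eq_square)
  also have "\<dots> = - Em"
    by (simp add: E0_Fp comm_rules)
  finally have "z.\<delta> (Fp * Kp) = (- 1) \<bullet> Em" by simp
  moreover have "z.\<delta> Em = 0"
    by (simp add: z.\<delta>_def shifts E0_Em)
  ultimately show ?thesis
    using z.\<delta>_linear(3)[of "- 1" Em] by (simp add: numeral_2_eq_2)
qed

text \<open>
  Let \<open>x i\<close> be the image of \<open>y\<close> under the \<open>i\<close>-th power of the derivation of the first vertex.  On
  the last nonzero vector \<open>x a\<close> that derivation vanishes, and the derivation of the second vertex is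
  nilpotent of order \<open>a + b + 1\<close> by the Leibniz rule; so \<open>E0\<close> acts nilpotently on \<open>x a\<close>.  From there
  one returns to \<open>y = x 0\<close> by commutators with \<open>Fp * Kp\<close>, which preserve nilpotency.  The exponent
  obtained in this way is improved at the end by the sl2 of \<open>E0\<close> and \<open>F0\<close>, for which \<open>y\<close> is a lowest
  weight vector of weight \<open>- (a + b)\<close>.
\<close>

theorem contracted_serre:
  assumes wp: "p.\<sigma> y = q powi (- int a) \<bullet> y" and wm: "Km * y * Lm = q powi (- int b) \<bullet> y"
    and sp: "(p.\<delta> ^^ Suc a) y = 0" and sm: "(mb.\<delta> ^^ Suc b) y = 0"
    and F: "y * Fp = Fp * y" "y * Fm = Fm * y"
  shows "(z.\<delta> ^^ Suc (a + b)) y = 0"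
proof -
  have wmb: "mb.\<sigma> y = q powi int b \<bullet> y"
  proof -
    have "y = Lm * (Km * y * Lm) * Km" by (simp add: comm_rules)
    also have "\<dots> = q powi (- int b) \<bullet> mb.\<sigma> y" by (simp only: wm) (simp add: mb.\<sigma>_def mult.assoc)
    finally have "q powi int b \<bullet> y = (q powi int b * q powi (- int b)) \<bullet> mb.\<sigma> y"
      by (metis scl_simps(3))
    then show ?thesis by (simp add: power_int_minus)
  qed
  define x where "x i = (p.\<delta> ^^ i) y" for i
  have x_Suc: "x (Suc i) = p.\<delta> (x i)" for i by (simp add: x_def)
  have xp: "p.\<sigma> (x i) = q powi (2 * int i - int a) \<bullet> x i" for i
  proof -
    have "(q^2) ^ i = q powi (2 * int i)" using power_int_power'[of q 2 i] by simp
    then have "q powi (- int a) * (q^2) ^ i = q powi (2 * int i - int a)"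
      by (simp add: algebra_simps flip: power_int_add)
    then show ?thesis using p.\<sigma>_\<delta>_pow[OF wp, of i] by (simp add: x_def)
  qed
  have p_\<delta>: "p.\<delta> (x i) = Ep * x i - q powi (2 * int i - int a) \<bullet> (x i * Ep)" for i
    by (simp add: p.\<delta>_def xp)
  have xm: "mb.\<sigma> (x i) = q powi (int b + int i) \<bullet> x i" for i
  proof (induction i)
    case (Suc i)
    then show ?case
      by (simp add: x_Suc p_\<delta> mb.\<sigma>_linear mb.\<sigma>_mult shifts scl_right power_int_add mult_ac)
  qed (simp add: x_def wmb)
  have xz: "z.\<sigma> (x i) = q powi (int i - int a - int b) \<bullet> x i" for i
  proof -
    have "Km * x i * Lm = q powi (- (int b + int i)) \<bullet> x i"
    proof -
      have "x i = Km * mb.\<sigma> (x i) * Lm" by (simp add: mb.\<sigma>_def comm_rules)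
      also have "\<dots> = q powi (int b + int i) \<bullet> (Km * x i * Lm)" by (simp add: xm mult.assoc)
      finally have "q powi (- (int b + int i)) \<bullet> x i
        = (q powi (- (int b + int i)) * q powi (int b + int i)) \<bullet> (Km * x i * Lm)"
        by (metis scl_simps(3))
      then show ?thesis by (simp flip: power_int_add)
    qed
    then have "z.\<sigma> (x i) = q powi (- (int b + int i)) \<bullet> p.\<sigma> (x i)"
      using z_\<sigma>[of "x i"] by (simp add: p.\<sigma>_def) (metis mult.assoc scl_simps(1,2))
    then show ?thesis by (simp add: xp algebra_simps flip: power_int_add)
  qed
  have m_nil: "(mb.\<delta> ^^ (Suc b + i)) (x i) = 0" for i
  proof (induction i)
    case (Suc i)
    have "(mb.\<delta> ^^ Suc (Suc b + i)) (Ep * x i) = 0"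
      by (rule mb.\<delta>_pow_mult[OF _ \<delta>_Ep Suc]) simp
    moreover have "(mb.\<delta> ^^ Suc (Suc b + i)) (x i * Ep) = 0"
      by (rule mb.\<delta>_pow_mult[OF _ Suc \<delta>_Ep]) simp
    ultimately have "(mb.\<delta> ^^ Suc (Suc b + i)) (x (Suc i)) = 0"
      by (simp add: x_Suc p_\<delta> mb.\<delta>_pow_linear del: funpow.simps)
    then show ?case by simp
  qed (use sm in \<open>simp add: x_def\<close>)
  have top: "(z.\<delta> ^^ (Suc b + a)) (x a) = 0"
  proof -
    have "(p.\<delta> ^^ (Suc b + a)) ((mb.\<delta> ^^ (Suc b + a)) (x a)) = qf q (Suc b + a) \<bullet> (z.\<delta> ^^ (Suc b + a)) (x a)"
    proof (rule p_pow_mb_pow[OF xp xm _ xz])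
      show "p.\<delta> (x a) = 0" using sp by (simp add: x_def)
      have "(q^2) ^ (Suc b + a) = q powi (2 * int (Suc b + a))" using power_int_power'[of q 2 "Suc b + a"] by simp
      moreover have "q^2 = q powi 2" by simp
      moreover have "2 * int a - int a + (int b + int a) + 2 = int a - int a - int b + 2 * int (Suc b + a)"
        by simp
      ultimately show "q powi (2 * int a - int a) * q powi (int b + int a) * q^2
          = q powi (int a - int a - int b) * (q^2) ^ (Suc b + a)"
        by (simp only: power_int_add[OF disjI1[OF q_nonzero], symmetric])
    qed
    then have "qf q (Suc b + a) \<bullet> (z.\<delta> ^^ (Suc b + a)) (x a) = 0"
      by (simp only: m_nil p.\<delta>_pow_linear)
    then show ?thesis using qf_nonzero by (rule scl_eq_0)
  qed
  have "\<exists>N. (z.\<delta> ^^ N) (x (a - i)) = 0" if "i \<le> a" for i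
    using that
  proof (induction i)
    case (Suc i)
    define n where "n = a - Suc i"
    have n: "a - i = Suc n" "n < a" using Suc.prems by (simp_all add: n_def)
    obtain N where N: "(z.\<delta> ^^ N) (x (Suc n)) = 0" using Suc n by auto
    have c: "qi q (int (Suc n)) * qi q (int n - int a) \<noteq> 0"
      using n by (simp add: qi_eq_0_iff)
    have "x (Suc n) * Kp = q powi (int a - 2 * int (Suc n)) \<bullet> (Kp * x (Suc n))"
    proof -
      have "Kp * x (Suc n) = p.\<sigma> (x (Suc n)) * Kp" by (simp add: p.\<sigma>_def comm_rules)
      also have "\<dots> = q powi (2 * int (Suc n) - int a) \<bullet> (x (Suc n) * Kp)" by (simp add: xp)
      finally show ?thesis by (simp flip: power_int_add)
    qed
    then have "(x (Suc n) * Fp - Fp * x (Suc n)) * Kp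
       = x (Suc n) * (Fp * Kp) - q powi (int a - 2 * int (Suc n)) \<bullet> (Fp * Kp * x (Suc n))"
      by (simp add: algebra_simps)
    moreover have "(z.\<delta> ^^ Suc N) (x (Suc n) * (Fp * Kp)) = 0"
      by (rule z.\<delta>_pow_mult[OF _ N z_nil_FK]) simp
    moreover have "(z.\<delta> ^^ Suc N) (Fp * Kp * x (Suc n)) = 0"
      by (rule z.\<delta>_pow_mult[OF _ z_nil_FK N]) simp
    moreover have "(x (Suc n) * Fp - Fp * x (Suc n)) * Kp = (qi q (int (Suc n)) * qi q (int n - int a)) \<bullet> x n"
      unfolding x_def p.commutator_\<delta>_pow[OF wp F(1)] by (simp add: comm_rules)
    ultimately have "(qi q (int (Suc n)) * qi q (int n - int a)) \<bullet> (z.\<delta> ^^ Suc N) (x n) = 0"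
      by (simp only: z.\<delta>_pow_linear flip: z.\<delta>_pow_linear(3)) (simp add: z.\<delta>_pow_linear del: funpow.simps)
    then have "(z.\<delta> ^^ Suc N) (x n) = 0" using c by (rule scl_eq_0)
    then show ?case unfolding n_def by blast
  qed (use top in \<open>metis diff_zero\<close>)
  from this[of a] obtain N where "(z.\<delta> ^^ N) y = 0" by (auto simp: x_def)
  moreover have "z.\<sigma> y = q powi (- int (a + b)) \<bullet> y"
    using xz[of 0] by (simp add: x_def algebra_simps)
  moreover have "y * F0 = F0 * y"
  proof -
    have "y * (Fp * Fm) = Fp * Fm * y" "y * (Fm * Fp) = Fm * Fp * y"
      using F by (metis mult.assoc)+
    then show ?thesis by (simp add: F0_def algebra_simps)
  qed
  ultimately show ?thesis by (intro z.\<delta>_pow_lowest_weight)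
qed

end

section \<open>Root data\<close>

text \<open>
  The properties of a root datum that survive the edge contraction without further hypotheses; the
  injectivity of coroots and roots is not among them.
\<close>

locale datum =
  fixes D :: "('i, 'y::ab_group_add, 'x::ab_group_add) rdatum"
  assumes dot_sym: "i \<in> idx D \<Longrightarrow> j \<in> idx D \<Longrightarrow> dot D i j = dot D j i"
    and dot_pos: "i \<in> idx D \<Longrightarrow> 0 < dot D i i"
    and dot_even: "i \<in> idx D \<Longrightarrow> even (dot D i i)"
    and dot_nonpos: "i \<in> idx D \<Longrightarrow> j \<in> idx D \<Longrightarrow> i \<noteq> j \<Longrightarrow> dot D i j \<le> 0"
    and dot_pairing: "i \<in> idx D \<Longrightarrow> j \<in> idx D \<Longrightarrow>
      dot D i i * pairing D (coroot D i) (root D j) = 2 * dot D i j"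
    and pairing_add_left: "pairing D (y + y') x = pairing D y x + pairing D y' x"
    and pairing_add_right: "pairing D y (x + x') = pairing D y x + pairing D y x'"
    and pairing_nondegenerate: "(\<And>y. pairing D y x = 0) \<Longrightarrow> x = 0"

lemma root_datum_datum: "root_datum D \<Longrightarrow> datum D"
proof -
  assume D: "root_datum D"
  then have p: "perfect_pairing (pairing D)" and c: "cartan_datum (idx D) (dot D)"
    by (simp_all add: root_datum_def)
  have l: "additive (\<lambda>y. pairing D y x)" and r: "additive (pairing D y)" for x y
    using p by (simp_all add: perfect_pairing_def)
  show ?thesis
  proof
    fix x assume "\<And>y. pairing D y x = 0"
    moreover have "additive (\<lambda>y. 0 :: int)" by (simp add: additive_def)
    moreover have "pairing D y 0 = 0" for y using r by (rule additive.zero)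
    ultimately show "x = 0" using p unfolding perfect_pairing_def by metis
  qed (use c D additive.add[OF l] additive.add[OF r] in
      \<open>auto simp: cartan_datum_def root_datum_def\<close>)
qed

definition kt :: "('i, 'y::ab_group_add, 'x) rdatum \<Rightarrow> 'i \<Rightarrow> 'y" where
  "kt D i = sum_list (replicate (nat (dot D i i div 2)) (coroot D i))"

lemma Kt_kt: "Kt D i = K (kt D i)" "Kt_inv D i = K (- kt D i)"
  by (simp_all add: Kt_def Kt_inv_def kt_def)

lemma qint_qi: "qint D i n = qi (vi D i) (int n)"
  by (simp add: qint_def qi_def power_int_minus power_inverse)

lemma qfact_qf: "qfact D i n = qf (vi D i) n"
  by (simp add: qfact_def qf_def qint_qi)

context datum
begin

lemma pairing_zero [simp]: "pairing D 0 x = 0" "pairing D y 0 = 0"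
  using pairing_add_left[of 0 0 x] pairing_add_right[of y 0 0] by simp_all

lemma pairing_minus [simp]: "pairing D (- y) x = - pairing D y x" "pairing D y (- x) = - pairing D y x"
  using pairing_add_left[of y "- y" x] pairing_add_right[of y x "- x"] by simp_all

lemma pairing_diff_right: "pairing D y (x - x') = pairing D y x - pairing D y x'"
  using pairing_add_right[of y x "- x'"] by simp

lemma pairing_kt:
  assumes "i \<in> idx D" "j \<in> idx D"
  shows "pairing D (kt D i) (root D j) = dot D i j"
proof -
  have "pairing D (sum_list (replicate n y)) x = int n * pairing D y x" for n y x
    by (induction n) (simp_all add: pairing_add_left algebra_simps)
  then have "2 * pairing D (kt D i) (root D j) = (2 * (dot D i i div 2)) * pairing D (coroot D i) (root D j)"
    using dot_pos[OF assms(1)] by (simp add: kt_def)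
  also have "\<dots> = 2 * dot D i j"
    using dot_even[OF assms(1)] dot_pairing[OF assms] by simp
  finally show ?thesis by simp
qed

lemma vi_square: "i \<in> idx D \<Longrightarrow> (vi D i)^2 = v powi dot D i i"
  using dot_even by (simp add: vi_def power_int_power' mult.commute)

lemma vi_powi_pairing:
  assumes "i \<in> idx D" "j \<in> idx D"
  shows "vi D i powi pairing D (coroot D i) (root D j) = v powi dot D i j"
proof -
  have "2 * (dot D i i div 2 * pairing D (coroot D i) (root D j)) = 2 * dot D i j"
    using dot_pairing[OF assms] dot_even[OF assms(1)] by (metis dvd_mult_div_cancel mult.assoc)
  then show ?thesis
    by (simp add: vi_def flip: power_int_mult)
qed

lemma generic_vi: "i \<in> idx D \<Longrightarrow> generic (vi D i)"
proof
  assume i: "i \<in> idx D"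
  show "vi D i \<noteq> 0" by (simp add: vi_def v_nonzero)
  fix n assume "vi D i powi n = 1"
  then have "dot D i i div 2 * n = 0"
    by (simp add: vi_def v_powi_eq_one flip: power_int_mult)
  moreover have "dot D i i div 2 \<noteq> 0"
    using dot_pos[OF i] dot_even[OF i] by auto
  ultimately show "n = 0" by simp
qed

lemma pairing_nonpos: "i \<in> idx D \<Longrightarrow> j \<in> idx D \<Longrightarrow> i \<noteq> j \<Longrightarrow> pairing D (coroot D i) (root D j) \<le> 0"
  using dot_pairing[of i j] dot_pos[of i] dot_nonpos[of i j]
  by (metis mult_le_0_iff not_less zero_less_mult_pos2 mult.commute mult_pos_pos zero_less_numeral)

end

lemma vertex_sum_swap:
  "sum_list (map g (vertex_sum m p x)) = sum_list (map g (vertex_sum p m x))"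
  for g :: "'i \<Rightarrow> 'b::ab_group_add"
  by (cases x) (simp_all add: add.commute)

locale contraction_datum = datum D for D :: "('i, 'y::ab_group_add, 'x::ab_group_add) rdatum" +
  fixes p m :: 'i
  assumes pm: "p \<in> idx D" "m \<in> idx D" "dot D p p = dot D m m" "dot D m m = - 2 * dot D p m"
begin

abbreviation D' where "D' \<equiv> contraction D p m"

lemma p_neq_m: "p \<noteq> m"
  using pm dot_pos[of m] by auto

lemma contraction_simps [simp]:
  "idx D' = Some ` (idx D - {p, m}) \<union> {None}" "pairing D' = pairing D"
  "coroot D' None = coroot D p + coroot D m" "coroot D' (Some i) = coroot D i"
  "root D' None = root D p + root D m" "root D' (Some i) = root D i"
  "dot D' (Some i) (Some j) = dot D i j"
  "dot D' None (Some j) = dot D p j + dot D m j"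
  "dot D' (Some j) None = dot D j p + dot D j m"
  by (simp_all add: contraction_def)

lemma dot_None [simp]: "dot D' None None = dot D p p"
  using pm dot_sym[of p m] by (simp add: contraction_def)

lemma contraction_vi [simp]: "vi D' None = vi D p" "vi D' (Some i) = vi D i"
  and vi_pm: "vi D m = vi D p"
  using pm by (simp_all add: vi_def)

lemma dot_pm: "v powi dot D p p = (vi D p)^2" "v powi dot D m m = (vi D p)^2"
    "v powi dot D p m = inverse (vi D p)" "v powi dot D m p = inverse (vi D p)"
proof -
  have "dot D p m = - (dot D p p div 2)" "dot D m p = dot D p m" using pm dot_sym[of p m] by auto
  then show "v powi dot D p m = inverse (vi D p)" "v powi dot D m p = inverse (vi D p)"
    by (simp_all add: vi_def power_int_minus)
qed (use pm vi_square vi_pm in auto)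

lemma contraction_kt [simp]: "kt D' None = kt D p + kt D m" "kt D' (Some i) = kt D i"
proof -
  have "sum_list (replicate n (a + b)) = sum_list (replicate n a) + sum_list (replicate n (b :: 'y))" for n a b
    by (induction n) (simp_all add: algebra_simps)
  then show "kt D' None = kt D p + kt D m" using pm by (simp add: kt_def)
qed (simp add: kt_def)

lemma datum_contraction: "datum D'"
proof
  fix i j assume i: "i \<in> idx D'" and j: "j \<in> idx D'"
  show "dot D' i j = dot D' j i"
    using i j pm dot_sym by auto
  show "0 < dot D' i i" "even (dot D' i i)"
    using i dot_pos dot_even pm(1) by auto
  show "dot D' i j \<le> 0" if "i \<noteq> j"
    using i j that pm by (auto intro!: dot_nonpos add_nonpos_nonpos)
  show "dot D' i i * pairing D' (coroot D' i) (root D' j) = 2 * dot D' i j"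
  proof -
    have lp: "dot D p p * pairing D (coroot D p) (root D l) = 2 * dot D p l"
      and lm: "dot D p p * pairing D (coroot D m) (root D l) = 2 * dot D m l" if "l \<in> idx D" for l
      using dot_pairing[of m l] dot_pairing[of p l] pm that by simp_all
    show ?thesis
    proof (cases i)
      case None
      show ?thesis
      proof (cases j)
        case None
        show ?thesis
          using lp[OF pm(1)] lp[OF pm(2)] lm[OF pm(1)] lm[OF pm(2)] pm(3,4) dot_sym[OF pm(1,2)]
          unfolding \<open>i = None\<close> None contraction_simps dot_None pairing_add_left pairing_add_right distrib_left
          by linarith
      next
        case (Some l)
        then have "l \<in> idx D" using j by auto
        from lp[OF this] lm[OF this] show ?thesis
          unfolding \<open>i = None\<close> Some contraction_simps dot_None pairing_add_left distrib_left by linarith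
      qed
    next
      case (Some l)
      then show ?thesis
        using i j dot_pairing pm
        by (cases j) (auto simp add: pairing_add_right distrib_left)
    qed
  qed
qed (simp_all add: pairing_add_left pairing_add_right pairing_nondegenerate)

lemma contraction_swap: "contraction D m p = D'"
  unfolding contraction_def vertex_sum_swap[of _ m p] by (simp add: insert_commute)

lemma contraction_datum_swap: "contraction_datum D m p"
  using pm dot_sym[of p m] by unfold_locales auto

end

section \<open>Algebras with quantum group generators\<close>

context central_scalars
begin

definition serre_val :: "('i, 'y, 'x) rdatum \<Rightarrow> ('i \<Rightarrow> 'a) \<Rightarrow> 'i \<Rightarrow> 'i \<Rightarrow> 'a" where
  "serre_val D e i j = (let n = nat (1 - pairing D (coroot D i) (root D j))
     in \<Sum>r\<le>n. (- 1) ^ r * ((1 / qfact D i (n - r)) \<bullet> e i ^ (n - r)) * e j * ((1 / qfact D i r) \<bullet> e i ^ r))"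

lemma evl_serre: "evl s X (serre D x i j) = serre_val D (X \<circ> x) i j"
  by (simp add: serre_def serre_val_def Let_def div_power_def evl_simps scl_def)

end

locale quantum_rep = datum D + central_scalars s
  for D :: "('i, 'y::ab_group_add, 'x::ab_group_add) rdatum" and s :: "Qv \<Rightarrow> 'a::ring_1" +
  fixes e f :: "'i \<Rightarrow> 'a" and k :: "'y \<Rightarrow> 'a"
  assumes k_zero: "k 0 = 1" and k_add: "k \<mu> * k \<nu> = k (\<mu> + \<nu>)"
    and ke: "i \<in> idx D \<Longrightarrow> k \<mu> * e i = v powi pairing D \<mu> (root D i) \<bullet> (e i * k \<mu>)"
    and kf: "i \<in> idx D \<Longrightarrow> k \<mu> * f i = v powi (- pairing D \<mu> (root D i)) \<bullet> (f i * k \<mu>)"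
    and ef: "i \<in> idx D \<Longrightarrow> e i * f i - f i * e i
      = (1 / (vi D i - inverse (vi D i))) \<bullet> (k (kt D i) - k (- kt D i))"
    and ef_commute: "i \<in> idx D \<Longrightarrow> j \<in> idx D \<Longrightarrow> i \<noteq> j \<Longrightarrow> e i * f j = f j * e i"
    and serre_e: "i \<in> idx D \<Longrightarrow> j \<in> idx D \<Longrightarrow> i \<noteq> j \<Longrightarrow> serre_val D e i j = 0"
    and serre_f: "i \<in> idx D \<Longrightarrow> j \<in> idx D \<Longrightarrow> i \<noteq> j \<Longrightarrow> serre_val D f i j = 0"

lemma quantum_rep_iff:
  assumes "datum D" "central_scalars s"
  shows "(\<forall>r\<in>qrels D. evl s X r = 0) \<longleftrightarrow>
    quantum_rep D s (\<lambda>i. X (E i)) (\<lambda>i. X (F i)) (\<lambda>\<mu>. X (K \<mu>))" (is "?l = ?r")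
proof -
  interpret datum D by fact
  interpret central_scalars s by fact
  note simps = evl_simps evl_serre Kt_kt scl_def comp_def mult.assoc
  show ?thesis
  proof
    assume ?l
    then have l: "r \<in> qrels D \<Longrightarrow> evl s X r = 0" for r by blast
    show ?r
    proof
      show "X (K 0) = 1"
        using l[of "gen (K 0) - 1"] by (simp add: qrels_def simps)
      fix \<mu> \<nu>
      have "gen (K \<mu>) * gen (K \<nu>) - gen (K (\<mu> + \<nu>)) \<in> qrels D" unfolding qrels_def by blast
      from l[OF this] show "X (K \<mu>) * X (K \<nu>) = X (K (\<mu> + \<nu>))" by (simp add: simps)
      fix i j assume i: "i \<in> idx D"
      have "gen (K \<mu>) * gen (E i) - scal (v powi pairing D \<mu> (root D i)) * gen (E i) * gen (K \<mu>) \<in> qrels D"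
        unfolding qrels_def using i by blast
      from l[OF this] show "X (K \<mu>) * X (E i) = v powi pairing D \<mu> (root D i) \<bullet> (X (E i) * X (K \<mu>))"
        by (simp add: simps)
      have "gen (K \<mu>) * gen (F i) - scal (v powi (- pairing D \<mu> (root D i))) * gen (F i) * gen (K \<mu>) \<in> qrels D"
        unfolding qrels_def using i by blast
      from l[OF this] show "X (K \<mu>) * X (F i) = v powi (- pairing D \<mu> (root D i)) \<bullet> (X (F i) * X (K \<mu>))"
        by (simp add: simps)
      have EF: "gen (E i) * gen (F j) - gen (F j) * gen (E i)
           - (if i = j then scal (1 / (vi D i - inverse (vi D i))) * (gen (Kt D i) - gen (Kt_inv D i))
              else 0) \<in> qrels D" if "j \<in> idx D" for j
        unfolding qrels_def using i that by blast
      from l[OF EF[OF i]]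
      show "X (E i) * X (F i) - X (F i) * X (E i)
        = (1 / (vi D i - inverse (vi D i))) \<bullet> (X (K (kt D i)) - X (K (- kt D i)))"
        by (simp add: simps)
      assume j: "j \<in> idx D" "i \<noteq> j"
      from l[OF EF[OF j(1)]] j show "X (E i) * X (F j) = X (F j) * X (E i)"
        by (simp add: simps)
      have "serre D E i j \<in> qrels D" "serre D F i j \<in> qrels D"
        unfolding qrels_def using i j by blast+
      from l[OF this(1)] l[OF this(2)]
      show "serre_val D (\<lambda>i. X (E i)) i j = 0" "serre_val D (\<lambda>i. X (F i)) i j = 0"
        by (simp_all add: simps)
    qed
  next
    assume ?r
    then interpret quantum_rep D s "\<lambda>i. X (E i)" "\<lambda>i. X (F i)" "\<lambda>\<mu>. X (K \<mu>)" .
    show ?l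
    proof
      fix r assume "r \<in> qrels D"
      then show "evl s X r = 0"
        unfolding qrels_def
        by (elim UnE; clarify;
            use k_zero k_add ke kf ef ef_commute serre_e serre_f in \<open>simp add: simps split: if_split\<close>)
    qed
  qed
qed

lemma (in datum) serre_val_nilpotent:
  fixes s :: "Qv \<Rightarrow> 'a::ring_1" and K L :: 'a
  assumes "central_scalars s" and ij: "i \<in> idx D" "j \<in> idx D" "i \<noteq> j"
    and KL: "K * L = 1" "L * K = 1"
    and X: "K * X i = s (v powi dot D i i) * (X i * K)" "K * X j = s (v powi dot D i j) * (X j * K)"
  shows "borel s (vi D i) (X i) K L"
    and "central_scalars.serre_val s D X i j = 0 \<longleftrightarrow>
      (borel.\<delta> (X i) K L ^^ nat (1 - pairing D (coroot D i) (root D j))) (X j) = 0"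
proof -
  interpret central_scalars s by fact
  interpret g: generic "vi D i" by (rule generic_vi[OF ij(1)])
  show "borel s (vi D i) (X i) K L"
    by unfold_locales (simp_all add: KL X scl_def vi_square[OF ij(1)])
  then interpret b: borel s "vi D i" "X i" K L .
  define n where "n = nat (1 - pairing D (coroot D i) (root D j))"
  have n: "1 - int n = pairing D (coroot D i) (root D j)"
    using pairing_nonpos[OF ij] by (simp add: n_def)
  have "b.\<sigma> (X j) = vi D i powi (1 - int n) \<bullet> X j"
    unfolding n vi_powi_pairing[OF ij(1,2)] by (simp add: b.\<sigma>_def X scl_def mult.assoc KL)
  from b.serre_sum_eq_0_iff[OF this]
  show "serre_val D X i j = 0 \<longleftrightarrow>
      (b.\<delta> ^^ nat (1 - pairing D (coroot D i) (root D j))) (X j) = 0"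
    by (simp add: serre_val_def Let_def b.serre_sum_def b.dpow_def qfact_qf n_def)
qed

context quantum_rep
begin

lemma k_minus: "k \<mu> * k (- \<mu>) = 1" "k (- \<mu>) * k \<mu> = 1"
  by (simp_all add: k_add k_zero)

text \<open>
  The Chevalley involution: what is proved for the \<open>e i\<close> also holds for the \<open>f i\<close>.
\<close>

lemma quantum_rep_flip: "quantum_rep D s f e (\<lambda>\<mu>. k (- \<mu>))"
proof
  show "k (- 0) = 1" by (simp add: k_zero)
  show "k (- \<mu>) * k (- \<nu>) = k (- (\<mu> + \<nu>))" for \<mu> \<nu> by (simp add: k_add add.commute)
  fix i \<mu> assume i: "i \<in> idx D"
  show "k (- \<mu>) * f i = v powi pairing D \<mu> (root D i) \<bullet> (f i * k (- \<mu>))"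
    "k (- \<mu>) * e i = v powi (- pairing D \<mu> (root D i)) \<bullet> (e i * k (- \<mu>))"
    using ke[OF i] kf[OF i] by simp_all
  show "f i * e i - e i * f i = (1 / (vi D i - inverse (vi D i))) \<bullet> (k (- kt D i) - k (- (- kt D i)))"
    using arg_cong[OF ef[OF i], of uminus] by (simp add: scl_right)
qed (simp_all add: ef_commute serre_e serre_f)

lemma sl2: "i \<in> idx D \<Longrightarrow> sl2 s (vi D i) (e i) (k (kt D i)) (k (- kt D i)) (f i)"
proof -
  assume i: "i \<in> idx D"
  interpret g: generic "vi D i" by (rule generic_vi[OF i])
  show ?thesis
    by unfold_locales (simp_all add: k_minus ke ef i pairing_kt vi_square)
qed

lemma e_nilpotent:
  assumes "i \<in> idx D" "j \<in> idx D" "i \<noteq> j"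
  shows "(borel.\<delta> (e i) (k (kt D i)) (k (- kt D i)) ^^ nat (1 - pairing D (coroot D i) (root D j))) (e j) = 0"
  using serre_val_nilpotent(2)[OF central_scalars_axioms assms k_minus, of "kt D i" e] serre_e[OF assms] assms
  by (simp add: ke pairing_kt scl_def)

end

locale contraction_rep = quantum_rep D s e f k + contraction_datum D p m
  for D :: "('i, 'y::ab_group_add, 'x::ab_group_add) rdatum" and s :: "Qv \<Rightarrow> 'a::ring_1"
    and e f k p m
begin

abbreviation q where "q \<equiv> vi D p"

lemma pairing_pm: "pairing D (coroot D p) (root D m) = - 1" "pairing D (coroot D m) (root D p) = - 1"
proof -
  have "dot D p p * (pairing D (coroot D p) (root D m) + 1) = 0"
    "dot D p p * (pairing D (coroot D m) (root D p) + 1) = 0"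
    using dot_pairing[of p m] dot_pairing[of m p] pm dot_sym[of p m] by (simp_all add: distrib_left)
  then show "pairing D (coroot D p) (root D m) = - 1" "pairing D (coroot D m) (root D p) = - 1"
    using dot_pos[of p] pm by auto
qed

lemma rank2: "rank2 s q (e p) (e m) (f p) (f m) (k (kt D p)) (k (kt D m)) (k (- kt D p)) (k (- kt D m))"
proof -
  interpret g: generic q by (rule generic_vi) (rule pm)
  have serre: "e i * (e i * e j) + e j * (e i * e i) = (q + inverse q) \<bullet> (e i * (e j * e i))"
    if ij: "i = p \<and> j = m \<or> i = m \<and> j = p" for i j
  proof -
    have i: "i \<in> idx D" "j \<in> idx D" "i \<noteq> j" "vi D i = q" using ij pm p_neq_m vi_pm by auto
    interpret b: sl2 s q "e i" "k (kt D i)" "k (- kt D i)" "f i" using sl2[OF i(1)] i(4) by simp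
    have "(b.\<delta> ^^ 2) (e j) = 0"
      using e_nilpotent[OF i(1-3)] ij pairing_pm by auto
    moreover have "b.\<sigma> (e j) = inverse q \<bullet> e j"
      using ij dot_pm i by (auto simp: b.\<sigma>_def ke pairing_kt mult.assoc k_minus)
    ultimately show ?thesis
      by (simp add: numeral_2_eq_2 b.\<delta>_def b.\<sigma>_linear b.\<sigma>_mult b.\<sigma>_E algebra_simps scl_right scl_left power2_eq_square)
  qed
  show ?thesis
    by unfold_locales
      (use pm(1,2) vi_pm ef[of p] ef[of m] ef_commute[of p m] ef_commute[of m p] p_neq_m serre in
        \<open>simp_all add: k_minus k_zero k_add add.commute[of "kt D m" "kt D p"] ke kf pairing_kt dot_pm power_int_minus\<close>)
qed

sublocale r: rank2 s q "e p" "e m" "f p" "f m" "k (kt D p)" "k (kt D m)" "k (- kt D p)" "k (- kt D m)"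
  by (rule rank2)

lemma contracted_weight:
  assumes "l \<in> idx D'" and X: "X None = c \<bullet> r.E0" "\<And>l. X (Some l) = e l"
  shows "k \<mu> * X l = v powi pairing D \<mu> (root D' l) \<bullet> (X l * k \<mu>)"
proof (cases l)
  case None
  have "v powi (pairing D \<mu> (root D p) + pairing D \<mu> (root D m))
      = v powi pairing D \<mu> (root D p) * v powi pairing D \<mu> (root D m)"
    by (simp add: power_int_add v_nonzero)
  moreover have "k \<mu> * (e a * e b)
     = (v powi pairing D \<mu> (root D a) * v powi pairing D \<mu> (root D b)) \<bullet> (e a * e b * k \<mu>)"
    if "a \<in> idx D" "b \<in> idx D" for a b
    using ke[OF that(1), of \<mu>, THEN r.assoc_rule] ke[OF that(2), of \<mu>] by (simp add: mult.assoc mult_ac)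
  ultimately show ?thesis
    using pm by (simp add: None X r.E0_def pairing_add_right algebra_simps scl_right)
qed (use assms ke in auto)

text \<open>
  Only two kinds of relations are new.  If the new vertex is acted upon, the Leibniz rule gives the
  order of nilpotency on a product of \<open>e p\<close> and \<open>e m\<close>, since pairings with the two roots add up.
  If it acts, the relation is the statement about the rank two system proved above.
\<close>

lemma serre_contraction:
  assumes ij: "i \<in> idx D'" "j \<in> idx D'" "i \<noteq> j" and X: "X None = c \<bullet> r.E0" "\<And>l. X (Some l) = e l"
  shows "serre_val D' X i j = 0"
proof -
  note X_weight = contracted_weight[OF _ X]
  interpret D': datum D' by (rule datum_contraction)
  have weights: "k (kt D' i) * X l = v powi dot D' i l \<bullet> (X l * k (kt D' i))" if "l \<in> idx D'" for l
    using X_weight[OF that] D'.pairing_kt[OF ij(1) that] by simp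
  note nilpotent = D'.serre_val_nilpotent[OF central_scalars_axioms ij k_minus, of "kt D' i" X,
      OF weights[OF ij(1), unfolded scl_def] weights[OF ij(2), unfolded scl_def]]
  interpret b: borel s "vi D' i" "X i" "k (kt D' i)" "k (- kt D' i)" by (rule nilpotent(1))
  define n where "n = nat (1 - pairing D' (coroot D' i) (root D' j))"
  have n: "1 - int n = pairing D' (coroot D' i) (root D' j)"
    using D'.pairing_nonpos[OF ij] by (simp add: n_def)
  have "serre_val D' X i j = 0 \<longleftrightarrow> (b.\<delta> ^^ n) (X j) = 0"
    using nilpotent(2) by (simp add: n_def)
  also have "(b.\<delta> ^^ n) (X j) = 0"
  proof (cases i)
    case (Some i')
    then have i': "i' \<in> idx D" "i' \<noteq> p" "i' \<noteq> m" using ij by auto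
    have nil: "(b.\<delta> ^^ nat (1 - pairing D (coroot D i') (root D l))) (e l) = 0" if "l \<in> idx D" "l \<noteq> i'" for l
      using e_nilpotent[OF i'(1) that(1)] that(2) X Some by simp
    show ?thesis
    proof (cases j)
      case (Some j')
      then have "j' \<in> idx D" "j' \<noteq> i'" using ij \<open>i = Some i'\<close> by auto
      from nil[OF this] show ?thesis using Some \<open>i = Some i'\<close> by (simp add: X n_def)
    next
      case None
      have "pairing D (coroot D i') (root D p) \<le> 0" "pairing D (coroot D i') (root D m) \<le> 0"
        using pairing_nonpos i' pm by auto
      then have "nat (1 - pairing D (coroot D i') (root D p)) + nat (1 - pairing D (coroot D i') (root D m)) \<le> Suc n"
        using None Some by (simp add: n_def pairing_add_right)
      note sum = this
      have p0: "(b.\<delta> ^^ nat (1 - pairing D (coroot D i') (root D p))) (e p) = 0"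
        and m0: "(b.\<delta> ^^ nat (1 - pairing D (coroot D i') (root D m))) (e m) = 0"
        using nil pm(1,2) i' by auto
      have "(b.\<delta> ^^ n) (e p * e m) = 0" "(b.\<delta> ^^ n) (e m * e p) = 0"
        using b.\<delta>_pow_mult[OF _ p0 m0, of n] b.\<delta>_pow_mult[OF _ m0 p0, of n] sum by (simp_all add: add.commute)
      then show ?thesis using None by (simp add: X r.E0_def b.\<delta>_pow_linear)
    qed
  next
    case None
    then obtain j' where j': "j = Some j'" "j' \<in> idx D" "j' \<noteq> p" "j' \<noteq> m" using ij by auto
    define a b where "a = nat (- pairing D (coroot D p) (root D j'))"
      and "b = nat (- pairing D (coroot D m) (root D j'))"
    have ab: "int a = - pairing D (coroot D p) (root D j')" "int b = - pairing D (coroot D m) (root D j')"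
      using pairing_nonpos[OF pm(1) j'(2)] pairing_nonpos[OF pm(2) j'(2)] j' by (simp_all add: a_def b_def)
    have n_ab: "n = Suc (a + b)"
      using n ab j' None by (simp add: pairing_add_left)
    have wp: "r.p.\<sigma> (e j') = q powi (- int a) \<bullet> e j'" and wm: "k (kt D m) * e j' * k (- kt D m) = q powi (- int b) \<bullet> e j'"
      using vi_powi_pairing[OF pm(1) j'(2)] vi_powi_pairing[OF pm(2) j'(2)] ab j' pm(1,2) vi_pm
      by (simp_all add: r.p.\<sigma>_def ke pairing_kt mult.assoc k_minus)
    have sp: "(r.p.\<delta> ^^ Suc a) (e j') = 0"
    proof -
      have "nat (1 - pairing D (coroot D p) (root D j')) = Suc a" using ab(1) by linarith
      then show ?thesis using e_nilpotent[OF pm(1) j'(2)] j'(3) by metis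
    qed
    interpret mb: borel s q "e m" "k (kt D m)" "k (- kt D m)"
      using sl2[OF pm(2)] vi_pm by (simp add: sl2_def)
    have sm: "(r.mb.\<delta> ^^ Suc b) (e j') = 0"
    proof -
      have "(mb.\<delta> ^^ Suc b) (e j') = 0"
      proof -
        have "nat (1 - pairing D (coroot D m) (root D j')) = Suc b" using ab(2) by linarith
        then show ?thesis using e_nilpotent[OF pm(2) j'(2)] j'(4) by metis
      qed
      moreover have "mb.\<sigma> (e j') = q powi (1 - int (Suc b)) \<bullet> e j'"
        using wm by (simp add: mb.\<sigma>_def)
      ultimately have "mb.serre_sum (Suc b) (e j') = 0"
        using mb.serre_sum_eq_0_iff by blast
      then have "r.mb.serre_sum (Suc b) (e j') = 0"
        by (simp add: mb.serre_sum_bar)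
      moreover have "r.mb.\<sigma> (e j') = inverse q powi (1 - int (Suc b)) \<bullet> e j'"
      proof -
        have "e j' = k (- kt D m) * (k (kt D m) * e j' * k (- kt D m)) * k (kt D m)"
          by (simp add: mult.assoc k_minus k_minus[THEN r.assoc_rule])
        also have "\<dots> = q powi (- int b) \<bullet> r.mb.\<sigma> (e j')"
          by (simp only: wm) (simp add: r.mb.\<sigma>_def mult.assoc)
        finally have "q powi int b \<bullet> e j' = (q powi int b * q powi (- int b)) \<bullet> r.mb.\<sigma> (e j')"
          by (metis scl_simps(3))
        then show ?thesis by (simp add: power_int_inverse power_int_minus power_inverse)
      qed
      ultimately show ?thesis using r.mb.serre_sum_eq_0_iff by blast
    qed
    have "(r.z.\<delta> ^^ Suc (a + b)) (e j') = 0"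
      using r.contracted_serre[OF wp wm sp sm] ef_commute[OF j'(2) pm(1)] ef_commute[OF j'(2) pm(2)] j' by auto
    moreover have "b.\<delta> x = c \<bullet> r.z.\<delta> x" for x
      by (simp only: b.\<delta>_def b.\<sigma>_def r.z.\<delta>_def r.z.\<sigma>_def)
        (simp add: r.K0_def r.L0_def None X k_add scl_right add.commute)
    then have "(b.\<delta> ^^ N) x = c ^ N \<bullet> (r.z.\<delta> ^^ N) x" for N x
      by (induction N) (simp_all add: r.z.\<delta>_linear)
    ultimately show ?thesis
      by (simp add: n_ab j' X del: funpow.simps)
  qed
  finally show ?thesis by blast
qed

lemma contraction_rep_flip: "contraction_rep D s f e (\<lambda>\<mu>. k (- \<mu>)) p m"
  using quantum_rep_flip contraction_datum_axioms by (simp add: contraction_rep_def)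

lemma contraction_rep_swap: "contraction_rep D s e f k m p"
  using quantum_rep_axioms contraction_datum_swap by (simp add: contraction_rep_def)

text \<open>
  The rescaling by \<open>c\<close> is there for the other sign of the twist in the embedding.
\<close>

lemma contraction_quantum_rep:
  assumes c: "c \<noteq> 0" and X: "X None = c \<bullet> r.E0" "\<And>l. X (Some l) = e l"
    and Y: "Y None = inverse c \<bullet> r.F0" "\<And>l. Y (Some l) = f l"
  shows "quantum_rep D' s X Y k"
proof -
  interpret D': datum D' by (rule datum_contraction)
  interpret fl: contraction_rep D s f e "\<lambda>\<mu>. k (- \<mu>)" p m by (rule contraction_rep_flip)
  have "fl.r.E0 = (- inverse q) \<bullet> r.F0"
    by (simp add: fl.r.E0_def r.F0_def scl_right)
  then have Y0: "Y None = (- (inverse c * q)) \<bullet> fl.r.E0"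
    by (simp add: Y mult.assoc)
  show ?thesis
  proof
    fix i \<mu> assume i: "i \<in> idx D'"
    show "k \<mu> * X i = v powi pairing D' \<mu> (root D' i) \<bullet> (X i * k \<mu>)"
      using contracted_weight[OF i X] by simp
    show "k \<mu> * Y i = v powi (- pairing D' \<mu> (root D' i)) \<bullet> (Y i * k \<mu>)"
      using fl.contracted_weight[OF i Y0 Y(2), of "- \<mu>"] by simp
    show "X i * Y i - Y i * X i = (1 / (vi D' i - inverse (vi D' i))) \<bullet> (k (kt D' i) - k (- kt D' i))"
    proof (cases i)
      case None
      show ?thesis
        using r.E0_F0 c by (simp add: None X Y r.K0_def r.L0_def k_add add.commute)
    qed (use i X Y ef in auto)
    fix j assume j: "j \<in> idx D'" "i \<noteq> j"
    have "e l * r.F0 = r.F0 * e l" "r.E0 * f l = f l * r.E0" if l: "l \<in> idx D" "l \<noteq> p" "l \<noteq> m" for l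
    proof -
      have "e l * (f a * f b) = f a * f b * e l" "e a * e b * f l = f l * (e a * e b)"
        if "a = p \<or> a = m" "b = p \<or> b = m" for a b
      proof -
        have comm: "x * (y * z) = y * z * x" if "x * y = y * x" "x * z = z * x" for x y z :: 'a
          using that by (metis mult.assoc)
        have ab: "a \<in> idx D" "b \<in> idx D" "l \<noteq> a" "l \<noteq> b" using that l pm(1,2) by auto
        show "e l * (f a * f b) = f a * f b * e l"
          by (rule comm) (use ef_commute l ab in auto)
        have "f l * (e a * e b) = e a * e b * f l"
          by (rule comm) (use ef_commute l ab in auto)
        then show "e a * e b * f l = f l * (e a * e b)" ..
      qed
      then show "e l * r.F0 = r.F0 * e l" "r.E0 * f l = f l * r.E0"
        by (simp_all add: r.F0_def r.E0_def algebra_simps)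
    qed
    then show "X i * Y j = Y j * X i"
      using i j by (cases i; cases j) (simp_all add: X Y ef_commute image_iff)
    show "serre_val D' X i j = 0" "serre_val D' Y i j = 0"
      using serre_contraction[OF i j X] fl.serre_contraction[OF i j Y0 Y(2)] .
  qed (simp_all add: k_zero k_add)
qed

text \<open>
  The two signs are exchanged by exchanging the two contracted vertices, up to rescaling the new
  generators by \<open>- q\<close> and its inverse.
\<close>

theorem quantum_rep_contraction:
  assumes \<epsilon>: "\<epsilon> \<in> {1, - 1 :: int}"
    and X: "X None = e p * e m - q powi (- \<epsilon>) \<bullet> (e m * e p)" "\<And>l. X (Some l) = e l"
    and Y: "Y None = f m * f p - q powi \<epsilon> \<bullet> (f p * f m)" "\<And>l. Y (Some l) = f l"
  shows "quantum_rep D' s X Y k"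
proof (cases "\<epsilon> = 1")
  case True
  then show ?thesis
    by (intro contraction_quantum_rep[of 1]) (simp_all add: X Y r.E0_def r.F0_def power_int_minus)
next
  case False
  then have [simp]: "\<epsilon> = - 1" using \<epsilon> by simp
  interpret sw: contraction_rep D s e f k m p by (rule contraction_rep_swap)
  have "quantum_rep (contraction D m p) s X Y k"
    by (rule sw.contraction_quantum_rep[of "- q"])
      (unfold X Y sw.r.E0_def sw.r.F0_def, simp_all add: vi_pm power_int_minus scl_right)
  then show ?thesis by (simp add: contraction_swap)
qed

end

section \<open>A ring containing all quotients of a free algebra\<close>

definition two_sided :: "'g free set \<Rightarrow> bool" where
  "two_sided J \<longleftrightarrow> 0 \<in> J \<and> (\<forall>p\<in>J. \<forall>q\<in>J. p + q \<in> J) \<and> (\<forall>p\<in>J. \<forall>a b. a * p * b \<in> J)"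

lemma two_sidedD:
  assumes "two_sided J"
  shows "0 \<in> J" "p \<in> J \<Longrightarrow> q \<in> J \<Longrightarrow> p + q \<in> J" "p \<in> J \<Longrightarrow> a * p \<in> J" "p \<in> J \<Longrightarrow> p * a \<in> J"
    "p \<in> J \<Longrightarrow> - p \<in> J"
proof -
  have *: "p \<in> J \<Longrightarrow> a * p * b \<in> J" for p a b
    using assms by (simp add: two_sided_def)
  show "0 \<in> J" "p \<in> J \<Longrightarrow> q \<in> J \<Longrightarrow> p + q \<in> J" using assms by (simp_all add: two_sided_def)
  show "p \<in> J \<Longrightarrow> a * p \<in> J" "p \<in> J \<Longrightarrow> p * a \<in> J" "p \<in> J \<Longrightarrow> - p \<in> J"
    using *[of p a 1] *[of p 1 a] *[of p "- 1" 1] by simp_all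
qed

lemma two_sided_diff: "two_sided J \<Longrightarrow> p \<in> J \<Longrightarrow> q \<in> J \<Longrightarrow> p - q \<in> J"
  using two_sidedD(2)[of J p "- q"] two_sidedD(5)[of J q] by simp

lemma two_sided_cong:
  assumes "two_sided J" "p - p' \<in> J"
  shows "- p - - p' \<in> J" "q - q' \<in> J \<Longrightarrow> (p + q) - (p' + q') \<in> J"
    "q - q' \<in> J \<Longrightarrow> (p - q) - (p' - q') \<in> J" "q - q' \<in> J \<Longrightarrow> p * q - p' * q' \<in> J"
proof -
  show "- p - - p' \<in> J" using two_sidedD(5)[OF assms] by simp
  show "(p + q) - (p' + q') \<in> J" if "q - q' \<in> J"
    using two_sidedD(2)[OF assms that] by (simp add: algebra_simps)
  show "(p - q) - (p' - q') \<in> J" if "q - q' \<in> J"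
    using two_sided_diff[OF assms that] by (simp add: algebra_simps)
  show "p * q - p' * q' \<in> J" if "q - q' \<in> J"
    using two_sidedD(2)[OF assms(1) two_sidedD(4)[OF assms, of q] two_sidedD(3)[OF assms(1) that, of p']]
    by (simp add: algebra_simps)
qed

text \<open>
  The product of the quotients of a free algebra by all its two-sided ideals.  A quotient by one
  ideal depends on that ideal and is not a type, but it embeds into this product, so that what is
  proved for all rings can be transferred to it.
\<close>

quotient_type 'g quotients = "'g free set \<Rightarrow> 'g free" / "\<lambda>f g. \<forall>J. two_sided J \<longrightarrow> f J - g J \<in> J"
proof (rule equivpI)
  show "reflp (\<lambda>f g :: 'g free set \<Rightarrow> 'g free. \<forall>J. two_sided J \<longrightarrow> f J - g J \<in> J)"
    by (rule reflpI) (simp add: two_sidedD)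
  show "symp (\<lambda>f g :: 'g free set \<Rightarrow> 'g free. \<forall>J. two_sided J \<longrightarrow> f J - g J \<in> J)"
    by (rule sympI) (metis minus_diff_eq two_sidedD(5))
  show "transp (\<lambda>f g :: 'g free set \<Rightarrow> 'g free. \<forall>J. two_sided J \<longrightarrow> f J - g J \<in> J)"
  proof (rule transpI, intro allI impI)
    fix f g h :: "'g free set \<Rightarrow> 'g free" and J :: "'g free set"
    assume "\<forall>J. two_sided J \<longrightarrow> f J - g J \<in> J" "\<forall>J. two_sided J \<longrightarrow> g J - h J \<in> J" "two_sided J"
    then have "(f J - g J) + (g J - h J) \<in> J" by (intro two_sidedD(2)) auto
    then show "f J - h J \<in> J" by simp
  qed
qed

instantiation quotients :: (type) ring_1
begin

lift_definition zero_quotients :: "'a quotients" is "\<lambda>J. 0" .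
lift_definition one_quotients :: "'a quotients" is "\<lambda>J. 1" .
lift_definition uminus_quotients :: "'a quotients \<Rightarrow> 'a quotients" is "\<lambda>f J. - f J"
  by (rule two_sided_cong) auto
lift_definition plus_quotients :: "'a quotients \<Rightarrow> 'a quotients \<Rightarrow> 'a quotients" is "\<lambda>f g J. f J + g J"
  by (rule two_sided_cong) auto
lift_definition minus_quotients :: "'a quotients \<Rightarrow> 'a quotients \<Rightarrow> 'a quotients" is "\<lambda>f g J. f J - g J"
  by (rule two_sided_cong) auto
lift_definition times_quotients :: "'a quotients \<Rightarrow> 'a quotients \<Rightarrow> 'a quotients" is "\<lambda>f g J. f J * g J"
  by (rule two_sided_cong) auto

instance
proof
  have "two_sided ({0} :: 'a free set)" by (simp add: two_sided_def)
  then show "(0 :: 'a quotients) \<noteq> 1"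
    unfolding zero_quotients.abs_eq one_quotients.abs_eq quotients.abs_eq_iff
    by (auto intro!: exI[of _ "{0}"])
qed (transfer; simp add: two_sidedD algebra_simps)+

end

text \<open>
  An element of the quotient by \<open>J0\<close> is extended to the other components by an algebra map \<open>\<chi>\<close> that
  kills the relations of interest, so that the relations hold in the whole product.
\<close>

definition component :: "'g free set \<Rightarrow> ('g free \<Rightarrow> 'g free) \<Rightarrow> 'g free \<Rightarrow> 'g quotients" where
  "component J0 \<chi> p = abs_quotients (\<lambda>J. if J = J0 then p else \<chi> p)"

lemma component_eq_0_iff:
  "component J0 \<chi> p = 0 \<longleftrightarrow> (\<forall>J. two_sided J \<longrightarrow> (if J = J0 then p else \<chi> p) \<in> J)"
  unfolding component_def zero_quotients.abs_eq quotients.abs_eq_iff by simp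

lemma central_scalars_component: "central_scalars (\<lambda>c. component (J0 :: 'g free set) (evl scal h) (scal c))"
proof
  fix c and x :: "'g quotients"
  show "x * component J0 (evl scal h) (scal c) = component J0 (evl scal h) (scal c) * x"
  proof (induction x rule: quotients.abs_induct)
    case (1 f)
    show ?case
      unfolding component_def times_quotients.abs_eq
      by (rule arg_cong[where f = abs_quotients]) (auto simp: fun_eq_iff free.evl_scal scal_commute)
  qed
qed (unfold component_def plus_quotients.abs_eq times_quotients.abs_eq one_quotients.abs_eq,
     rule_tac [!] arg_cong[where f = abs_quotients],
     auto simp: fun_eq_iff free.evl_scal free.evl_add free.evl_one single_add mult_single)

lemma evl_component:
  "evl (\<lambda>c. component J0 (evl scal h) (scal c)) (\<lambda>g. component J0 (evl scal h) (gen g)) p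
     = component J0 (evl scal h) p" (is "evl ?s ?X p = ?c p")
proof -
  interpret central_scalars ?s by (rule central_scalars_component)
  have mult: "?c (p * q) = ?c p * ?c q" and add: "?c (p + q) = ?c p + ?c q" for p q
    unfolding component_def plus_quotients.abs_eq times_quotients.abs_eq
    by (rule_tac [!] arg_cong[where f = abs_quotients]) (auto simp: fun_eq_iff free.evl_mult free.evl_add)
  have zero: "?c 0 = 0" and one: "?c 1 = 1"
    unfolding component_def zero_quotients.abs_eq one_quotients.abs_eq
    by (rule_tac [!] arg_cong[where f = abs_quotients]) (auto simp: fun_eq_iff free.evl_one)
  have word: "prod_list (map ?X w) = ?c (wmon w 1)" for w
  proof (induction w)
    case Nil
    show ?case using one by (simp add: zero_word_def flip: single_one)
  next
    case (Cons g w)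
    have "prod_list (map ?X (g # w)) = ?c (gen g) * ?c (wmon w 1)"
      by (simp only: list.map prod_list.Cons Cons)
    also have "\<dots> = ?c (wmon (g # w) 1)"
      by (simp only: mult single_Word_Cons[of g w])
    finally show ?case .
  qed
  show ?thesis
  proof (induction p rule: monomial_induct[OF free_alg_UNIV])
    case (2 w c)
    have "evl ?s ?X (wmon w c) = ?c (scal c) * prod_list (map ?X w)"
      by (simp only: evl_single word.sel)
    also have "\<dots> = ?c (scal c * wmon w 1)"
      by (simp only: word mult)
    finally show ?case by (simp add: mult_single)
  qed (simp_all add: zero evl_add add)
qed

section \<open>The quantum group as a quotient\<close>

lemma free_alg_closed:
  "0 \<in> carrier (free_alg G)" "1 \<in> carrier (free_alg G)" "scal c \<in> carrier (free_alg G)"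
  "g \<in> G \<Longrightarrow> gen g \<in> carrier (free_alg G)"
  "p \<in> carrier (free_alg G) \<Longrightarrow> q \<in> carrier (free_alg G) \<Longrightarrow> p + q \<in> carrier (free_alg G)"
  "p \<in> carrier (free_alg G) \<Longrightarrow> q \<in> carrier (free_alg G) \<Longrightarrow> p - q \<in> carrier (free_alg G)"
  "p \<in> carrier (free_alg G) \<Longrightarrow> q \<in> carrier (free_alg G) \<Longrightarrow> p * q \<in> carrier (free_alg G)"
  "p \<in> carrier (free_alg G) \<Longrightarrow> - p \<in> carrier (free_alg G)"
  "set w \<subseteq> G \<Longrightarrow> wmon w c \<in> carrier (free_alg G)"
proof -
  interpret ring "free_alg G" by (rule ring_free_alg)
  show m: "- p \<in> carrier (free_alg G)" if "p \<in> carrier (free_alg G)" for p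
    using that by (simp add: free_alg_carrier_iff in_keys_iff)
  show a: "p + q \<in> carrier (free_alg G)" if "p \<in> carrier (free_alg G)" "q \<in> carrier (free_alg G)" for p q
    using a_closed[OF that] by (simp add: free_alg_def)
  show "p - q \<in> carrier (free_alg G)" if "p \<in> carrier (free_alg G)" "q \<in> carrier (free_alg G)"
    using a[OF that(1) m[OF that(2)]] by simp
  show "p * q \<in> carrier (free_alg G)" if "p \<in> carrier (free_alg G)" "q \<in> carrier (free_alg G)"
    using m_closed[OF that] by (simp add: free_alg_def)
qed (simp_all add: free_alg_carrier_iff)

lemma free_alg_power: "p \<in> carrier (free_alg G) \<Longrightarrow> p ^ n \<in> carrier (free_alg G)"
  by (induction n) (simp_all add: free_alg_closed)

lemma free_alg_sum: "(\<And>a. a \<in> A \<Longrightarrow> f a \<in> carrier (free_alg G)) \<Longrightarrow> sum f A \<in> carrier (free_alg G)"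
  by (induction A rule: infinite_finite_induct) (simp_all add: free_alg_closed)

lemma free_alg_ops [simp]:
  "(\<oplus>\<^bsub>free_alg G\<^esub>) = (+)" "(\<otimes>\<^bsub>free_alg G\<^esub>) = (*)" "\<zero>\<^bsub>free_alg G\<^esub> = 0" "\<one>\<^bsub>free_alg G\<^esub> = 1"
  by (simp_all add: free_alg_def)

lemma free_alg_minus: "p \<in> carrier (free_alg G) \<Longrightarrow> \<ominus>\<^bsub>free_alg G\<^esub> p = - p"
proof -
  interpret ring "free_alg G" by (rule ring_free_alg)
  assume "p \<in> carrier (free_alg G)"
  then show ?thesis by (intro minus_equality) (simp_all add: free_alg_closed)
qed

lemma free_hom_closed:
  assumes "p \<in> carrier (free_alg G)" "\<And>g. g \<in> G \<Longrightarrow> h g \<in> carrier (free_alg H)"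
  shows "free_hom h p \<in> carrier (free_alg H)"
  using assms(1)
proof (induction rule: monomial_induct)
  case (single w c)
  then have "prod_list (map h w) \<in> carrier (free_alg H)"
    by (induction w) (simp_all add: free_alg_closed assms)
  then show ?case by (simp add: free_hom_evl free.evl_single free_alg_closed)
qed (simp_all add: free_hom_evl free.evl_add free_alg_closed)

lemma serre_closed: "x i \<in> G \<Longrightarrow> x j \<in> G \<Longrightarrow> serre D x i j \<in> carrier (free_alg G)"
proof -
  assume "x i \<in> G" "x j \<in> G"
  then have "div_power D x i n \<in> carrier (free_alg G)" for n
    by (simp add: div_power_def free_alg_closed free_alg_power)
  moreover have "(- 1) ^ r \<in> carrier (free_alg G)" for r
    by (intro free_alg_power free_alg_closed)
  ultimately show ?thesis
    using \<open>x j \<in> G\<close> by (auto simp: serre_def Let_def intro!: free_alg_sum free_alg_closed)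
qed

lemma gen_in_qgens: "i \<in> idx D \<Longrightarrow> E i \<in> qgens D" "i \<in> idx D \<Longrightarrow> F i \<in> qgens D" "K \<mu> \<in> qgens D"
  by (simp_all add: qgens_def)

lemma qrels_carrier: "qrels D \<subseteq> carrier (free_alg (qgens D))"
  unfolding qrels_def
  by (auto simp: Kt_kt gen_in_qgens intro!: free_alg_closed serre_closed)

text \<open>
  The quantum group and its negative half are both of the following form.
\<close>

locale presented =
  fixes G :: "'g set" and rels :: "'g free set"
  assumes rels_carrier: "rels \<subseteq> carrier (free_alg G)"
begin

abbreviation R where "R \<equiv> free_alg G"
definition I where "I = Idl\<^bsub>R\<^esub> rels"
abbreviation Q where "Q \<equiv> R Quot I"
abbreviation cls where "cls p \<equiv> I +>\<^bsub>R\<^esub> p"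

sublocale R: ring R by (rule ring_free_alg)
sublocale I: ideal I R unfolding I_def by (rule R.genideal_ideal[OF rels_carrier])
sublocale Q: ring Q by (rule I.quotient_is_ring)

lemma I_carrier: "p \<in> I \<Longrightarrow> p \<in> carrier R"
  by (rule I.Icarr)

lemma rels_I: "r \<in> rels \<Longrightarrow> r \<in> I"
  unfolding I_def using R.genideal_self[OF rels_carrier] by blast

lemma I_closed: "0 \<in> I" "p \<in> I \<Longrightarrow> q \<in> I \<Longrightarrow> p + q \<in> I" "p \<in> I \<Longrightarrow> - p \<in> I"
  "p \<in> I \<Longrightarrow> t \<in> carrier R \<Longrightarrow> t * p \<in> I" "p \<in> I \<Longrightarrow> t \<in> carrier R \<Longrightarrow> p * t \<in> I"
  using I.zero_closed I.a_closed I.a_inv_closed[of p] I.I_l_closed I.I_r_closed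
  by (auto simp: free_alg_minus[OF I_carrier])

lemma I_induct [consumes 1, case_names rel zero add left right]:
  assumes p: "p \<in> I"
    and rel: "\<And>r. r \<in> rels \<Longrightarrow> P r" and zero: "P 0"
    and add: "\<And>p q. p \<in> carrier R \<Longrightarrow> q \<in> carrier R \<Longrightarrow> P p \<Longrightarrow> P q \<Longrightarrow> P (p + q)"
    and left: "\<And>t p. t \<in> carrier R \<Longrightarrow> p \<in> carrier R \<Longrightarrow> P p \<Longrightarrow> P (t * p)"
    and right: "\<And>t p. t \<in> carrier R \<Longrightarrow> p \<in> carrier R \<Longrightarrow> P p \<Longrightarrow> P (p * t)"
  shows "P p"
proof -
  let ?S = "{p \<in> carrier R. P p}"
  have neg: "P (- p)" if "p \<in> carrier R" "P p" for p
    using left[OF _ that, of "- 1"] by (simp add: free_alg_closed)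
  have "subgroup ?S (add_monoid R)"
    by (rule R.add.subgroupI)
      (use zero add neg in \<open>auto simp: free_alg_closed free_alg_minus simp flip: a_inv_def\<close>)
  then have "ideal ?S R"
    by (intro idealI) (use left right in \<open>auto simp: ring_free_alg free_alg_closed\<close>)
  then have "I \<subseteq> ?S"
    unfolding I_def by (rule R.genideal_minimal) (use rel rels_carrier in auto)
  then show ?thesis using p by blast
qed

lemma cls_eq_iff: "p \<in> carrier R \<Longrightarrow> q \<in> carrier R \<Longrightarrow> cls p = cls q \<longleftrightarrow> p - q \<in> I"
proof -
  assume p: "p \<in> carrier R" and q: "q \<in> carrier R"
  have sub: "cls p \<subseteq> cls q" if "p - q \<in> I" for p q
  proof
    fix t assume "t \<in> cls p"
    then obtain h where "h \<in> I" "t = h + p" by (auto simp: a_r_coset_def')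
    then have "h + (p - q) \<in> I" "t = h + (p - q) + q" using that by (auto intro: I_closed)
    then show "t \<in> cls q" unfolding a_r_coset_def' by (auto intro!: bexI[of _ "h + (p - q)"])
  qed
  show ?thesis
  proof
    assume "cls p = cls q"
    then have "p \<in> cls q" using I.a_rcos_self[OF p] by simp
    then show "p - q \<in> I" by (auto simp: a_r_coset_def')
  next
    assume "p - q \<in> I"
    then show "cls p = cls q" using sub[of p q] sub[of q p] I_closed(3)[of "p - q"] by auto
  qed
qed

lemma cls_ops:
  assumes "p \<in> carrier R" "q \<in> carrier R"
  shows "cls p \<oplus>\<^bsub>Q\<^esub> cls q = cls (p + q)" "cls p \<otimes>\<^bsub>Q\<^esub> cls q = cls (p * q)"
  using assms ring_hom_add[OF I.rcos_ring_hom] ring_hom_mult[OF I.rcos_ring_hom] by force+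

lemma cls_one: "\<one>\<^bsub>Q\<^esub> = cls 1"
  using ring_hom_one[OF I.rcos_ring_hom] by simp

lemma cls_zero: "\<zero>\<^bsub>Q\<^esub> = cls 0"
  using R.a_coset_add_zero[OF I.a_subset] by (simp add: FactRing_def)

lemma cls_closed: "p \<in> carrier R \<Longrightarrow> cls p \<in> carrier Q"
  using ring_hom_closed[OF I.rcos_ring_hom] by blast

lemma carrier_cls: "u \<in> carrier Q \<Longrightarrow> \<exists>p\<in>carrier R. u = cls p"
  by (auto simp: FactRing_def A_RCOSETS_def')

lemma rep_cls:
  assumes p: "p \<in> carrier R"
  shows "rep (cls p) \<in> carrier R" "cls (rep (cls p)) = cls p"
proof -
  have "p \<in> cls p" using p by (rule I.a_rcos_self)
  then have r: "rep (cls p) \<in> cls p" unfolding rep_def by (rule someI)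
  then obtain h where "h \<in> I" "rep (cls p) = h + p"
    by (auto simp: a_r_coset_def')
  then show c: "rep (cls p) \<in> carrier R" using p I_carrier by (simp add: free_alg_closed)
  show "cls (rep (cls p)) = cls p"
    using \<open>h \<in> I\<close> \<open>rep (cls p) = h + p\<close> c p by (simp add: cls_eq_iff)
qed

lemma cls_uminus: "p \<in> carrier R \<Longrightarrow> \<ominus>\<^bsub>Q\<^esub> cls p = cls (- p)"
  by (rule Q.minus_equality) (simp_all add: cls_ops cls_closed cls_zero free_alg_closed)

end

sublocale datum \<subseteq> U: presented "qgens D" "qrels D"
  by unfold_locales (rule qrels_carrier)

context datum
begin

lemma U_defs: "qideal D = U.I" "UQ D = U.Q" "ucls D p = U.cls p"
  by (simp_all add: qideal_def U.I_def UQ_def ucls_def)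

text \<open>
  The test ring is the product of all quotients.  Letters that are not generators are sent to zero
  first, so that the ideal extends to a two-sided ideal of the free algebra on all letters, and the
  remaining components are filled by the counit.
\<close>

lemma qideal_membership:
  assumes p: "p \<in> carrier U.R"
    and eq: "\<And>(s :: Qv \<Rightarrow> ('i, 'y) qgen quotients) X. central_scalars s \<Longrightarrow>
      quantum_rep D s (\<lambda>i. X (E i)) (\<lambda>i. X (F i)) (\<lambda>\<mu>. X (K \<mu>)) \<Longrightarrow> evl s X p = 0"
  shows "p \<in> U.I"
proof -
  define \<kappa> :: "('i, 'y) qgen free \<Rightarrow> ('i, 'y) qgen free"
    where "\<kappa> = evl scal (\<lambda>g. if g \<in> qgens D then gen g else 0)"
  have \<kappa>_id: "\<kappa> p = p" if "p \<in> carrier U.R" for p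
    using that
  proof (induction rule: monomial_induct)
    case (single w c)
    then have "prod_list (map (\<lambda>g. if g \<in> qgens D then gen g else 0) w) = wmon w 1"
    proof (induction w)
      case Nil
      then show ?case by (simp add: zero_word_def flip: single_one)
    next
      case (Cons g w)
      then show ?case using single_Word_Cons[of g w 1] by simp
    qed
    then show ?case by (simp add: \<kappa>_def free.evl_single mult_single)
  qed (simp_all add: \<kappa>_def free.evl_add)
  have \<kappa>_closed: "\<kappa> p \<in> carrier U.R" for p
    using free_hom_closed[of p UNIV "\<lambda>g. if g \<in> qgens D then gen g else 0" "qgens D"]
    by (simp add: \<kappa>_def free_hom_evl free_alg_UNIV free_alg_closed)
  define J where "J = {p. \<kappa> p \<in> U.I}"
  have J: "two_sided J"
  proof -
    have "\<kappa> 0 = 0" "\<kappa> (p + q) = \<kappa> p + \<kappa> q" "\<kappa> (p * q) = \<kappa> p * \<kappa> q" for p q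
      by (simp_all add: \<kappa>_def free.evl_add free.evl_mult)
    then show ?thesis
      by (simp add: two_sided_def J_def U.I_closed(1,2,4) U.I_closed(5) \<kappa>_closed)
  qed
  define h where "h = (\<lambda>g :: ('i, 'y) qgen. case g of K \<mu> \<Rightarrow> 1 | _ \<Rightarrow> (0 :: ('i, 'y) qgen free))"
  have aug: "evl scal h r = 0" if "r \<in> qrels D" for r
  proof -
    have "quantum_rep D scal (\<lambda>i. h (E i)) (\<lambda>i. h (F i)) (\<lambda>\<mu>. h (K \<mu>))"
      by unfold_locales (simp_all add: h_def free.serre_val_def Let_def free.scl_def)
    then show ?thesis
      using quantum_rep_iff[OF datum_axioms free.central_scalars_axioms, of h] that by blast
  qed
  define s where "s = (\<lambda>c. component J (evl scal h) (scal c))"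
  define X where "X = (\<lambda>g. component J (evl scal h) (gen g))"
  interpret s: central_scalars s unfolding s_def by (rule central_scalars_component)
  have ev: "evl s X q = component J (evl scal h) q" for q
    unfolding s_def X_def by (rule evl_component)
  have "\<forall>r\<in>qrels D. evl s X r = 0"
  proof
    fix r assume r: "r \<in> qrels D"
    then have "r \<in> J" unfolding J_def using qrels_carrier U.rels_I by (auto simp: \<kappa>_id)
    then show "evl s X r = 0"
      unfolding ev component_eq_0_iff using aug[OF r] two_sidedD(1) by auto
  qed
  then have "evl s X p = 0"
    using eq quantum_rep_iff[OF datum_axioms s.central_scalars_axioms] s.central_scalars_axioms by blast
  then have "p \<in> J"
    unfolding ev component_eq_0_iff using J by (metis (full_types))
  then show ?thesis using p by (simp add: J_def \<kappa>_id)
qed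

section \<open>The grading\<close>

definition hpart :: "'x \<Rightarrow> ('i, 'y) qgen free \<Rightarrow> ('i, 'y) qgen free" where
  "hpart d p = (\<Sum>w\<in>{w \<in> Poly_Mapping.keys p. wdeg D w = d}. Poly_Mapping.single w (Poly_Mapping.lookup p w))"

definition homogeneous :: "'x \<Rightarrow> ('i, 'y) qgen free \<Rightarrow> bool" where
  "homogeneous d p \<longleftrightarrow> (\<forall>w\<in>Poly_Mapping.keys p. wdeg D w = d)"

lemma wdeg_add [simp]: "wdeg D (u + w) = wdeg D u + wdeg D w" and wdeg_zero [simp]: "wdeg D 0 = 0"
  by (simp_all add: wdeg_def)

lemma wdeg_Word [simp]: "wdeg D (Word []) = 0" "wdeg D (Word (g # w)) = gdeg D g + wdeg D (Word w)"
  by (simp_all add: wdeg_def)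

lemma lookup_hpart: "Poly_Mapping.lookup (hpart d p) w = (if wdeg D w = d then Poly_Mapping.lookup p w else 0)"
proof -
  have "Poly_Mapping.lookup (hpart d p) w
      = (\<Sum>u\<in>{u \<in> Poly_Mapping.keys p. wdeg D u = d}. if u = w then Poly_Mapping.lookup p u else 0)"
    by (simp add: hpart_def lookup_sum lookup_single when_def)
  then show ?thesis by (simp add: in_keys_iff)
qed

lemma hpart_add: "hpart d (p + q) = hpart d p + hpart d q"
  and hpart_diff: "hpart d (p - q) = hpart d p - hpart d q"
  and hpart_zero [simp]: "hpart d 0 = 0"
  and hpart_single: "hpart d (Poly_Mapping.single w c) = (if wdeg D w = d then Poly_Mapping.single w c else 0)"
  by (auto intro!: poly_mapping_eqI simp: lookup_hpart lookup_add lookup_minus lookup_single when_def)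

lemma homogeneous_hpart: "homogeneous d (hpart d p)"
  by (auto simp: homogeneous_def in_keys_iff lookup_hpart split: if_splits)

lemma hpart_homogeneous: "homogeneous e p \<Longrightarrow> hpart d p = (if d = e then p else 0)"
  by (auto intro!: poly_mapping_eqI simp: lookup_hpart homogeneous_def in_keys_iff)

lemma homogeneous_iff: "homogeneous d p \<longleftrightarrow> hpart d p = p"
  by (metis homogeneous_hpart hpart_homogeneous)

lemma homogeneous_add: "homogeneous d p \<Longrightarrow> homogeneous d q \<Longrightarrow> homogeneous d (p + q)"
  and homogeneous_diff: "homogeneous d p \<Longrightarrow> homogeneous d q \<Longrightarrow> homogeneous d (p - q)"
  and homogeneous_zero: "homogeneous d 0"
  by (simp_all add: homogeneous_iff hpart_add hpart_diff)

lemma homogeneous_mult: "homogeneous d p \<Longrightarrow> homogeneous e q \<Longrightarrow> homogeneous (d + e) (p * q)"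
  using keys_mult[of p q] by (fastforce simp: homogeneous_def)

lemma homogeneous_single: "homogeneous (wdeg D w) (Poly_Mapping.single w c)"
  by (simp add: homogeneous_def)

lemma homogeneous_scal: "homogeneous 0 (scal c)" and homogeneous_gen: "homogeneous (gdeg D g) (gen g)"
  by (simp_all add: homogeneous_def)

lemma homogeneous_one: "homogeneous 0 1"
  using homogeneous_scal[of 1] by simp

lemma homogeneous_scal_mult: "homogeneous d p \<Longrightarrow> homogeneous d (scal c * p)"
  using homogeneous_mult[OF homogeneous_scal] by simp

lemma homogeneous_power: "homogeneous d p \<Longrightarrow> homogeneous (sum_list (replicate n d)) (p ^ n)"
  by (induction n) (simp_all add: homogeneous_mult homogeneous_one)

lemma homogeneous_sum: "(\<And>a. a \<in> A \<Longrightarrow> homogeneous d (f a)) \<Longrightarrow> homogeneous d (sum f A)"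
  by (induction A rule: infinite_finite_induct) (simp_all add: homogeneous_add homogeneous_zero)

lemma hpart_closed: "p \<in> carrier U.R \<Longrightarrow> hpart d p \<in> carrier U.R"
  by (auto simp: free_alg_carrier_iff in_keys_iff lookup_hpart split: if_splits)

lemma hpart_mult:
  "hpart d (Poly_Mapping.single w c * p) = Poly_Mapping.single w c * hpart (d - wdeg D w) p"
  "hpart d (p * Poly_Mapping.single w c) = hpart (d - wdeg D w) p * Poly_Mapping.single w c"
proof -
  have "hpart d (Poly_Mapping.single w c * p) = Poly_Mapping.single w c * hpart (d - wdeg D w) p \<and>
    hpart d (p * Poly_Mapping.single w c) = hpart (d - wdeg D w) p * Poly_Mapping.single w c"
  proof (induction p rule: monomial_induct[OF free_alg_UNIV])
    case (2 u c')
    show ?case by (auto simp: mult_single hpart_single algebra_simps)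
  qed (simp_all add: hpart_add distrib_left distrib_right)
  then show "hpart d (Poly_Mapping.single w c * p) = Poly_Mapping.single w c * hpart (d - wdeg D w) p"
    "hpart d (p * Poly_Mapping.single w c) = hpart (d - wdeg D w) p * Poly_Mapping.single w c" by blast+
qed

lemma homogeneous_serre: "\<exists>d. homogeneous d (serre D x i j)"
proof -
  let ?n = "nat (1 - pairing D (coroot D i) (root D j))"
  let ?d = "\<lambda>n. sum_list (replicate n (gdeg D (x i)))"
  have d: "?d (m + n) = ?d m + ?d n" for m n
    by (simp add: replicate_add)
  have dp: "homogeneous (?d n) (div_power D x i n)" for n
    using homogeneous_scal_mult[OF homogeneous_power[OF homogeneous_gen]] by (simp add: div_power_def)
  have "homogeneous (?d ?n + gdeg D (x j)) ((- 1) ^ r * div_power D x i (?n - r) * gen (x j) * div_power D x i r)"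
    if "r \<le> ?n" for r
  proof -
    have "(- 1) ^ r = scal ((- 1) ^ r)"
      by (simp only: free.s_power free.s_minus free.s_one)
    moreover have "homogeneous (0 + ?d (?n - r) + gdeg D (x j) + ?d r)
      (scal ((- 1) ^ r) * div_power D x i (?n - r) * gen (x j) * div_power D x i r)"
      by (intro homogeneous_mult homogeneous_scal homogeneous_gen dp)
    moreover have "0 + ?d (?n - r) + gdeg D (x j) + ?d r = ?d ?n + gdeg D (x j)"
      using d[of "?n - r" r] that by (simp add: algebra_simps)
    ultimately show ?thesis by metis
  qed
  then show ?thesis unfolding serre_def Let_def by (intro exI homogeneous_sum) auto
qed

lemma homogeneous_rel: "r \<in> qrels D \<Longrightarrow> \<exists>d. homogeneous d r"
proof -
  have K: "homogeneous 0 (gen (K \<mu>))" for \<mu>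
    using homogeneous_gen[of "K \<mu>"] by simp
  assume "r \<in> qrels D"
  then show ?thesis
    unfolding qrels_def
  proof (elim UnE)
    assume "r \<in> {gen (K 0) - 1}"
    then show ?thesis using homogeneous_diff[OF K homogeneous_one] by auto
  next
    assume "r \<in> {gen (K \<mu>) * gen (K \<nu>) - gen (K (\<mu> + \<nu>)) | \<mu> \<nu>. True}"
    then show ?thesis using homogeneous_diff[OF homogeneous_mult[OF K K, simplified] K] by auto
  next
    assume "r \<in> {gen (K \<mu>) * gen (E i)
           - scal (v powi pairing D \<mu> (root D i)) * gen (E i) * gen (K \<mu>) | \<mu> i. i \<in> idx D}"
    then obtain \<mu> i where "r = gen (K \<mu>) * gen (E i)
           - scal (v powi pairing D \<mu> (root D i)) * gen (E i) * gen (K \<mu>)" by blast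
    then show ?thesis
      using homogeneous_diff[OF homogeneous_mult[OF K homogeneous_gen[of "E i"], simplified]
        homogeneous_mult[OF homogeneous_scal_mult[OF homogeneous_gen[of "E i"]] K, simplified]] by auto
  next
    assume "r \<in> {gen (K \<mu>) * gen (F i)
           - scal (v powi (- pairing D \<mu> (root D i))) * gen (F i) * gen (K \<mu>) | \<mu> i. i \<in> idx D}"
    then obtain \<mu> i where "r = gen (K \<mu>) * gen (F i)
           - scal (v powi (- pairing D \<mu> (root D i))) * gen (F i) * gen (K \<mu>)" by blast
    then show ?thesis
      using homogeneous_diff[OF homogeneous_mult[OF K homogeneous_gen[of "F i"], simplified]
        homogeneous_mult[OF homogeneous_scal_mult[OF homogeneous_gen[of "F i"]] K, simplified]] by auto
  next
    assume "r \<in> {gen (E i) * gen (F j) - gen (F j) * gen (E i)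
           - (if i = j then scal (1 / (vi D i - inverse (vi D i))) * (gen (Kt D i) - gen (Kt_inv D i))
              else 0) | i j. i \<in> idx D \<and> j \<in> idx D}"
    then obtain i j where r: "r = gen (E i) * gen (F j) - gen (F j) * gen (E i)
           - (if i = j then scal (1 / (vi D i - inverse (vi D i))) * (gen (Kt D i) - gen (Kt_inv D i))
              else 0)" by blast
    have EF: "homogeneous (root D i - root D j) (gen (E i) * gen (F j))"
      "homogeneous (root D i - root D j) (gen (F j) * gen (E i))"
      using homogeneous_mult[OF homogeneous_gen[of "E i"] homogeneous_gen[of "F j"]]
        homogeneous_mult[OF homogeneous_gen[of "F j"] homogeneous_gen[of "E i"]] by (simp_all add: algebra_simps)
    have "homogeneous 0 (scal c * (gen (Kt D l) - gen (Kt_inv D l)))" for c l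
      unfolding Kt_kt by (intro homogeneous_scal_mult homogeneous_diff K)
    then have "homogeneous (root D i - root D j) (if i = j then scal (1 / (vi D i - inverse (vi D i))) *
      (gen (Kt D i) - gen (Kt_inv D i)) else 0)"
      by (simp add: homogeneous_zero)
    then show ?thesis unfolding r using homogeneous_diff[OF homogeneous_diff[OF EF]] by blast
  qed (use homogeneous_serre in auto)
qed

text \<open>
  The defining relations are homogeneous.
\<close>

lemma hpart_I: "p \<in> U.I \<Longrightarrow> hpart d p \<in> U.I"
proof -
  assume "p \<in> U.I"
  then have "\<forall>d. hpart d p \<in> U.I"
  proof (induction rule: U.I_induct)
    case (rel r)
    then obtain e where "homogeneous e r" using homogeneous_rel by blast
    then show ?case using U.rels_I[OF rel] by (auto simp: hpart_homogeneous U.I_closed)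
  next
    case (left t p)
    from left(1) left(2,3) show ?case
      by (induction rule: monomial_induct)
        (auto simp: distrib_right hpart_add hpart_mult intro!: U.I_closed(1,2,4) free_alg_closed)
  next
    case (right t p)
    from right(1) right(2,3) show ?case
      by (induction rule: monomial_induct)
        (auto simp: distrib_left hpart_add hpart_mult intro!: U.I_closed(1,2,5) free_alg_closed)
  qed (simp_all add: U.I_closed hpart_add)
  then show ?thesis ..
qed

lemma hcomp_cls:
  assumes p: "p \<in> carrier U.R"
  shows "hcomp D d (U.cls p) = U.cls (hpart d p)"
proof -
  have "hcomp D d (U.cls p) = U.cls (hpart d (rep (U.cls p)))"
    by (simp add: hcomp_def U_defs hpart_def)
  also have "\<dots> = U.cls (hpart d p)"
  proof -
    have "rep (U.cls p) - p \<in> U.I"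
      using U.rep_cls[OF p] p U.cls_eq_iff by blast
    then have "hpart d (rep (U.cls p)) - hpart d p \<in> U.I"
      unfolding hpart_diff[symmetric] by (rule hpart_I)
    then show ?thesis using U.rep_cls(1)[OF p] p by (simp add: U.cls_eq_iff hpart_closed)
  qed
  finally show ?thesis .
qed

lemma K_homogeneous:
  assumes t: "t \<in> carrier U.R" and d: "homogeneous d t"
  shows "gen (K \<mu>) * t - scal (v powi pairing D \<mu> d) * t * gen (K \<mu>) \<in> U.I"
proof -
  let ?k = "gen (K \<mu>) :: ('i, 'y) qgen free"
  have k: "?k \<in> carrier U.R" by (simp add: free_alg_closed gen_in_qgens)
  have gen: "?k * gen g - scal (v powi pairing D \<mu> (gdeg D g)) * gen g * ?k \<in> U.I" if "g \<in> qgens D" for g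
  proof (cases g)
    case (K \<nu>)
    have "gen (K \<mu>) * gen (K \<nu>) - gen (K (\<mu> + \<nu>)) \<in> qrels D" "gen (K \<nu>) * gen (K \<mu>) - gen (K (\<nu> + \<mu>)) \<in> qrels D"
      unfolding qrels_def by blast+
    then have "(gen (K \<mu>) * gen (K \<nu>) - gen (K (\<mu> + \<nu>))) + - (gen (K \<nu>) * gen (K \<mu>) - gen (K (\<nu> + \<mu>))) \<in> U.I"
      by (intro U.I_closed U.rels_I)
    then show ?thesis by (simp add: K algebra_simps)
  next
    case (E i)
    have i: "i \<in> idx D" using that E by (auto simp: qgens_def)
    have "?k * gen g - scal (v powi pairing D \<mu> (gdeg D g)) * gen g * ?k \<in> qrels D"
      unfolding qrels_def E gdeg.simps using i by blast
    then show ?thesis by (rule U.rels_I)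
  next
    case (F i)
    have i: "i \<in> idx D" using that F by (auto simp: qgens_def)
    have "?k * gen g - scal (v powi (pairing D \<mu> (gdeg D g))) * gen g * ?k \<in> qrels D"
      unfolding qrels_def F gdeg.simps pairing_minus using i by blast
    then show ?thesis by (rule U.rels_I)
  qed
  have word: "?k * wmon w 1
     - scal (v powi pairing D \<mu> (wdeg D (Word w))) * wmon w 1 * ?k \<in> U.I"
    if "set w \<subseteq> qgens D" for w
    using that
  proof (induction w)
    case Nil
    then show ?case by (simp add: U.I_closed mult_single plus_word_def)
  next
    case (Cons g w)
    let ?w = "wmon w 1 :: ('i, 'y) qgen free"
    let ?a = "v powi pairing D \<mu> (gdeg D g)" and ?b = "v powi pairing D \<mu> (wdeg D (Word w))"
    have w: "?w \<in> carrier U.R" and g: "g \<in> qgens D" using Cons.prems by (auto intro!: free_alg_closed)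
    have "(?k * gen g - scal ?a * gen g * ?k) * ?w + (scal ?a * gen g) * (?k * ?w - scal ?b * ?w * ?k) \<in> U.I"
      using gen[OF g] Cons.IH Cons.prems w g by (intro U.I_closed free_alg_closed) auto
    also have "(?k * gen g - scal ?a * gen g * ?k) * ?w + (scal ?a * gen g) * (?k * ?w - scal ?b * ?w * ?k)
      = ?k * (gen g * ?w) - scal ?a * (gen g * scal ?b) * ?w * ?k"
      by (simp add: algebra_simps)
    also have "gen g * scal ?b = scal ?b * gen g" by (rule scal_commute)
    also have "scal ?a * (scal ?b * gen g) * ?w * ?k
      = scal (v powi pairing D \<mu> (wdeg D (Word (g # w)))) * (gen g * ?w) * ?k"
      by (simp add: pairing_add_right power_int_add v_nonzero mult.assoc free.s_assoc)
    finally show ?case unfolding single_Word_Cons[of g w 1] .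
  qed
  have "?k * hpart d p - scal (v powi pairing D \<mu> d) * hpart d p * ?k \<in> U.I" if "p \<in> carrier U.R" for p
    using that
  proof (induction rule: monomial_induct)
    case (single w c)
    let ?w = "wmon w 1 :: ('i, 'y) qgen free"
    show ?case
    proof (cases "wdeg D (Word w) = d")
      case True
      have c: "wmon w c = scal c * ?w" by (simp add: mult_single)
      have "scal c * (?k * ?w - scal (v powi pairing D \<mu> d) * ?w * ?k) \<in> U.I"
        using word[OF single] True by (intro U.I_closed free_alg_closed) simp
      also have "scal c * (?k * ?w - scal (v powi pairing D \<mu> d) * ?w * ?k)
        = ?k * (scal c * ?w) - scal (v powi pairing D \<mu> d) * (scal c * ?w) * ?k"
        by (simp add: right_diff_distrib free.s_left_comm[of ?k] free.s_left_comm[of "scal (v powi pairing D \<mu> d)"] mult.assoc)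
      finally show ?thesis unfolding c[symmetric] using True by (simp add: hpart_single)
    qed (simp add: hpart_single U.I_closed)
  next
    case (add p q)
    have "?k * hpart d (p + q) - scal (v powi pairing D \<mu> d) * hpart d (p + q) * ?k
      = (?k * hpart d p - scal (v powi pairing D \<mu> d) * hpart d p * ?k)
      + (?k * hpart d q - scal (v powi pairing D \<mu> d) * hpart d q * ?k)"
      by (simp add: hpart_add algebra_simps)
    then show ?case using add by (simp only: U.I_closed)
  qed (simp add: U.I_closed)
  from this[OF t] show ?thesis using d by (simp add: homogeneous_iff)
qed

end

context datum
begin

section \<open>Components of the modified quantum group\<close>

definition wt_gens :: "'x \<Rightarrow> 'x \<Rightarrow> ('i, 'y) qgen free set set" where
  "wt_gens a b = {U.cls (gen (K \<mu>) - scal (v powi pairing D \<mu> a)) \<otimes>\<^bsub>U.Q\<^esub> u | \<mu> u. u \<in> carrier U.Q}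
      \<union> {u \<otimes>\<^bsub>U.Q\<^esub> U.cls (gen (K \<mu>) - scal (v powi pairing D \<mu> b)) | \<mu> u. u \<in> carrier U.Q}"

lemma wt_rel_eq: "wt_rel D a b = generate (add_monoid U.Q) (wt_gens a b)"
  by (simp add: wt_rel_def wt_gens_def U_defs)

lemma K_minus_closed: "gen (K \<mu>) - scal c \<in> carrier U.R"
  by (intro free_alg_closed gen_in_qgens)

lemma wt_gens_closed: "wt_gens a b \<subseteq> carrier U.Q"
  by (auto simp: wt_gens_def intro!: U.Q.m_closed U.cls_closed K_minus_closed)

lemma abelian_subgroup_wt_rel: "abelian_subgroup (wt_rel D a b) U.Q"
proof (rule abelian_subgroupI3)
  show "additive_subgroup (wt_rel D a b) U.Q"
    unfolding wt_rel_eq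
    by (rule additive_subgroup.intro, rule U.Q.add.generate_is_subgroup) (simp add: wt_gens_closed)
qed (rule U.Q.abelian_group_axioms)

text \<open>
  The preimage in the free algebra of the subspace by which a component is divided.  Equations
  between cosets of cosets become memberships in these sets.
\<close>

definition van :: "'x \<Rightarrow> 'x \<Rightarrow> ('i, 'y) qgen free set" where
  "van a b = {p \<in> carrier U.R. U.cls p \<in> wt_rel D a b}"

lemma van_carrier: "p \<in> van a b \<Longrightarrow> p \<in> carrier U.R"
  by (simp add: van_def)

lemma I_van: "p \<in> U.I \<Longrightarrow> p \<in> van a b"
proof -
  interpret W: abelian_subgroup "wt_rel D a b" U.Q by (rule abelian_subgroup_wt_rel)
  assume p: "p \<in> U.I"
  then have "U.cls p = U.cls 0"
    using U.I_carrier by (simp add: U.cls_eq_iff free_alg_closed)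
  then show ?thesis
    using p U.I_carrier W.zero_closed by (simp add: van_def U.cls_zero)
qed

lemma van_add: "p \<in> van a b \<Longrightarrow> q \<in> van a b \<Longrightarrow> p + q \<in> van a b"
  and van_uminus: "p \<in> van a b \<Longrightarrow> - p \<in> van a b"
proof -
  interpret W: abelian_subgroup "wt_rel D a b" U.Q by (rule abelian_subgroup_wt_rel)
  show "p + q \<in> van a b" if "p \<in> van a b" "q \<in> van a b"
    using that W.a_closed[of "U.cls p" "U.cls q"] by (simp add: van_def U.cls_ops free_alg_closed)
  show "- p \<in> van a b" if "p \<in> van a b"
    using that W.a_inv_closed[of "U.cls p"] by (simp add: van_def U.cls_uminus free_alg_closed)
qed

lemma van_zero: "0 \<in> van a b"
  by (simp add: I_van U.I_closed)

lemma van_diff: "p \<in> van a b \<Longrightarrow> q \<in> van a b \<Longrightarrow> p - q \<in> van a b"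
  using van_add[OF _ van_uminus] by fastforce

lemma van_K:
  assumes "p \<in> carrier U.R"
  shows "(gen (K \<mu>) - scal (v powi pairing D \<mu> a)) * p \<in> van a b"
    and "p * (gen (K \<mu>) - scal (v powi pairing D \<mu> b)) \<in> van a b"
proof -
  have "U.cls (gen (K \<mu>) - scal (v powi pairing D \<mu> a)) \<otimes>\<^bsub>U.Q\<^esub> U.cls p \<in> wt_gens a b"
    "U.cls p \<otimes>\<^bsub>U.Q\<^esub> U.cls (gen (K \<mu>) - scal (v powi pairing D \<mu> b)) \<in> wt_gens a b"
    unfolding wt_gens_def using U.cls_closed[OF assms] by blast+
  then show "(gen (K \<mu>) - scal (v powi pairing D \<mu> a)) * p \<in> van a b"
    "p * (gen (K \<mu>) - scal (v powi pairing D \<mu> b)) \<in> van a b"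
    using assms K_minus_closed
    by (simp_all add: van_def wt_rel_eq U.cls_ops generate.incl free_alg_closed(7))
qed

lemma van_induct [consumes 1, case_names ideal left right add uminus]:
  assumes p: "p \<in> van a b"
    and ideal: "\<And>p. p \<in> U.I \<Longrightarrow> P p"
    and left: "\<And>\<mu> p. p \<in> carrier U.R \<Longrightarrow> P ((gen (K \<mu>) - scal (v powi pairing D \<mu> a)) * p)"
    and right: "\<And>\<mu> p. p \<in> carrier U.R \<Longrightarrow> P (p * (gen (K \<mu>) - scal (v powi pairing D \<mu> b)))"
    and add: "\<And>p q. p \<in> carrier U.R \<Longrightarrow> q \<in> carrier U.R \<Longrightarrow> P p \<Longrightarrow> P q \<Longrightarrow> P (p + q)"
    and uminus: "\<And>p. p \<in> carrier U.R \<Longrightarrow> P p \<Longrightarrow> P (- p)"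
  shows "P p"
proof -
  have mod: "P q" if "P p" "U.cls p = U.cls q" "p \<in> carrier U.R" "q \<in> carrier U.R" for p q
  proof -
    have "q - p \<in> U.I" using that by (metis U.cls_eq_iff)
    from add[OF that(3) U.I_carrier[OF this] that(1) ideal[OF this]] have "P (p + (q - p))" .
    then show ?thesis by simp
  qed
  have gens: "\<exists>p\<in>carrier U.R. U.cls p = h \<and> P p" if "h \<in> wt_gens a b" for h
  proof -
    from that consider \<mu> u where "u \<in> carrier U.Q" "h = U.cls (gen (K \<mu>) - scal (v powi pairing D \<mu> a)) \<otimes>\<^bsub>U.Q\<^esub> u"
      | \<mu> u where "u \<in> carrier U.Q" "h = u \<otimes>\<^bsub>U.Q\<^esub> U.cls (gen (K \<mu>) - scal (v powi pairing D \<mu> b))"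
      unfolding wt_gens_def by blast
    then show ?thesis
    proof cases
      case 1
      then obtain q where "q \<in> carrier U.R" "u = U.cls q" using U.carrier_cls by blast
      then show ?thesis
        using 1 left K_minus_closed by (intro bexI[of _ "(gen (K \<mu>) - scal (v powi pairing D \<mu> a)) * q"])
          (simp_all add: U.cls_ops free_alg_closed(7))
    next
      case 2
      then obtain q where "q \<in> carrier U.R" "u = U.cls q" using U.carrier_cls by blast
      then show ?thesis
        using 2 right K_minus_closed by (intro bexI[of _ "q * (gen (K \<mu>) - scal (v powi pairing D \<mu> b))"])
          (simp_all add: U.cls_ops free_alg_closed(7))
    qed
  qed
  have "\<exists>p\<in>carrier U.R. U.cls p = u \<and> P p" if "u \<in> wt_rel D a b" for u
    using that unfolding wt_rel_eq
  proof (induction rule: generate.induct)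
    case one
    then show ?case using ideal[OF U.I_closed(1)] free_alg_closed(1) by (auto simp: U.cls_zero)
  next
    case (incl h)
    then show ?case by (rule gens)
  next
    case (inv h)
    then obtain p where "p \<in> carrier U.R" "U.cls p = h" "P p" using gens by blast
    then show ?case
      using uminus U.cls_uminus[of p] by (intro bexI[of _ "- p"]) (auto simp: free_alg_closed a_inv_def)
  next
    case (eng h1 h2)
    then obtain p q where "p \<in> carrier U.R" "U.cls p = h1" "P p" "q \<in> carrier U.R" "U.cls q = h2" "P q" by blast
    then show ?case by (intro bexI[of _ "p + q"]) (auto simp: U.cls_ops free_alg_closed add)
  qed
  then obtain q where "q \<in> carrier U.R" "U.cls q = U.cls p" "P q"
    using p by (auto simp: van_def)
  then show ?thesis using p mod by (auto simp: van_def)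
qed

lemma van_scal: "p \<in> van a b \<Longrightarrow> scal c * p \<in> van a b"
proof (induction rule: van_induct)
  case (ideal p)
  then show ?case by (intro I_van U.I_closed) (auto intro: free_alg_closed)
next
  case (left \<mu> p)
  have "scal c * ((gen (K \<mu>) - scal (v powi pairing D \<mu> a)) * p) = (gen (K \<mu>) - scal (v powi pairing D \<mu> a)) * (scal c * p)"
    by (rule free.s_left_comm[symmetric])
  then show ?case using left by (simp only:) (intro van_K free_alg_closed)
next
  case (right \<mu> p)
  have "scal c * (p * (gen (K \<mu>) - scal (v powi pairing D \<mu> b))) = scal c * p * (gen (K \<mu>) - scal (v powi pairing D \<mu> b))"
    by (simp only: mult.assoc)
  then show ?case using right by (simp only:) (intro van_K free_alg_closed)
qed (simp_all add: distrib_left van_add van_uminus)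

text \<open>
  Moving \<open>K \<mu>\<close> past an element of degree \<open>d\<close> multiplies it by a power of \<open>v\<close>, which shifts the
  weight by \<open>d\<close>.
\<close>

lemma van_mult_left:
  assumes t: "t \<in> carrier U.R" "homogeneous d t" and p: "p \<in> van a b"
  shows "t * p \<in> van (a + d) b"
  using p
proof (induction rule: van_induct)
  case (ideal p)
  then show ?case using t by (intro I_van U.I_closed)
next
  case (left \<mu> p)
  let ?a = "v powi pairing D \<mu> a" and ?d = "v powi pairing D \<mu> d" and ?k = "gen (K \<mu>) :: ('i, 'y) qgen free"
  have ad: "v powi pairing D \<mu> (a + d) = ?a * ?d"
    by (simp add: pairing_add_right power_int_add v_nonzero)
  have "(?k * t - scal ?d * t * ?k) * p \<in> U.I"
    using K_homogeneous[OF t] left by (intro U.I_closed(5))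
  then have "(?k - scal (?a * ?d)) * (t * p) - (?k * t - scal ?d * t * ?k) * p \<in> van (a + d) b"
    using left t van_K(1)[of "t * p" \<mu> "a + d"] van_diff[OF _ I_van] by (simp add: ad free_alg_closed)
  also have "(?k - scal (?a * ?d)) * (t * p) - (?k * t - scal ?d * t * ?k) * p
      = scal ?d * (t * ((?k - scal ?a) * p))"
  proof -
    have "t * (scal ?a * p) = scal ?a * (t * p)" by (rule free.s_left_comm)
    then show ?thesis
      by (simp add: left_diff_distrib right_diff_distrib mult.assoc free.s_assoc mult.commute[of ?d ?a])
  qed
  finally have "scal (inverse ?d) * (scal ?d * (t * ((?k - scal ?a) * p))) \<in> van (a + d) b"
    by (rule van_scal)
  then show ?case
    unfolding free.s_assoc by (simp add: v_nonzero)
next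
  case (right \<mu> p)
  then show ?case using van_K(2)[of "t * p" \<mu> b "a + d"] t by (simp add: mult.assoc free_alg_closed)
qed (simp_all add: distrib_left van_add van_uminus)

lemma van_mult_right:
  assumes t: "t \<in> carrier U.R" "homogeneous d t" and p: "p \<in> van a b"
  shows "p * t \<in> van a (b - d)"
  using p
proof (induction rule: van_induct)
  case (ideal p)
  then show ?case using t by (intro I_van U.I_closed(5))
next
  case (right \<mu> p)
  let ?b = "v powi pairing D \<mu> b" and ?d = "v powi pairing D \<mu> d" and ?k = "gen (K \<mu>) :: ('i, 'y) qgen free"
  have bd: "?b = ?d * v powi pairing D \<mu> (b - d)"
    by (simp add: pairing_diff_right flip: power_int_add)
      (simp add: power_int_diff v_nonzero)
  have "p * (?k * t - scal ?d * t * ?k) \<in> U.I"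
    using K_homogeneous[OF t] right by (intro U.I_closed(4))
  moreover have "scal ?d * (p * t * (?k - scal (v powi pairing D \<mu> (b - d)))) \<in> van a (b - d)"
    using right t by (intro van_scal van_K free_alg_closed)
  ultimately have "p * (?k * t - scal ?d * t * ?k)
      + scal ?d * (p * t * (?k - scal (v powi pairing D \<mu> (b - d)))) \<in> van a (b - d)"
    by (rule van_add[OF I_van])
  also have "p * (?k * t - scal ?d * t * ?k) + scal ?d * (p * t * (?k - scal (v powi pairing D \<mu> (b - d))))
      = p * (?k - scal ?b) * t"
  proof -
    let ?c = "v powi pairing D \<mu> (b - d)"
    have 1: "p * (scal ?d * (t * ?k)) = scal ?d * (p * (t * ?k))" by (rule free.s_left_comm)
    have 2: "p * (scal (?d * ?c) * t) = scal (?d * ?c) * (p * t)" by (rule free.s_left_comm)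
    have 3: "p * (t * scal ?c) = scal ?c * (p * t)" by (simp only: scal_commute[of t] free.s_left_comm[of p])
    show ?thesis unfolding bd
      by (simp only: right_diff_distrib left_diff_distrib mult.assoc 1 2 3 free.s_assoc) simp
  qed
  finally show ?case .
next
  case (left \<mu> p)
  then show ?case using van_K(1)[of "p * t" \<mu> a "b - d"] t by (simp add: mult.assoc free_alg_closed)
qed (simp_all add: distrib_right van_add van_uminus)

text \<open>
  If the degree is not the difference of the two weights, then some \<open>K \<mu>\<close> acts by different scalars
  on the two sides, because the pairing is nondegenerate and \<open>v\<close> is not a root of unity.
\<close>

lemma nonweight_van:
  assumes t: "t \<in> carrier U.R" "homogeneous d t" and d: "d \<noteq> a - b"
  shows "t \<in> van a b"
proof -
  from d have "d + b - a \<noteq> 0" by auto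
  then obtain \<mu> where "pairing D \<mu> (d + b - a) \<noteq> 0" using pairing_nondegenerate by blast
  then have ne: "pairing D \<mu> d + pairing D \<mu> b \<noteq> pairing D \<mu> a"
    by (simp add: pairing_add_right pairing_diff_right)
  let ?a = "v powi pairing D \<mu> a" and ?b = "v powi pairing D \<mu> b" and ?d = "v powi pairing D \<mu> d"
  let ?k = "gen (K \<mu>) :: ('i, 'y) qgen free"
  have "(?k - scal ?a) * t - (?k * t - scal ?d * t * ?k) - scal ?d * (t * (?k - scal ?b)) \<in> van a b"
    using t by (intro van_diff van_scal van_K I_van K_homogeneous)
  also have "(?k - scal ?a) * t - (?k * t - scal ?d * t * ?k) - scal ?d * (t * (?k - scal ?b))
      = scal (?d * ?b - ?a) * t"
    by (simp add: right_diff_distrib left_diff_distrib mult.assoc scal_commute[of t] free.s_assoc single_diff)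
  finally have *: "scal (?d * ?b - ?a) * t \<in> van a b" .
  have "?d * ?b - ?a \<noteq> 0"
  proof
    assume "?d * ?b - ?a = 0"
    then have "v powi (pairing D \<mu> d + pairing D \<mu> b) * v powi (- pairing D \<mu> a) = ?a * v powi (- pairing D \<mu> a)"
      by (simp add: power_int_add v_nonzero)
    then have "v powi (pairing D \<mu> d + pairing D \<mu> b - pairing D \<mu> a) = 1"
      by (simp add: v_nonzero flip: power_int_add)
    then show False using ne by (simp add: v_powi_eq_one)
  qed
  then show ?thesis
    using van_scal[OF *, of "inverse (?d * ?b - ?a)"] unfolding free.s_assoc by simp
qed

lemma hpart_van: "p \<in> carrier U.R \<Longrightarrow> p - hpart (a - b) p \<in> van a b"
proof (induction rule: monomial_induct)
  case (single w c)
  have "wmon w c \<in> van a b" if "wdeg D (Word w) \<noteq> a - b"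
    using nonweight_van[OF free_alg_closed(9)[OF single] homogeneous_single that] .
  then show ?case by (simp add: hpart_single van_zero)
next
  case (add p q)
  have "p + q - hpart (a - b) (p + q) = (p - hpart (a - b) p) + (q - hpart (a - b) q)"
    by (simp add: hpart_add)
  then show ?case using add by (simp only: van_add)
qed (simp add: van_zero)

abbreviation coset :: "'x \<Rightarrow> 'x \<Rightarrow> ('i, 'y) qgen free \<Rightarrow> ('i, 'y) qgen free set set" where
  "coset a b p \<equiv> wt_rel D a b +>\<^bsub>U.Q\<^esub> U.cls p"

lemma coset_eq_iff:
  assumes "p \<in> carrier U.R" "q \<in> carrier U.R"
  shows "coset a b p = coset a b q \<longleftrightarrow> p - q \<in> van a b"
proof -
  interpret W: abelian_subgroup "wt_rel D a b" U.Q by (rule abelian_subgroup_wt_rel)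
  note c = U.cls_closed[OF assms(1)] U.cls_closed[OF assms(2)]
  have "p - q \<in> van a b \<longleftrightarrow> U.cls p \<oplus>\<^bsub>U.Q\<^esub> \<ominus>\<^bsub>U.Q\<^esub> U.cls q \<in> wt_rel D a b"
    using assms by (simp add: van_def U.cls_uminus U.cls_ops free_alg_closed)
  also have "\<dots> \<longleftrightarrow> U.cls p \<in> coset a b q"
    using W.a_rcos_module[OF c(2,1)] by simp
  also have "\<dots> \<longleftrightarrow> coset a b p = coset a b q"
    using W.a_repr_independence'[OF _ c(2)] W.a_rcos_self[OF c(1)] by metis
  finally show ?thesis ..
qed

lemma coset_zero: "coset a b 0 = wt_rel D a b"
proof -
  interpret W: abelian_subgroup "wt_rel D a b" U.Q by (rule abelian_subgroup_wt_rel)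
  show ?thesis using U.Q.a_coset_add_zero[OF W.a_subset] by (simp add: U.cls_zero)
qed

lemma coset_eq_wt_rel_iff: "p \<in> carrier U.R \<Longrightarrow> coset a b p = wt_rel D a b \<longleftrightarrow> p \<in> van a b"
  using coset_eq_iff[of p 0 a b] by (simp add: coset_zero free_alg_closed)

lemma rep_coset:
  assumes p: "p \<in> carrier U.R"
  obtains q where "q \<in> carrier U.R" "rep (coset a b p) = U.cls q" "q - p \<in> van a b"
proof -
  interpret W: abelian_subgroup "wt_rel D a b" U.Q by (rule abelian_subgroup_wt_rel)
  have "U.cls p \<in> coset a b p" using U.cls_closed[OF p] by (rule W.a_rcos_self)
  then have r: "rep (coset a b p) \<in> coset a b p" unfolding rep_def by (rule someI)
  then obtain h where h: "h \<in> wt_rel D a b" "rep (coset a b p) = h \<oplus>\<^bsub>U.Q\<^esub> U.cls p"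
    by (auto simp: a_r_coset_def')
  then obtain q where q: "q \<in> carrier U.R" "h = U.cls q"
    using W.a_Hcarr U.carrier_cls by blast
  show ?thesis
  proof
    show "q + p \<in> carrier U.R" using q p by (simp add: free_alg_closed)
    show "rep (coset a b p) = U.cls (q + p)" using h q p by (simp add: U.cls_ops)
    show "q + p - p \<in> van a b" using h q by (simp add: van_def)
  qed
qed

section \<open>The modified quantum group\<close>

definition \<pi> :: "'x \<Rightarrow> 'x \<Rightarrow> ('i, 'y) qgen free \<Rightarrow> ('i, 'y, 'x) dot_elt" where
  "\<pi> a b p = dpi D a b (U.cls p)"

lemma \<pi>_apply: "\<pi> a b p (a', b') = (if a' = a \<and> b' = b then coset a b p else wt_rel D a' b')"
  by (simp add: \<pi>_def dpi_def U_defs)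

lemma \<pi>_eq: "p \<in> carrier U.R \<Longrightarrow> q \<in> carrier U.R \<Longrightarrow> p - q \<in> van a b \<Longrightarrow> \<pi> a b p = \<pi> a b q"
  by (simp add: \<pi>_def dpi_def fun_eq_iff U_defs coset_eq_iff)

lemma idem_\<pi>: "idem D a = \<pi> a a 1"
  by (simp add: idem_def \<pi>_def U_defs U.cls_one)

lemma comp_group: "group (U.Q A_Mod wt_rel D a b)"
  by (rule abelian_subgroup.a_factorgroup_is_group[OF abelian_subgroup_wt_rel])

lemma carrier_Udot: "x \<in> carrier (Udot D) \<longleftrightarrow>
   (\<forall>a b. \<exists>p\<in>carrier U.R. x (a, b) = coset a b p) \<and> finite {(a, b). x (a, b) \<noteq> wt_rel D a b}"
proof -
  have "carrier (U.Q A_Mod wt_rel D a b) = {coset a b p | p. p \<in> carrier U.R}" for a b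
    using U.carrier_cls U.cls_closed by (fastforce simp: A_FactGroup_def' A_RCOSETS_def')
  moreover have "\<one>\<^bsub>U.Q A_Mod wt_rel D a b\<^esub> = wt_rel D a b" for a b
    by (simp add: A_FactGroup_def')
  ultimately show ?thesis
    unfolding Udot_def U_defs
    by (subst carrier_sum_group) (auto simp: comp_group PiE_iff split_def Bex_def conj_commute)
qed

lemma Udot_add: "(x \<otimes>\<^bsub>Udot D\<^esub> y) (a, b) = x (a, b) <+>\<^bsub>U.Q\<^esub> y (a, b)"
  by (simp add: Udot_def U_defs)

lemma coset_add:
  assumes "p \<in> carrier U.R" "q \<in> carrier U.R"
  shows "coset a b p <+>\<^bsub>U.Q\<^esub> coset a b q = coset a b (p + q)"
proof -
  interpret W: abelian_subgroup "wt_rel D a b" U.Q by (rule abelian_subgroup_wt_rel)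
  show ?thesis
    using W.a_rcos_sum[OF U.cls_closed[OF assms(1)] U.cls_closed[OF assms(2)]] assms by (simp add: U.cls_ops)
qed

lemma \<pi>_closed: "p \<in> carrier U.R \<Longrightarrow> \<pi> a b p \<in> carrier (Udot D)"
proof -
  assume p: "p \<in> carrier U.R"
  have "{(a', b'). \<pi> a b p (a', b') \<noteq> wt_rel D a' b'} \<subseteq> {(a, b)}"
    by (auto simp: \<pi>_apply)
  then have "finite {(a', b'). \<pi> a b p (a', b') \<noteq> wt_rel D a' b'}"
    by (rule finite_subset) simp
  moreover have "\<exists>q\<in>carrier U.R. \<pi> a b p (a', b') = coset a' b' q" for a' b'
    using p free_alg_closed(1) coset_zero[of a' b']
    by (cases "a' = a \<and> b' = b") (auto simp: \<pi>_apply)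
  ultimately show ?thesis by (simp add: carrier_Udot)
qed

lemma \<pi>_add: "p \<in> carrier U.R \<Longrightarrow> q \<in> carrier U.R \<Longrightarrow> \<pi> a b p \<otimes>\<^bsub>Udot D\<^esub> \<pi> a b q = \<pi> a b (p + q)"
  using coset_add[of 0 0] free_alg_closed(1)
  by (auto simp: fun_eq_iff Udot_add \<pi>_apply coset_add coset_zero)

lemma Udot_induct [consumes 1, case_names zero add]:
  assumes "x \<in> carrier (Udot D)"
    and zero: "P (\<pi> 0 0 0)"
    and add: "\<And>x a b p. x \<in> carrier (Udot D) \<Longrightarrow> p \<in> carrier U.R \<Longrightarrow> P x \<Longrightarrow> P (x \<otimes>\<^bsub>Udot D\<^esub> \<pi> a b p)"
  shows "P x"
proof -
  have "finite {(a, b). x (a, b) \<noteq> wt_rel D a b}"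
    using assms(1) by (simp add: carrier_Udot)
  then show ?thesis
    using assms(1)
  proof (induction "{(a, b). x (a, b) \<noteq> wt_rel D a b}" arbitrary: x rule: finite_psubset_induct)
    case psubset
    show ?case
    proof (cases "\<exists>a b. x (a, b) \<noteq> wt_rel D a b")
      case False
      then have "x = \<pi> 0 0 0" by (auto simp: fun_eq_iff \<pi>_apply coset_zero)
      then show ?thesis using zero by simp
    next
      case True
      then obtain a b where ab: "x (a, b) \<noteq> wt_rel D a b" by blast
      obtain p where p: "p \<in> carrier U.R" "x (a, b) = coset a b p"
        using psubset.prems unfolding carrier_Udot by blast
      define y where "y = x((a, b) := wt_rel D a b)"
      have sub: "{(a, b). y (a, b) \<noteq> wt_rel D a b} \<subset> {(a, b). x (a, b) \<noteq> wt_rel D a b}"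
        using ab by (auto simp: y_def)
      have y: "y \<in> carrier (Udot D)"
        using psubset.prems finite_subset[OF psubset_imp_subset[OF sub]] coset_zero[of a b] free_alg_closed(1)
        by (auto simp: carrier_Udot y_def)
      have "y \<otimes>\<^bsub>Udot D\<^esub> \<pi> a b p = x"
      proof
        fix ab' :: "'x \<times> 'x"
        obtain a' b' where ab': "ab' = (a', b')" by (cases ab')
        obtain q where q: "q \<in> carrier U.R" "x (a', b') = coset a' b' q"
          using psubset.prems unfolding carrier_Udot by blast
        show "(y \<otimes>\<^bsub>Udot D\<^esub> \<pi> a b p) ab' = x ab'"
          using p q coset_add[of 0 p a b] coset_add[of q 0 a' b'] free_alg_closed(1)
          by (auto simp: ab' Udot_add \<pi>_apply y_def coset_zero)
      qed
      then show ?thesis using add[OF y p(1) psubset.hyps(2)[OF sub y], of a b] by simp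
    qed
  qed
qed

lemma finsum_one: "u \<in> carrier U.Q \<Longrightarrow> g c = u \<Longrightarrow> (\<Oplus>\<^bsub>U.Q\<^esub>c\<in>{c}. g c) = u"
  by (subst U.Q.finsum_insert) auto

text \<open>
  The action is defined by representatives and sums over weights.  On one component at most one
  summand is left, or none if the element vanishes there; both cases agree because multiplication
  by homogeneous elements respects the vanishing polynomials.
\<close>

lemma lact_\<pi>:
  assumes t: "t \<in> carrier U.R" "homogeneous d t" and q: "q \<in> carrier U.R"
  shows "lact D (U.cls t) (\<pi> a b q) = \<pi> (a + d) b (t * q)"
proof
  fix ab' :: "'x \<times> 'x"
  obtain a' b' where ab': "ab' = (a', b')" by (cases ab')
  let ?S = "{c. \<pi> a b q (c, b') \<noteq> wt_rel D c b'}"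
  let ?f = "\<lambda>c. hcomp D (a' - c) (U.cls t) \<otimes>\<^bsub>U.Q\<^esub> rep (\<pi> a b q (c, b'))"
  have l: "lact D (U.cls t) (\<pi> a b q) ab' = wt_rel D a' b' +>\<^bsub>U.Q\<^esub> (\<Oplus>\<^bsub>U.Q\<^esub>c\<in>?S. ?f c)"
    by (simp add: lact_def ab' U_defs)
  have S: "?S = (if b' = b \<and> q \<notin> van a b then {a} else {})"
    using q by (auto simp: \<pi>_apply coset_eq_wt_rel_iff split: if_splits)
  have tq: "t * q \<in> carrier U.R" using t q by (simp add: free_alg_closed)
  show "lact D (U.cls t) (\<pi> a b q) ab' = \<pi> (a + d) b (t * q) ab'"
  proof (cases "b' = b \<and> q \<notin> van a b")
    case True
    obtain q' where q': "q' \<in> carrier U.R" "rep (coset a b q) = U.cls q'" "q' - q \<in> van a b"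
      using rep_coset[OF q] by blast
    have "?f a = U.cls (hpart (a' - a) t * q')"
      using True t q' by (simp add: \<pi>_apply hcomp_cls U.cls_ops hpart_closed)
    then have "(\<Oplus>\<^bsub>U.Q\<^esub>c\<in>?S. ?f c) = U.cls (hpart (a' - a) t * q')"
      using True S q' t by (simp add: finsum_one U.cls_closed free_alg_closed hpart_closed)
    moreover have "coset a' b (hpart (a' - a) t * q') = \<pi> (a + d) b (t * q) (a', b)"
    proof (cases "a' = a + d")
      case True
      have "t * q' - t * q \<in> van (a + d) b"
        using van_mult_left[OF t q'(3)] by (simp add: right_diff_distrib)
      then show ?thesis
        using True t q' tq by (simp add: \<pi>_apply hpart_homogeneous coset_eq_iff free_alg_closed)
    next
      case False
      then have "a' - a \<noteq> d" by auto
      then show ?thesis using False t by (simp add: \<pi>_apply hpart_homogeneous coset_zero)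
    qed
    ultimately show ?thesis using True l by (simp add: ab')
  next
    case False
    then have "(\<Oplus>\<^bsub>U.Q\<^esub>c\<in>?S. ?f c) = U.cls 0"
      using S by (auto simp: U.cls_zero)
    moreover have "\<pi> (a + d) b (t * q) (a', b') = wt_rel D a' b'"
      using False van_mult_left[OF t, of q a b] tq by (auto simp: \<pi>_apply coset_eq_wt_rel_iff)
    ultimately show ?thesis using l by (simp add: ab' coset_zero)
  qed
qed

text \<open>
  The multiplications by idempotents extract the part of degree \<open>a - b\<close>, and the other parts vanish
  in the component anyway.  This lets the orthogonality of the form be used for components.
\<close>

lemma sandwich:
  assumes p: "p \<in> carrier U.R"
  shows "dmult D (ract D (idem D a) (U.cls p)) (idem D b) = \<pi> a b p"
proof -
  define y where "y = ract D (idem D a) (U.cls p)"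
  have hp: "hpart d p \<in> carrier U.R" for d using p by (rule hpart_closed)
  have one: "1 \<in> carrier U.R" by (rule free_alg_closed)
  have y_apply: "y (a', b') = (if a' = a then coset a b' (hpart (a - b') p) else wt_rel D a' b')" for a' b'
  proof -
    let ?S = "{c. \<pi> a a 1 (a', c) \<noteq> wt_rel D a' c}"
    let ?f = "\<lambda>c. rep (\<pi> a a 1 (a', c)) \<otimes>\<^bsub>U.Q\<^esub> hcomp D (c - b') (U.cls p)"
    have l: "y (a', b') = wt_rel D a' b' +>\<^bsub>U.Q\<^esub> (\<Oplus>\<^bsub>U.Q\<^esub>c\<in>?S. ?f c)"
      by (simp add: y_def ract_def idem_\<pi> U_defs)
    have S: "?S = (if a' = a \<and> 1 \<notin> van a a then {a} else {})"
      using one by (auto simp: \<pi>_apply coset_eq_wt_rel_iff split: if_splits)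
    have R: "r * hpart (a - b') p \<in> van a b'" if "r \<in> van a a" for r
      using van_mult_right[OF hp homogeneous_hpart that, of "a - b'"] by simp
    show ?thesis
    proof (cases "a' = a \<and> 1 \<notin> van a a")
      case True
      obtain r where r: "r \<in> carrier U.R" "rep (coset a a 1) = U.cls r" "r - 1 \<in> van a a"
        using rep_coset[OF one] by blast
      have "?f a = U.cls (r * hpart (a - b') p)"
        using True r p by (simp add: \<pi>_apply hcomp_cls U.cls_ops hp)
      then have "(\<Oplus>\<^bsub>U.Q\<^esub>c\<in>?S. ?f c) = U.cls (r * hpart (a - b') p)"
        using True S r by (simp add: finsum_one U.cls_closed free_alg_closed hp)
      then show ?thesis
        using l True R[OF r(3)] r hp by (simp add: coset_eq_iff free_alg_closed left_diff_distrib)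
    next
      case False
      then have "(\<Oplus>\<^bsub>U.Q\<^esub>c\<in>?S. ?f c) = U.cls 0"
        using S by (auto simp: U.cls_zero)
      moreover have "coset a b' (hpart (a - b') p) = wt_rel D a b'" if "a' = a"
        using False that R[of 1] coset_eq_wt_rel_iff[OF hp] by simp
      ultimately show ?thesis
        using l by (simp add: coset_zero)
    qed
  qed
  show ?thesis
  proof
    fix ab' :: "'x \<times> 'x"
    obtain a' b' where ab': "ab' = (a', b')" by (cases ab')
    let ?S = "{c. y (a', c) \<noteq> wt_rel D a' c \<and> \<pi> b b 1 (c, b') \<noteq> wt_rel D c b'}"
    let ?f = "\<lambda>c. hcomp D (a' - c) (rep (y (a', c))) \<otimes>\<^bsub>U.Q\<^esub> hcomp D (c - b') (rep (\<pi> b b 1 (c, b')))"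
    have l: "dmult D y (idem D b) ab' = wt_rel D a' b' +>\<^bsub>U.Q\<^esub> (\<Oplus>\<^bsub>U.Q\<^esub>c\<in>?S. ?f c)"
      by (simp add: dmult_def idem_\<pi> ab' U_defs)
    have S: "?S = (if a' = a \<and> b' = b \<and> hpart (a - b) p \<notin> van a b \<and> 1 \<notin> van b b then {b} else {})"
      using one hp by (auto simp: y_apply \<pi>_apply coset_eq_wt_rel_iff split: if_splits)
    have hv: "hpart (c - d) r \<in> van c d" if "r \<in> van c d" for c d r
      using van_diff[OF that hpart_van[OF van_carrier[OF that], of c d]] by simp
    have L: "hpart (a - b) r * s \<in> van a b" if "r \<in> carrier U.R" "s \<in> van b b" for r s
      using van_mult_left[OF hpart_closed[OF that(1)] homogeneous_hpart that(2), of "a - b"] by simp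
    have ph: "\<pi> a b p = \<pi> a b (hpart (a - b) p)"
      using hpart_van[OF p] p hp by (intro \<pi>_eq)
    show "dmult D (ract D (idem D a) (U.cls p)) (idem D b) ab' = \<pi> a b p ab'"
    proof (cases "a' = a \<and> b' = b \<and> hpart (a - b) p \<notin> van a b \<and> 1 \<notin> van b b")
      case True
      obtain r where r: "r \<in> carrier U.R" "rep (coset b b 1) = U.cls r" "r - 1 \<in> van b b"
        using rep_coset[OF one] by blast
      obtain s where s: "s \<in> carrier U.R" "rep (coset a b (hpart (a - b) p)) = U.cls s" "s - hpart (a - b) p \<in> van a b"
        using rep_coset[OF hp] by blast
      have "?f b = U.cls (hpart (a - b) s * hpart 0 r)"
        using True r s by (simp add: \<pi>_apply y_apply hcomp_cls U.cls_ops hpart_closed)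
      then have "(\<Oplus>\<^bsub>U.Q\<^esub>c\<in>?S. ?f c) = U.cls (hpart (a - b) s * hpart 0 r)"
        using True S r s by (simp add: finsum_one U.cls_closed free_alg_closed hpart_closed)
      moreover have "hpart (a - b) s * hpart 0 r - hpart (a - b) p \<in> van a b"
      proof -
        have 1: "hpart (a - b) s - hpart (a - b) p \<in> van a b"
          using hv[OF s(3)] hpart_homogeneous[OF homogeneous_hpart] by (simp add: hpart_diff)
        have "hpart 0 r - 1 \<in> van b b"
          using hv[OF r(3)] hpart_homogeneous[OF homogeneous_one] by (simp add: hpart_diff)
        from van_add[OF L[OF s(1) this] 1] show ?thesis
          by (simp add: right_diff_distrib)
      qed
      ultimately show ?thesis
        using True l r s hp unfolding ph y_def[symmetric]
        by (simp add: \<pi>_apply coset_eq_iff free_alg_closed hpart_closed ab')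
    next
      case False
      then have "(\<Oplus>\<^bsub>U.Q\<^esub>c\<in>?S. ?f c) = U.cls 0"
        using S by (auto simp: U.cls_zero)
      moreover have "\<pi> a b (hpart (a - b) p) (a', b') = wt_rel D a' b'"
      proof (cases "a' = a \<and> b' = b")
        case True
        then have "hpart (a - b) p \<in> van a b"
          using False L[OF p, of 1] by auto
        then show ?thesis using True coset_eq_wt_rel_iff[OF hp] by (simp add: \<pi>_apply)
      qed (auto simp: \<pi>_apply)
      ultimately show ?thesis
        using l unfolding ph y_def[symmetric] by (simp add: ab' coset_zero)
    qed
  qed
qed

end

section \<open>The form on the negative half\<close>

lemma (in central_scalars) word_sum_sum: "word_sum s \<phi> (sum f A) = (\<Sum>a\<in>A. word_sum s \<phi> (f a))"
  by (induction A rule: infinite_finite_induct) (simp_all add: word_sum_add)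

lemma central_scalars_id: "central_scalars (\<lambda>c :: Qv. c)"
  by unfold_locales simp_all

interpretation Qv: central_scalars "\<lambda>c :: Qv. c"
  by (rule central_scalars_id)

\<comment> \<open>For the identity these equations read \<open>1 = 1\<close> and \<open>0 = 0\<close> and make the simplifier loop.\<close>
declare Qv.s_one [simp del] Qv.s_zero [simp del]

text \<open>
  Only values of functionals on coproducts are needed, and these obey a recursion in the word in
  which the tensor square no longer appears.
\<close>

definition coprod_sum :: "('i, 'y, 'x) rdatum \<Rightarrow> ('i word \<times> 'i word \<Rightarrow> Qv) \<Rightarrow> 'i list \<Rightarrow> Qv" where
  "coprod_sum D g w = word_sum (\<lambda>c. c) g (coprod_word D w)"

lemma coprod_sum_Nil: "coprod_sum D g [] = g (0, 0)"
  by (simp add: coprod_sum_def Qv.word_sum_single)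

lemma coprod_sum_Cons:
  "coprod_sum D g (i # w) = coprod_sum D (\<lambda>(x, y). g (Word [i] + x, y) + v powi wdot D (Word [i]) x * g (x, Word [i] + y)) w"
proof -
  let ?s = "Poly_Mapping.single (Word [i], 0) 1 + Poly_Mapping.single (0, Word [i]) 1 :: 'a word \<times> 'a word \<Rightarrow>\<^sub>0 Qv"
  let ?t = "coprod_word D w"
  have ne: "Word [i] \<noteq> 0" by (simp add: zero_word_def)
  have l: "Poly_Mapping.lookup ?s (Word [i], 0) = 1" "Poly_Mapping.lookup ?s (0, Word [i]) = 1"
    unfolding lookup_add lookup_single when_def using ne by simp_all
  have k: "Poly_Mapping.keys ?s = {(Word [i], 0), (0, Word [i])}"
  proof (rule antisym)
    have "Poly_Mapping.keys ?s \<subseteq> Poly_Mapping.keys (Poly_Mapping.single (Word [i], 0 :: 'a word) (1 :: Qv))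
        \<union> Poly_Mapping.keys (Poly_Mapping.single (0 :: 'a word, Word [i]) (1 :: Qv))"
      by (rule keys_add)
    then show "Poly_Mapping.keys ?s \<subseteq> {(Word [i], 0), (0, Word [i])}" by (simp add: insert_commute)
    have "(Word [i], 0) \<in> Poly_Mapping.keys ?s" "(0, Word [i]) \<in> Poly_Mapping.keys ?s"
      unfolding in_keys_iff l by simp_all
    then show "{(Word [i], 0), (0, Word [i])} \<subseteq> Poly_Mapping.keys ?s" by blast
  qed
  have "coprod_sum D g (i # w)
    = (\<Sum>(x', y')\<in>Poly_Mapping.keys ?t. Poly_Mapping.lookup ?t (x', y') * g (Word [i] + x', y'))
    + (\<Sum>(x', y')\<in>Poly_Mapping.keys ?t. Poly_Mapping.lookup ?t (x', y') * (v powi wdot D (Word [i]) x' * g (x', Word [i] + y')))"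
    using ne by (simp add: coprod_sum_def twist_mult_def k l split_def Qv.word_sum_sum Qv.word_sum_add Qv.word_sum_single wdot_def mult_ac)
  also have "\<dots> = coprod_sum D (\<lambda>(x, y). g (Word [i] + x, y) + v powi wdot D (Word [i]) x * g (x, Word [i] + y)) w"
    by (simp add: coprod_sum_def word_sum_def split_def distrib_left sum.distrib)
  finally show ?thesis .
qed

lemma coprod_sum_cong:
  assumes "set w \<subseteq> G" "\<And>x y. set (letters x) \<subseteq> G \<Longrightarrow> set (letters y) \<subseteq> G \<Longrightarrow> g (x, y) = g' (x, y)"
  shows "coprod_sum D g w = coprod_sum D g' w"
  using assms
proof (induction w arbitrary: g g')
  case (Cons i w)
  show ?case unfolding coprod_sum_Cons
    by (rule Cons.IH) (use Cons.prems in \<open>auto simp: plus_word_def\<close>)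
qed (simp add: coprod_sum_Nil)

lemma coprod_sum_add: "coprod_sum D (\<lambda>x. g x + h x) w = coprod_sum D g w + coprod_sum D h w"
  by (simp add: coprod_sum_def word_sum_def distrib_left sum.distrib)

lemma coprod_sum_mult: "coprod_sum D (\<lambda>x. c * g x) w = c * coprod_sum D g w"
  by (simp add: coprod_sum_def word_sum_def sum_distrib_left mult_ac)

lemma coprod_pairing_single:
  "coprod_pairing D Bf x x' (wmon w 1)
     = coprod_sum D (\<lambda>(a, b). Bf x (fcls D (Poly_Mapping.single a 1)) * Bf x' (fcls D (Poly_Mapping.single b 1))) w"
  by (simp add: coprod_pairing_def coprod_sum_def word_sum_def split_def mult.assoc)

text \<open>
  The left twisted derivations; up to a scalar they are adjoint to left multiplication by the
  generators.
\<close>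

primrec word_deriv :: "('i, 'y, 'x) rdatum \<Rightarrow> 'i \<Rightarrow> 'i list \<Rightarrow> 'i free" where
  "word_deriv D j [] = 0"
| "word_deriv D j (i # w) = (if i = j then wmon w 1 else 0)
     + scal (v powi dot D i j) * (gen i * word_deriv D j w)"

definition deriv :: "('i, 'y, 'x) rdatum \<Rightarrow> 'i \<Rightarrow> 'i free \<Rightarrow> 'i free" where
  "deriv D j = word_sum scal (\<lambda>w. word_deriv D j (letters w))"

definition twist :: "('i, 'y, 'x) rdatum \<Rightarrow> 'i \<Rightarrow> 'i free \<Rightarrow> 'i free" where
  "twist D j = evl scal (\<lambda>i. scal (v powi dot D i j) * gen i)"

lemma deriv_single: "deriv D j (wmon w c) = scal c * word_deriv D j w"
  by (simp add: deriv_def free.word_sum_single)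

lemma deriv_scal: "deriv D j (scal c) = 0"
  using deriv_single[of D j "[]" c] by (simp flip: zero_word_def)

lemma deriv_linear: "deriv D j (p + q) = deriv D j p + deriv D j q"
  "deriv D j (p - q) = deriv D j p - deriv D j q" "deriv D j 0 = 0"
  by (simp_all add: deriv_def free.word_sum_add free.word_sum_diff)

lemma twist_simps: "twist D j (p + q) = twist D j p + twist D j q" "twist D j (p - q) = twist D j p - twist D j q"
  "twist D j (p * q) = twist D j p * twist D j q" "twist D j (scal c) = scal c" "twist D j 1 = 1" "twist D j 0 = 0"
  "twist D j (gen i) = scal (v powi dot D i j) * gen i"
  by (simp_all only: twist_def free.evl_simps)

lemma deriv_scal_mult: "deriv D j (scal c * p) = scal c * deriv D j p"
proof (induction p rule: monomial_induct[OF free_alg_UNIV])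
  case (2 w d)
  then show ?case by (simp only: scal_mult_single deriv_single free.s_assoc)
qed (simp_all add: deriv_linear distrib_left)

lemma deriv_gen_mult: "deriv D j (gen i * p) = (if i = j then p else 0) + scal (v powi dot D i j) * (gen i * deriv D j p)"
proof (induction p rule: monomial_induct[OF free_alg_UNIV])
  case (2 w d)
  have "deriv D j (gen i * wmon w d) = scal d * word_deriv D j (i # w)"
    by (simp only: single_Word_Cons[symmetric] deriv_single)
  moreover have "scal d * (scal c * (gen i * t)) = scal c * (gen i * (scal d * t))" for c and t :: "'a free"
    by (metis free.s_left_comm)
  ultimately show ?case
    by (simp add: deriv_single distrib_left mult_single)
qed (simp_all add: deriv_linear distrib_left)

lemma deriv_mult: "deriv D j (p * q) = deriv D j p * q + twist D j p * deriv D j q"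
proof (induction p rule: monomial_induct[OF free_alg_UNIV])
  case (2 w d)
  have word: "deriv D j (wmon w 1 * q)
      = deriv D j (wmon w 1) * q + twist D j (wmon w 1) * deriv D j q"
  proof (induction w)
    case Nil
    have "wmon [] 1 = (1 :: 'a free)" by (simp add: zero_word_def flip: single_one)
    then show ?case using deriv_scal[of D j 1] by (simp add: twist_simps)
  next
    case (Cons i w)
    show ?case
      unfolding single_Word_Cons[of i w 1] mult.assoc deriv_gen_mult Cons twist_simps
      by (simp add: algebra_simps)
  qed
  have "wmon w d = scal d * wmon w 1"
    by (simp add: mult_single)
  then show ?case
    by (simp only: mult.assoc deriv_scal_mult word twist_simps distrib_left)
qed (simp_all add: deriv_linear twist_simps algebra_simps)

lemma deriv_closed: "p \<in> carrier (free_alg G) \<Longrightarrow> deriv D j p \<in> carrier (free_alg G)"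
proof (induction rule: monomial_induct)
  case (single w c)
  then have "word_deriv D j w \<in> carrier (free_alg G)"
    by (induction w) (auto intro!: free_alg_closed)
  then show ?case by (simp add: deriv_single free_alg_closed)
qed (simp_all add: deriv_linear free_alg_closed)

lemma letters_eq_Nil: "letters w = [] \<longleftrightarrow> w = Word []"
  by (cases w) simp

text \<open>
  The next two lemmas compute the parts of a coproduct whose left factor has degree zero or is a
  single letter; the latter is a twisted derivation.
\<close>

lemma coprod_sum_empty_left:
  "coprod_sum D (\<lambda>(x, y). if x = 0 then h y else 0) w = h (Word w)"
proof (induction w arbitrary: h)
  case (Cons i w)
  have "(\<lambda>(x, y). (if Word [i] + x = 0 then h y else 0) + v powi wdot D (Word [i]) x * (if x = 0 then h (Word [i] + y) else 0))
    = (\<lambda>(x, y). if x = 0 then h (Word [i] + y) else 0)"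
    by (auto simp: fun_eq_iff zero_word_def plus_word_def wdot_def)
  then show ?case
    unfolding coprod_sum_Cons prod.case
    using Cons[of "\<lambda>y. h (Word [i] + y)"] by (simp add: plus_word_def)
qed (simp add: coprod_sum_Nil zero_word_def)

lemma coprod_sum_deriv:
  "coprod_sum D (\<lambda>(x, y). if x = Word [j] then h y else 0) w = word_sum (\<lambda>c. c) h (word_deriv D j w)"
proof (induction w arbitrary: h)
  case Nil
  then show ?case by (simp add: coprod_sum_Nil zero_word_def)
next
  case (Cons i w)
  have h: "word_sum (\<lambda>c. c) h (scal c * (gen i * p)) = c * word_sum (\<lambda>c. c) (\<lambda>y. h (Word [i] + y)) p" for c p
  proof (induction p rule: monomial_induct[OF free_alg_UNIV])
    case (2 w d)
    then show ?case by (simp add: mult_single Qv.word_sum_single mult_ac)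
  qed (simp_all add: distrib_left Qv.word_sum_add)
  have "(\<lambda>(x, y). (if Word [i] + x = Word [j] then h y else 0) + v powi wdot D (Word [i]) x * (if x = Word [j] then h (Word [i] + y) else 0))
    = (\<lambda>xy. (\<lambda>(x, y). if x = 0 then (if i = j then h y else 0) else 0) xy
        + v powi dot D i j * (\<lambda>(x, y). if x = Word [j] then h (Word [i] + y) else 0) xy)"
    by (auto simp: fun_eq_iff zero_word_def plus_word_def wdot_def letters_eq_Nil)
  then have "coprod_sum D (\<lambda>(x, y). if x = Word [j] then h y else 0) (i # w)
     = (if i = j then h (Word w) else 0) + v powi dot D i j * word_sum (\<lambda>c. c) (\<lambda>y. h (Word [i] + y)) (word_deriv D j w)"
    unfolding coprod_sum_Cons prod.case
    by (simp only: coprod_sum_add coprod_sum_mult coprod_sum_empty_left Cons)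
  then show ?case by (simp add: Qv.word_sum_add Qv.word_sum_single h)
qed

lemma frels_carrier:
  "{serre D (\<lambda>i. i) i j | i j. i \<in> idx D \<and> j \<in> idx D \<and> i \<noteq> j} \<subseteq> carrier (free_alg (idx D))"
  using serre_closed[of "\<lambda>i. i"] by fastforce

locale half_form = datum D for D :: "('i, 'y::ab_group_add, 'x::ab_group_add) rdatum" +
  fixes Bf
  assumes f_form: "f_form D Bf"
begin

sublocale f: presented "idx D" "{serre D (\<lambda>i. i) i j | i j. i \<in> idx D \<and> j \<in> idx D \<and> i \<noteq> j}"
  by unfold_locales (rule frels_carrier)

lemma f_defs: "falg D = f.Q" "fcls D p = f.cls p"
  by (simp_all add: falg_def fcls_def fideal_def f.I_def)

definition b :: "'i free \<Rightarrow> 'i free \<Rightarrow> Qv" where "b p q = Bf (f.cls p) (f.cls q)"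
definition c :: "'i \<Rightarrow> Qv" where "c i = inverse (1 - vi D i powi (- 2))"

lemma
  assumes p: "p \<in> carrier f.R" and q: "q \<in> carrier f.R"
  shows b_sym: "b p q = b q p"
    and b_add_left: "p' \<in> carrier f.R \<Longrightarrow> b (p + p') q = b p q + b p' q"
    and b_scal_left: "b (scal d * p) q = d * b p q"
    and b_mult: "p' \<in> carrier f.R \<Longrightarrow> b (p * p') q = coprod_pairing D Bf (f.cls p) (f.cls p') q"
proof -
  note ax = f_form[unfolded f_form_def f_defs]
  note cl = f.cls_closed
  show "b p q = b q p"
    using ax cl[OF p] cl[OF q] unfolding b_def by blast
  show "b (p + p') q = b p q + b p' q" if "p' \<in> carrier f.R"
  proof -
    have "Bf (f.cls p \<oplus>\<^bsub>f.Q\<^esub> f.cls p') (f.cls q) = Bf (f.cls p) (f.cls q) + Bf (f.cls p') (f.cls q)"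
      using ax cl[OF p] cl[OF q] cl[OF that] by blast
    then show ?thesis using p that by (simp add: b_def f.cls_ops)
  qed
  show "b (scal d * p) q = d * b p q"
  proof -
    have "Bf (f.cls (scal d) \<otimes>\<^bsub>f.Q\<^esub> f.cls p) (f.cls q) = d * Bf (f.cls p) (f.cls q)"
      using ax cl[OF p] cl[OF q] by blast
    then show ?thesis using p by (simp add: b_def f.cls_ops free_alg_closed)
  qed
  show "b (p * p') q = coprod_pairing D Bf (f.cls p) (f.cls p') q" if "p' \<in> carrier f.R"
  proof -
    have "Bf (f.cls p \<otimes>\<^bsub>f.Q\<^esub> f.cls p') (f.cls q) = coprod_pairing D Bf (f.cls p) (f.cls p') q"
      using ax cl[OF p] q cl[OF that] by blast
    then show ?thesis using p that by (simp add: b_def f.cls_ops)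
  qed
qed

lemma b_one: "b 1 1 = 1"
  using f_form by (simp add: f_form_def f_defs b_def f.cls_one)

lemma b_gen: "i \<in> idx D \<Longrightarrow> j \<in> idx D \<Longrightarrow> b (gen i) (gen j) = (if i = j then c i else 0)"
  using f_form by (simp add: f_form_def f_defs b_def c_def)

lemma b_scal_right: "p \<in> carrier f.R \<Longrightarrow> q \<in> carrier f.R \<Longrightarrow> b p (scal d * q) = d * b p q"
  using b_scal_left[of q p d] b_sym[of p] by (simp add: free_alg_closed)

lemma b_add_right: "p \<in> carrier f.R \<Longrightarrow> q \<in> carrier f.R \<Longrightarrow> q' \<in> carrier f.R \<Longrightarrow> b p (q + q') = b p q + b p q'"
  using b_add_left[of q p q'] b_sym[of p] by (simp add: free_alg_closed)

lemma b_zero: "p \<in> carrier f.R \<Longrightarrow> b p 0 = 0" "p \<in> carrier f.R \<Longrightarrow> b 0 p = 0"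
  using b_scal_right[of p 0 0] b_scal_left[of 0 p 0] by (simp_all add: free_alg_closed)

lemma b_mult_word:
  assumes "p \<in> carrier f.R" "p' \<in> carrier f.R" "set w \<subseteq> idx D"
  shows "b (p * p') (wmon w 1)
    = coprod_sum D (\<lambda>(x, y). b p (Poly_Mapping.single x 1) * b p' (Poly_Mapping.single y 1)) w"
  using b_mult[OF assms(1) _ assms(2)] free_alg_closed(9)[OF assms(3)]
  by (simp add: coprod_pairing_single f_defs b_def)

lemma single_zero_word: "wmon [] 1 = (1 :: 'i free)" "Poly_Mapping.single 0 1 = (1 :: 'i free)"
  by (simp_all add: zero_word_def flip: single_one)

lemma b_one_gen: "i \<in> idx D \<Longrightarrow> b 1 (gen i) = 0"
  using b_mult_word[of 1 1 "[i]"] b_one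
  by (simp add: coprod_sum_Cons coprod_sum_Nil wdot_def free_alg_closed single_zero_word del: single_one)

lemma b_gen_mult_one: "i \<in> idx D \<Longrightarrow> p \<in> carrier f.R \<Longrightarrow> b (gen i * p) 1 = 0"
  using b_mult_word[of "gen i" p "[]"] b_sym[of "gen i" 1] b_one_gen[of i]
  by (simp add: coprod_sum_Nil free_alg_closed single_zero_word del: single_one)

text \<open>
  The form respects degrees: a generator pairs to zero with every word other than itself, because the
  coproduct of the generator has only its two obvious terms.
\<close>

lemma b_gen_word:
  assumes i: "i \<in> idx D" and w: "set w \<subseteq> idx D"
  shows "b (gen i) (wmon w 1) = (if w = [i] then c i else 0)"
proof (cases w)
  case Nil
  then show ?thesis using b_gen_mult_one[OF i, of 1] by (simp add: single_zero_word free_alg_closed del: single_one)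
next
  case (Cons j u)
  have ju: "j \<in> idx D" "set u \<subseteq> idx D" using w Cons by auto
  let ?u = "wmon u 1 :: 'i free"
  have u: "?u \<in> carrier f.R" using ju by (intro free_alg_closed)
  have "b (gen i) (wmon w 1) = b (gen j * ?u) (gen i)"
    unfolding Cons single_Word_Cons[of j u]
    using i ju u by (intro b_sym free_alg_closed)
  also have "\<dots> = b (gen j) (gen i) * b ?u 1 + b (gen j) 1 * b ?u (gen i)"
    using b_mult_word[of "gen j" ?u "[i]"] i ju u
    by (simp add: coprod_sum_Cons coprod_sum_Nil wdot_def free_alg_closed single_zero_word del: single_one)
  also have "b (gen j) 1 = 0" using b_gen_mult_one[OF ju(1), of 1] by (simp add: free_alg_closed)
  also have "b ?u 1 = (if u = [] then 1 else 0)"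
  proof (cases u)
    case (Cons k u')
    then show ?thesis
      using b_gen_mult_one[of k "wmon u' 1"] ju free_alg_closed(9)[of u' "idx D" 1]
      by (simp add: single_Word_Cons[symmetric])
  qed (simp add: single_zero_word b_one del: single_one)
  finally show ?thesis using Cons b_gen[OF ju(1) i] by auto
qed

lemma b_word_sum: "p \<in> carrier f.R \<Longrightarrow> q \<in> carrier f.R \<Longrightarrow>
    b p q = word_sum (\<lambda>d. d) (\<lambda>y. b p (Poly_Mapping.single y 1)) q"
proof (rotate_tac, induction q rule: monomial_induct)
  case (single w d)
  then show ?case
    using b_scal_right[of p "wmon w 1" d] by (simp add: Qv.word_sum_single mult_single free_alg_closed)
qed (simp_all add: b_zero b_add_right Qv.word_sum_add)

lemma b_adjoint:
  assumes i: "i \<in> idx D" and p: "p \<in> carrier f.R" and q: "q \<in> carrier f.R"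
  shows "b (gen i * p) q = c i * b p (deriv D i q)"
  using q
proof (induction q rule: monomial_induct)
  case (single w d)
  have gp: "gen i * p \<in> carrier f.R" using i p by (intro free_alg_closed)
  have "b (gen i * p) (wmon w 1)
      = coprod_sum D (\<lambda>(x, y). b (gen i) (Poly_Mapping.single x 1) * b p (Poly_Mapping.single y 1)) w"
    using i p single by (intro b_mult_word free_alg_closed)
  also have "\<dots> = coprod_sum D (\<lambda>xy. c i * (\<lambda>(x, y). if x = Word [i] then b p (Poly_Mapping.single y 1) else 0) xy) w"
  proof (rule coprod_sum_cong[OF single])
    fix x y :: "'i word" assume "set (letters x) \<subseteq> idx D"
    then show "(\<lambda>(x, y). b (gen i) (Poly_Mapping.single x 1) * b p (Poly_Mapping.single y 1)) (x, y)
      = c i * (\<lambda>(x, y). if x = Word [i] then b p (Poly_Mapping.single y 1) else 0) (x, y)"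
      using b_gen_word[OF i, of "letters x"] by (cases x) auto
  qed
  also have "\<dots> = c i * b p (word_deriv D i w)"
  proof -
    have "word_deriv D i w \<in> carrier f.R"
      using deriv_closed[OF free_alg_closed(9)[OF single, of 1], of D i] by (simp add: deriv_single)
    from b_word_sum[OF p this] show ?thesis
      by (simp only: coprod_sum_mult coprod_sum_deriv)
  qed
  finally have 1: "b (gen i * p) (wmon w 1) = c i * b p (word_deriv D i w)" .
  have w: "wmon w 1 \<in> carrier f.R" "word_deriv D i w \<in> carrier f.R"
    using single deriv_closed[OF free_alg_closed(9)[OF single, of 1], of D i] by (auto simp: deriv_single free_alg_closed)
  have "b (gen i * p) (wmon w d) = d * b (gen i * p) (wmon w 1)"
    using b_scal_right[OF gp w(1), of d] by (simp add: mult_single)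
  then show ?case
    using b_scal_right[OF p w(2), of d] by (simp add: 1 deriv_single)
qed (use p i in \<open>simp_all add: b_zero b_add_right deriv_linear deriv_closed free_alg_closed distrib_left\<close>)

end

context contraction_datum
begin

text \<open>
  The restriction of the embedding to the negative halves, on generators.
\<close>

definition \<psi> :: "int \<Rightarrow> 'i option \<Rightarrow> 'i free" where
  "\<psi> \<epsilon> k = (case k of None \<Rightarrow> gen m * gen p - scal (vi D p powi \<epsilon>) * gen p * gen m | Some i \<Rightarrow> gen i)"

lemma \<psi>_closed: "k \<in> idx D' \<Longrightarrow> \<psi> \<epsilon> k \<in> carrier (free_alg (idx D))"
  using pm(1,2) by (auto simp: \<psi>_def intro!: free_alg_closed split: option.splits)

lemma free_hom_\<psi>_closed: "x \<in> carrier (free_alg (idx D')) \<Longrightarrow> free_hom (\<psi> \<epsilon>) x \<in> carrier (free_alg (idx D))"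
  by (rule free_hom_closed) (use \<psi>_closed in auto)

lemma twist_\<psi>: "twist D l (\<psi> \<epsilon> None) = scal (v powi (dot D p l + dot D m l)) * \<psi> \<epsilon> None"
proof -
  let ?p = "v powi dot D p l" and ?m = "v powi dot D m l"
  have pm: "scal ?p * gen p * (scal ?m * gen m) = scal (?p * ?m) * (gen p * gen m)"
    "scal ?m * gen m * (scal ?p * gen p) = scal (?p * ?m) * (gen m * gen p)"
    by (simp_all add: mult_single mult.commute)
  have "scal (vi D p powi \<epsilon>) * (scal (?p * ?m) * (gen p * gen m)) = scal (?p * ?m) * (scal (vi D p powi \<epsilon>) * (gen p * gen m))"
    by (rule free.s_left_comm)
  then show ?thesis
    by (simp only: \<psi>_def option.case twist_simps mult.assoc pm[unfolded mult.assoc] right_diff_distrib power_int_add[OF disjI1[OF v_nonzero]])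
qed

lemma deriv_gen: "deriv D j (gen i) = (if i = j then 1 else 0)"
  using deriv_gen_mult[of D j i 1] deriv_scal[of D j 1] by simp

text \<open>
  With the sign \<open>- 1\<close> the derivation of \<open>p\<close> kills the new generator and that of \<open>m\<close> turns it into a
  multiple of the generator \<open>p\<close>.
\<close>

lemma deriv_\<psi>:
  "l \<noteq> p \<Longrightarrow> l \<noteq> m \<Longrightarrow> deriv D l (\<psi> \<epsilon> None) = 0"
  "deriv D p (\<psi> (- 1) None) = 0"
  "deriv D m (\<psi> (- 1) None) = scal (1 - vi D p powi (- 2)) * gen p"
proof -
  have d: "deriv D l (\<psi> \<epsilon> None) = (if m = l then gen p else 0) + scal (v powi dot D m l) * (gen m * (if p = l then 1 else 0))
      - scal (vi D p powi \<epsilon>) * ((if p = l then gen m else 0) + scal (v powi dot D p l) * (gen p * (if m = l then 1 else 0)))" for l \<epsilon>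
    by (simp only: \<psi>_def option.case deriv_linear deriv_gen_mult deriv_scal_mult mult.assoc deriv_gen)
  show "l \<noteq> p \<Longrightarrow> l \<noteq> m \<Longrightarrow> deriv D l (\<psi> \<epsilon> None) = 0"
    unfolding d by simp
  show "deriv D p (\<psi> (- 1) None) = 0"
    unfolding d using p_neq_m by (simp add: dot_pm power_int_minus)
  have "vi D p powi (- 2) = inverse (vi D p) * inverse (vi D p)"
    by (simp add: power_int_minus power2_eq_square)
  then show "deriv D m (\<psi> (- 1) None) = scal (1 - vi D p powi (- 2)) * gen p"
    unfolding d using p_neq_m by (simp add: dot_pm power_int_minus mult_single single_diff left_diff_distrib)
qed

lemma twist_\<psi>_gen: "twist D l (\<psi> \<epsilon> k) = scal (v powi dot D' k (Some l)) * \<psi> \<epsilon> k"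
  by (cases k) (simp_all add: twist_\<psi>, simp add: \<psi>_def twist_simps)

lemma free_hom_Cons: "free_hom h (wmon (k # w) c) = h k * free_hom h (wmon w c)"
  unfolding single_Word_Cons[of k w c] by (simp only: free_hom_evl free.evl_mult free.evl_gen)

lemma free_hom_scal: "free_hom h (scal c * x) = scal c * free_hom h x"
  by (simp only: free_hom_evl free.evl_mult free.evl_scal)

lemma deriv_free_hom_\<psi>:
  assumes l: "l \<in> idx D" "l \<noteq> p" "l \<noteq> m" and y: "y \<in> carrier (free_alg (idx D'))"
  shows "deriv D l (free_hom (\<psi> \<epsilon>) y) = free_hom (\<psi> \<epsilon>) (deriv D' (Some l) y)"
  using y
proof (induction rule: monomial_induct)
  case (single w c)
  let ?h = "free_hom (\<psi> \<epsilon>)"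
  show ?case
  proof (induction w)
    case Nil
    then show ?case by (simp add: deriv_scal free_hom_evl free.evl_single)
      (simp add: deriv_scal flip: zero_word_def)
  next
    case (Cons k w)
    let ?w = "wmon w c :: 'i option free"
    have "deriv D l (\<psi> \<epsilon> k) = (if k = Some l then 1 else 0)"
      using l deriv_\<psi>(1)[of l \<epsilon>] by (cases k) (simp_all add: \<psi>_def deriv_gen)
    then have "deriv D l (?h (wmon (k # w) c))
      = (if k = Some l then ?h ?w else 0) + scal (v powi dot D' k (Some l)) * (\<psi> \<epsilon> k * ?h (deriv D' (Some l) ?w))"
      unfolding free_hom_Cons deriv_mult twist_\<psi>_gen Cons by (simp add: mult.assoc)
    also have "\<dots> = ?h (deriv D' (Some l) (wmon (k # w) c))"
      unfolding single_Word_Cons[of k w c] deriv_gen_mult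
      by (simp add: free_hom_evl free.evl_add free.evl_mult free.evl_scal free.evl_gen)
    finally show ?case .
  qed
qed (simp_all add: free_hom_evl free.evl_add deriv_linear)

lemma deriv_p_\<psi>: "y \<in> carrier (free_alg (idx D')) \<Longrightarrow> deriv D p (free_hom (\<psi> (- 1)) y) = 0"
proof (induction rule: monomial_induct)
  case (single w c)
  then show ?case
  proof (induction w)
    case Nil
    then show ?case by (simp add: free_hom_evl free.evl_single deriv_scal)
  next
    case (Cons k w)
    then have "deriv D p (\<psi> (- 1) k) = 0"
      using deriv_\<psi>(2) by (cases k) (auto simp: \<psi>_def deriv_gen)
    then show ?case using Cons unfolding free_hom_Cons deriv_mult by simp
  qed
qed (simp_all add: free_hom_evl free.evl_add deriv_linear)

text \<open>
  On the image of the embedding the adjoint of the new generator acts through the composite of the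
  derivations of the two old vertices.
\<close>

lemma deriv_p_deriv_m_\<psi>:
  "y \<in> carrier (free_alg (idx D')) \<Longrightarrow> deriv D p (deriv D m (free_hom (\<psi> (- 1)) y))
    = scal (1 - vi D p powi (- 2)) * free_hom (\<psi> (- 1)) (deriv D' None y)"
proof (induction rule: monomial_induct)
  case (single w c)
  define t where "t = 1 - vi D p powi (- 2)"
  let ?h = "free_hom (\<psi> (- 1))"
  from single show ?case unfolding t_def[symmetric]
  proof (induction w)
    case Nil
    then show ?case
      by (simp add: free_hom_evl free.evl_single deriv_scal)
        (simp add: deriv_scal deriv_linear flip: zero_word_def)
  next
    case (Cons k w)
    let ?w = "wmon w c :: 'i option free"
    define Y where "Y = ?h ?w"
    define u where "u = \<psi> (- 1) k"
    have w: "?w \<in> carrier (free_alg (idx D'))" using Cons.prems by (intro free_alg_closed) auto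
    have Y: "deriv D p Y = 0" unfolding Y_def by (rule deriv_p_\<psi>[OF w])
    have IH: "deriv D p (deriv D m Y) = scal t * ?h (deriv D' None ?w)"
      using Cons by (simp add: Y_def)
    have u: "deriv D p u = 0" "deriv D m u = (if k = None then scal t * gen p else 0)"
      using deriv_\<psi>(2,3) Cons.prems by (cases k; auto simp: u_def \<psi>_def deriv_gen t_def)+
    obtain a a' where tw: "twist D m u = scal a * u" "twist D p u = scal a' * u" and a: "a * a' = v powi dot D' k None"
    proof (cases k)
      case None
      have "dot D' k None = (dot D p m + dot D m m) + (dot D p p + dot D m p)"
        using None pm dot_sym[of p m] by simp
      then have "v powi (dot D p m + dot D m m) * v powi (dot D p p + dot D m p) = v powi dot D' k None"
        by (simp only: power_int_add[OF disjI1[OF v_nonzero]])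
      then show ?thesis using that twist_\<psi>[of m] twist_\<psi>[of p] None by (simp add: u_def)
    next
      case (Some i)
      have "v powi dot D i m * v powi dot D i p = v powi dot D' k None"
        using Some by (simp add: power_int_add v_nonzero)
      then show ?thesis using that Some by (simp add: u_def \<psi>_def twist_simps)
    qed
    have "deriv D p (deriv D m (u * Y)) = deriv D p (deriv D m u * Y) + deriv D p (scal a * (u * deriv D m Y))"
      by (simp add: deriv_mult[of D m u Y] deriv_linear tw mult.assoc)
    also have "deriv D p (deriv D m u * Y) = (if k = None then scal t * Y else 0)"
      by (simp add: u mult.assoc deriv_scal_mult deriv_gen_mult Y deriv_linear)
    also have "deriv D p (scal a * (u * deriv D m Y)) = scal (a * a') * (u * (scal t * ?h (deriv D' None ?w)))"
      by (simp only: deriv_scal_mult deriv_mult[of D p u] u tw IH mult.assoc free.s_assoc mult_zero_left add_0_left)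
    also have "\<dots> = scal t * (scal (a * a') * (u * ?h (deriv D' None ?w)))"
      by (simp only: free.s_left_comm[of u] free.s_assoc mult.commute[of t])
    finally have "deriv D p (deriv D m (u * Y)) = scal t * ((if k = None then Y else 0)
        + scal (v powi dot D' k None) * (u * ?h (deriv D' None ?w)))"
      unfolding a by (simp add: distrib_left)
    also have "(if k = None then Y else 0) + scal (v powi dot D' k None) * (u * ?h (deriv D' None ?w))
        = ?h (deriv D' None (wmon (k # w) c))"
      unfolding single_Word_Cons[of k w c] deriv_gen_mult Y_def u_def
      by (simp add: free_hom_evl free.evl_add free.evl_mult free.evl_scal free.evl_gen)
    finally show ?case unfolding free_hom_Cons Y_def u_def .
  qed
qed (simp_all add: free_hom_evl free.evl_add deriv_linear distrib_left)

text \<open>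
  Left multiplication by the new generator in the first argument becomes, in the second argument, the
  composite of the derivations of \<open>m\<close> and \<open>p\<close>; the composite in the other order vanishes on the
  image.  The scalar \<open>1 - q\<^sup>-\<^sup>2\<close> that appears cancels one of the two factors \<open>(1 - q\<^sup>-\<^sup>2)\<^sup>-\<^sup>1\<close> that come
  from the two old generators.
\<close>

lemma half_form_contraction_plus:
  assumes f: "f_form D Bf" and f': "f_form D' Bf'"
    and x: "x \<in> carrier (free_alg (idx D'))" and y: "y \<in> carrier (free_alg (idx D'))"
  shows "Bf' (fcls D' x) (fcls D' y) = Bf (fcls D (free_hom (\<psi> 1) x)) (fcls D (free_hom (\<psi> (- 1)) y))"
proof -
  interpret H: half_form D Bf using f by unfold_locales
  interpret D': datum D' by (rule datum_contraction)
  interpret H': half_form D' Bf' using f' by unfold_locales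
  let ?h = "free_hom (\<psi> 1)" and ?h' = "free_hom (\<psi> (- 1))"
  have hc: "z \<in> carrier H'.f.R \<Longrightarrow> free_hom (\<psi> \<epsilon>) z \<in> carrier H.f.R" for z \<epsilon>
    by (rule free_hom_\<psi>_closed)
  have "\<forall>y\<in>carrier H'.f.R. H'.b x y = H.b (?h x) (?h' y)"
    using x
  proof (induction x rule: monomial_induct)
    case zero
    show ?case using hc by (simp add: H'.b_zero H.b_zero free_hom_evl)
  next
    case (add x x')
    have "?h (x + x') = ?h x + ?h x'" by (simp add: free_hom_evl free.evl_add)
    then show ?case using add hc by (simp add: H'.b_add_left H.b_add_left)
  next
    case (single w d)
    have base: "\<forall>y\<in>carrier H'.f.R. H'.b (wmon w 1) y = H.b (?h (wmon w 1)) (?h' y)"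
      using single
    proof (induction w)
      case Nil
      have "H'.b 1 y = H.b 1 (?h' y)" if "y \<in> carrier H'.f.R" for y
        using that
      proof (induction rule: monomial_induct)
        case (single w d)
        have base: "H'.b 1 (wmon w 1) = H.b 1 (?h' (wmon w 1))"
        proof (cases w)
          case Nil
          then show ?thesis by (simp add: H'.single_zero_word H'.b_one H.b_one free_hom_evl free.evl_one del: single_one)
        next
          case (Cons k u)
          have k: "k \<in> idx D'" "set u \<subseteq> idx D'" using Cons single by auto
          define z where "z = wmon u (1 :: Qv)"
          have z: "z \<in> carrier H'.f.R" using k by (simp add: z_def free_alg_closed)
          have 1: "H'.b 1 (gen k * z) = 0"
            using H'.b_gen_mult_one[OF k(1) z] H'.b_sym[of 1 "gen k * z"] k z by (simp add: free_alg_closed)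
          have gz: "H.b (gen i * Z) 1 = 0" if "i \<in> idx D" "Z \<in> carrier H.f.R" for i Z
            using H.b_gen_mult_one that .
          have "H.b (\<psi> (- 1) k * ?h' z) 1 = 0"
          proof (cases k)
            case None
            let ?q = "vi D p powi (- 1)"
            have *: "\<psi> (- 1) k * ?h' z = gen m * (gen p * ?h' z) + scal (- ?q) * (gen p * (gen m * ?h' z))"
              unfolding None \<psi>_def option.case by (simp add: left_diff_distrib mult.assoc free.s_minus)
            show ?thesis unfolding *
              using hc[OF z] pm(1,2) by (simp add: H.b_add_left H.b_scal_left gz free_alg_closed)
          next
            case (Some i)
            then show ?thesis using gz[of i "?h' z"] k hc[OF z] by (auto simp: \<psi>_def)
          qed
          then have "H.b 1 (\<psi> (- 1) k * ?h' z) = 0"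
            using H.b_sym[of "\<psi> (- 1) k * ?h' z" 1] hc[OF z] \<psi>_closed[OF k(1)] by (simp add: free_alg_closed)
          moreover have "?h' (wmon w 1) = \<psi> (- 1) k * ?h' z"
            unfolding Cons z_def by (rule free_hom_Cons)
          moreover have "wmon w 1 = gen k * z"
            unfolding Cons z_def by (rule single_Word_Cons)
          ultimately show ?thesis using 1 by metis
        qed
        define W where "W = wmon w (1 :: Qv)"
        have W: "W \<in> carrier H'.f.R" unfolding W_def using single by (rule free_alg_closed)
        have eq: "wmon w d = scal d * W"
          by (simp add: W_def mult_single)
        show ?case
          using base H'.b_scal_right[OF free_alg_closed(2) W, of d] H.b_scal_right[OF free_alg_closed(2) hc[OF W], of d]
          unfolding eq free_hom_scal W_def[symmetric] by simp
      qed (use hc in \<open>simp_all add: H'.b_zero H.b_zero H'.b_add_right H.b_add_right free_alg_closed free_hom_evl free.evl_add\<close>)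
      then show ?case by (simp add: H'.single_zero_word free_hom_evl free.evl_one del: single_one)
    next
      case (Cons k w)
      define X where "X = wmon w (1 :: Qv)"
      have k: "k \<in> idx D'" and w: "set w \<subseteq> idx D'" using Cons.prems by auto
      have X: "X \<in> carrier H'.f.R" using w by (simp add: X_def free_alg_closed)
      have IH: "H'.b X y = H.b (?h X) (?h' y)" if "y \<in> carrier H'.f.R" for y
        using Cons.IH w that by (simp add: X_def)
      have "H'.b (gen k * X) y = H.b (\<psi> 1 k * ?h X) (?h' y)" if y: "y \<in> carrier H'.f.R" for y
      proof -
        note hX = hc[OF X, of 1] and hy = hc[OF y, of "- 1"]
        have dy: "deriv D' k y \<in> carrier H'.f.R" using y by (rule deriv_closed)
        have "H'.b (gen k * X) y = H'.c k * H.b (?h X) (?h' (deriv D' k y))"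
          using H'.b_adjoint[OF k X y] IH[OF dy] by simp
        also have "\<dots> = H.b (\<psi> 1 k * ?h X) (?h' y)"
        proof (cases k)
          case (Some l)
          then have l: "l \<in> idx D" "l \<noteq> p" "l \<noteq> m" using k by auto
          show ?thesis
            using H.b_adjoint[OF l(1) hX hy] deriv_free_hom_\<psi>[OF l y] Some by (simp add: \<psi>_def H.c_def H'.c_def)
        next
          case None
          let ?q = "vi D p"
          have adj: "H.b (gen i * (gen j * ?h X)) (?h' y) = H.c p * H.c p * H.b (?h X) (deriv D j (deriv D i (?h' y)))"
            if "i = p \<and> j = m \<or> i = m \<and> j = p" for i j
          proof -
            have i: "i \<in> idx D" "j \<in> idx D" "H.c i = H.c p" "H.c j = H.c p" using that pm vi_pm by (auto simp: H.c_def)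
            show ?thesis
              using H.b_adjoint[OF i(1) _ hy, of "gen j * ?h X"] H.b_adjoint[OF i(2) hX deriv_closed[OF hy, of D i]] hX i
              by (simp add: free_alg_closed)
          qed
          have *: "\<psi> 1 k * ?h X = gen m * (gen p * ?h X) + scal (- ?q) * (gen p * (gen m * ?h X))"
            unfolding None \<psi>_def option.case by (simp add: left_diff_distrib mult.assoc free.s_minus)
          have "H.b (\<psi> 1 k * ?h X) (?h' y) = H.c p * H.c p * H.b (?h X) (deriv D p (deriv D m (?h' y)))
             - ?q * (H.c p * H.c p * H.b (?h X) (deriv D m (deriv D p (?h' y))))"
            unfolding * using hX hy pm(1,2) adj[of m p] adj[of p m]
            by (simp add: H.b_add_left H.b_scal_left free_alg_closed)
          also have "\<dots> = H.c p * (H.c p * (1 - ?q powi (- 2))) * H.b (?h X) (?h' (deriv D' None y))"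
            using hX hc[OF deriv_closed[OF y, of D' None], of "- 1"]
            by (simp add: deriv_p_\<psi>[OF y] deriv_p_deriv_m_\<psi>[OF y] deriv_linear H.b_zero H.b_scal_right)
          also have "H.c p * (1 - ?q powi (- 2)) = 1"
          proof -
            interpret g: generic ?q using pm(1) by (rule generic_vi)
            have "1 - ?q powi (- 2) \<noteq> 0"
              using g.q_generic[of "- 2"] by auto
            then show ?thesis by (simp add: H.c_def)
          qed
          finally show ?thesis using None by (simp add: H.c_def H'.c_def)
        qed
        finally show ?thesis .
      qed
      moreover have e: "?h (wmon (k # w) 1) = \<psi> 1 k * ?h X"
        unfolding X_def by (rule free_hom_Cons)
      moreover have e': "wmon (k # w) 1 = gen k * X"
        unfolding X_def by (rule single_Word_Cons)
      ultimately show ?case unfolding e unfolding e' by blast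
    qed
    define W where "W = wmon w (1 :: Qv)"
    have W: "W \<in> carrier H'.f.R" unfolding W_def using single by (rule free_alg_closed)
    have eq: "wmon w d = scal d * W"
      by (simp add: W_def mult_single)
    show ?case
      using base H'.b_scal_left[OF W] H.b_scal_left[OF hc[OF W]] hc
      unfolding eq free_hom_scal W_def[symmetric] by simp
  qed
  then show ?thesis using y by (simp add: H.b_def H'.b_def H.f_defs H'.f_defs)
qed

text \<open>
  The other sign follows from the symmetry of the form.
\<close>

lemma half_form_contraction:
  assumes "f_form D Bf" "f_form D' Bf'" and \<epsilon>: "\<epsilon> \<in> {1, - 1}"
    and x: "x \<in> carrier (free_alg (idx D'))" and y: "y \<in> carrier (free_alg (idx D'))"
  shows "Bf' (fcls D' x) (fcls D' y) = Bf (fcls D (free_hom (\<psi> \<epsilon>) x)) (fcls D (free_hom (\<psi> (- \<epsilon>)) y))"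
proof (cases "\<epsilon> = 1")
  case True
  then show ?thesis using half_form_contraction_plus[OF assms(1,2) x y] by simp
next
  case False
  interpret H: half_form D Bf using assms(1) by unfold_locales
  interpret D': datum D' by (rule datum_contraction)
  interpret H': half_form D' Bf' using assms(2) by unfold_locales
  have "H'.b x y = H'.b y x" using x y by (rule H'.b_sym)
  moreover have "H.b (free_hom (\<psi> (- 1)) x) (free_hom (\<psi> 1) y) = H.b (free_hom (\<psi> 1) y) (free_hom (\<psi> (- 1)) x)"
    using x y by (intro H.b_sym free_hom_\<psi>_closed)
  moreover have "\<epsilon> = - 1" using False \<epsilon> by simp
  ultimately show ?thesis
    using half_form_contraction_plus[OF assms(1,2) y x] by (simp add: H.b_def H'.b_def H.f_defs H'.f_defs)
qed

end

section \<open>Uniqueness of the form\<close>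

context datum
begin

abbreviation Ew :: "'i list \<Rightarrow> ('i, 'y) qgen free" where "Ew w \<equiv> wmon (map E w) 1"
abbreviation Fw :: "'i list \<Rightarrow> ('i, 'y) qgen free" where "Fw w \<equiv> wmon (map F w) 1"

lemma Ew_Cons: "Ew (i # w) = gen (E i) * Ew w" and Fw_Cons: "Fw (i # w) = gen (F i) * Fw w"
  unfolding list.map by (rule single_Word_Cons)+

lemma word_gens_closed: "w \<in> lists (idx D) \<Longrightarrow> Ew w \<in> carrier U.R" "w \<in> lists (idx D) \<Longrightarrow> Fw w \<in> carrier U.R"
  by (auto intro!: free_alg_closed gen_in_qgens)

text \<open>
  Modulo the relations and the polynomials that kill the idempotent of weight \<open>b\<close>, every element
  is a combination of products of an \<open>E\<close>-word and an \<open>F\<close>-word.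
\<close>

inductive normal :: "'x \<Rightarrow> ('i, 'y) qgen free \<Rightarrow> bool" for b where
  word: "e \<in> lists (idx D) \<Longrightarrow> w \<in> lists (idx D) \<Longrightarrow> normal b (scal c * (Ew e * Fw w))"
| van: "(\<And>a. p \<in> van a b) \<Longrightarrow> normal b p"
| add: "normal b p \<Longrightarrow> normal b q \<Longrightarrow> normal b (p + q)"

lemma normal_closed: "normal b p \<Longrightarrow> p \<in> carrier U.R"
  by (induction rule: normal.induct) (auto intro!: free_alg_closed word_gens_closed dest: van_carrier)

lemma normal_mod: "normal b q \<Longrightarrow> p - q \<in> U.I \<Longrightarrow> normal b p"
  using normal.add[OF normal.van[of "p - q"], of b q] by (simp add: I_van)

lemma normal_scal: "normal b p \<Longrightarrow> normal b (scal c * p)"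
proof (induction rule: normal.induct)
  case (word e w d)
  then show ?case using normal.word[of e w b "c * d"] by (simp add: free.s_assoc)
qed (simp_all add: distrib_left normal.add normal.van van_scal)

lemma gen_van: "g \<in> qgens D \<Longrightarrow> (\<And>a. p \<in> van a b) \<Longrightarrow> gen g * p \<in> van a b"
  using van_mult_left[OF free_alg_closed(4) homogeneous_gen, of g p "a - gdeg D g" b] by simp

lemma normal_E:
  assumes i: "i \<in> idx D"
  shows "normal b p \<Longrightarrow> normal b (gen (E i) * p)"
proof (induction rule: normal.induct)
  case (word e w c)
  have "gen (E i) * (scal c * (Ew e * Fw w)) = scal c * (Ew (i # e) * Fw w)"
    unfolding Ew_Cons by (simp only: free.s_left_comm mult.assoc)
  then show ?case using word i normal.word[of "i # e" w b c] by simp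
qed (simp_all add: distrib_left normal.add normal.van gen_van gen_in_qgens i)

lemma normal_K: "normal b p \<Longrightarrow> normal b (gen (K \<mu>) * p)"
proof (induction rule: normal.induct)
  case (word e w c)
  define t where "t = Ew e * Fw w"
  define d where "d = wdeg D (Word (map E e)) + wdeg D (Word (map F w))"
  have t: "t \<in> carrier U.R" "homogeneous d t"
    using word by (auto simp: t_def d_def intro!: homogeneous_mult homogeneous_single free_alg_closed(7) word_gens_closed)
  let ?d = "v powi pairing D \<mu> d" and ?b = "v powi pairing D \<mu> b"
  have "normal b (scal ?d * (t * (gen (K \<mu>) - scal ?b)))"
    using t by (intro normal_scal normal.van van_K(2))
  moreover have "normal b (scal (?d * ?b) * t)"
    unfolding t_def using word by (intro normal.word)
  ultimately have "normal b (scal ?d * (t * (gen (K \<mu>) - scal ?b)) + scal (?d * ?b) * t)"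
    by (rule normal.add)
  also have "scal ?d * (t * (gen (K \<mu>) - scal ?b)) + scal (?d * ?b) * t = scal ?d * t * gen (K \<mu>)"
    by (simp add: right_diff_distrib scal_commute[of t] free.s_assoc mult.assoc)
  finally have "normal b (gen (K \<mu>) * t)"
    by (rule normal_mod[OF _ K_homogeneous[OF t]])
  then have "normal b (scal c * (gen (K \<mu>) * t))" by (rule normal_scal)
  then show ?case unfolding t_def by (simp only: free.s_left_comm)
qed (simp_all add: distrib_left normal.add normal.van gen_van gen_in_qgens)

text \<open>
  An \<open>F\<close> is moved to the right past the \<open>E\<close>-word; each exchange of \<open>E\<close> and \<open>F\<close> of the same vertex
  leaves terms with one \<open>K\<close>, which have been dealt with.
\<close>

lemma normal_F:
  assumes i: "i \<in> idx D"
  shows "normal b p \<Longrightarrow> normal b (gen (F i) * p)"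
proof (induction rule: normal.induct)
  case (word e w c)
  have "normal b (gen (F i) * (Ew e * Fw w))"
    using word(1)
  proof (induction e rule: list.induct)
    case Nil
    have "gen (F i) * (Ew [] * Fw w) = scal 1 * (Ew [] * Fw (i # w))"
      unfolding Fw_Cons by (simp add: mult_single plus_word_def)
    then show ?case using normal.word[of "[]" "i # w" b 1] word i by (simp only:) simp
  next
    case (Cons j e)
    have j: "j \<in> idx D" and e: "e \<in> lists (idx D)" using Cons.prems by simp_all
    define t where "t = Ew e * Fw w"
    have t: "t \<in> carrier U.R" using e word by (auto simp: t_def intro!: free_alg_closed(7) word_gens_closed)
    define h :: "('i, 'y) qgen free" where "h = (if j = i then scal (1 / (vi D j - inverse (vi D j))) * (gen (Kt D j) - gen (Kt_inv D j)) else 0)"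
    have r: "gen (E j) * gen (F i) - gen (F i) * gen (E j) - h \<in> qrels D"
      unfolding qrels_def h_def using i j by blast
    have IH: "normal b (gen (F i) * t)" using Cons.IH e by (simp add: t_def)
    have nt: "normal b t" using normal.word[OF e word(2), of b 1] by (simp add: t_def)
    have K: "normal b (gen (K \<mu>) * t - gen (K \<nu>) * t)" for \<mu> \<nu>
      using normal.add[OF normal_K[OF nt] normal_scal[OF normal_K[OF nt], of "- 1"], of \<mu> \<nu>]
      by (simp only: free.s_minus free.s_one) simp
    have "normal b (scal (- 1) * (h * t))"
      using normal_scal[OF normal_scal[OF K], of "- 1"] normal.van[OF van_zero, of b] 
      by (auto simp: h_def Kt_kt left_diff_distrib mult.assoc)
    then have "normal b (gen (E j) * (gen (F i) * t) + scal (- 1) * (h * t))"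
      using normal_E[OF j IH] by (intro normal.add)
    moreover have "gen (F i) * (gen (E j) * t) - (gen (E j) * (gen (F i) * t) + scal (- 1) * (h * t)) \<in> U.I"
    proof -
      have "- ((gen (E j) * gen (F i) - gen (F i) * gen (E j) - h) * t) \<in> U.I"
        using U.rels_I[OF r] t by (intro U.I_closed(3) U.I_closed(5))
      then show ?thesis by (simp add: free.s_minus left_diff_distrib mult.assoc algebra_simps)
    qed
    ultimately have "normal b (gen (F i) * (gen (E j) * t))" by (rule normal_mod)
    then show ?case unfolding t_def Ew_Cons by (simp only: mult.assoc)
  qed
  then have "normal b (scal c * (gen (F i) * (Ew e * Fw w)))" by (rule normal_scal)
  then show ?case by (simp only: free.s_left_comm)
qed (simp_all add: distrib_left normal.add normal.van gen_van gen_in_qgens i)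

lemma normal_all: "p \<in> carrier U.R \<Longrightarrow> normal b p"
proof (induction rule: monomial_induct)
  case zero
  show ?case by (rule normal.van) (rule van_zero)
next
  case (single w c)
  then show ?case
  proof (induction w)
    case Nil
    have "wmon [] c = scal c * (Ew [] * Fw [])"
      by (simp add: mult_single plus_word_def)
    then show ?case using normal.word[of "[]" "[]" b c] by (simp only:) simp
  next
    case (Cons g w)
    then have "normal b (gen g * wmon w c)"
      using normal_E normal_F normal_K by (auto simp: qgens_def)
    then show ?case unfolding single_Word_Cons[of g w c] .
  qed
qed (rule normal.add)

text \<open>
  Here \<open>\<Delta>\<close> is the difference of two forms.  The adjunction moves the generators of the first
  argument to the second, which can then be taken in normal form.  Its \<open>E\<close>-word is moved back one
  letter at a time: up to a \<open>K\<close>, which acts by a scalar, \<open>E i\<close> is the image of \<open>F i\<close> under the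
  antihomomorphism \<open>rho\<close>.  What remains are \<open>F\<close>-words in both arguments.
\<close>

lemma form_unique:
  fixes \<Delta> :: "'x \<Rightarrow> 'x \<Rightarrow> ('i, 'y) qgen free \<Rightarrow> ('i, 'y) qgen free \<Rightarrow> Qv"
  assumes add_left: "\<And>a b x x' y. x \<in> carrier U.R \<Longrightarrow> x' \<in> carrier U.R \<Longrightarrow> y \<in> carrier U.R \<Longrightarrow>
      \<Delta> a b (x + x') y = \<Delta> a b x y + \<Delta> a b x' y"
    and add_right: "\<And>a b x y y'. x \<in> carrier U.R \<Longrightarrow> y \<in> carrier U.R \<Longrightarrow> y' \<in> carrier U.R \<Longrightarrow>
      \<Delta> a b x (y + y') = \<Delta> a b x y + \<Delta> a b x y'"
    and scal_left: "\<And>a b c x y. x \<in> carrier U.R \<Longrightarrow> y \<in> carrier U.R \<Longrightarrow> \<Delta> a b (scal c * x) y = c * \<Delta> a b x y"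
    and scal_right: "\<And>a b c x y. x \<in> carrier U.R \<Longrightarrow> y \<in> carrier U.R \<Longrightarrow> \<Delta> a b x (scal c * y) = c * \<Delta> a b x y"
    and van_left: "\<And>a b x y. x \<in> van a b \<Longrightarrow> y \<in> carrier U.R \<Longrightarrow> \<Delta> a b x y = 0"
    and van_right: "\<And>a b x y. x \<in> carrier U.R \<Longrightarrow> y \<in> van a b \<Longrightarrow> \<Delta> a b x y = 0"
    and adjoint: "\<And>a b g x y. g \<in> qgens D \<Longrightarrow> x \<in> carrier U.R \<Longrightarrow> y \<in> carrier U.R \<Longrightarrow>
      \<Delta> (a + gdeg D g) b (gen g * x) y = \<Delta> a b x (rho_gen D g * y)"
    and F_words: "\<And>b w u. w \<in> lists (idx D) \<Longrightarrow> u \<in> lists (idx D) \<Longrightarrow>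
      wdeg D (Word (map F w)) = wdeg D (Word (map F u)) \<Longrightarrow> \<Delta> (b + wdeg D (Word (map F w))) b (Fw w) (Fw u) = 0"
    and x: "x \<in> carrier U.R" and y: "y \<in> carrier U.R"
  shows "\<Delta> a b x y = 0"
proof -
  have EF: "\<Delta> a b (Fw w) (Ew e * Fw u) = 0"
    if "e \<in> lists (idx D)" "w \<in> lists (idx D)" "u \<in> lists (idx D)" for a b e w u
    using that
  proof (induction e arbitrary: a w rule: list.induct)
    case Nil
    have 1: "Ew [] * Fw u = Fw u" by (simp add: mult_single plus_word_def)
    have nonweight: "Fw w \<in> van a b" if "wdeg D (Word (map F w)) \<noteq> a - b" "w \<in> lists (idx D)" for w
      using that by (intro nonweight_van[OF _ homogeneous_single] word_gens_closed)
    show ?case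
    proof (cases "wdeg D (Word (map F w)) = a - b \<and> wdeg D (Word (map F u)) = a - b")
      case True
      then show ?thesis using F_words[of w u b] Nil 1 by simp
    next
      case False
      then show ?thesis
        using van_left[OF nonweight[of w] word_gens_closed(2)] van_right[OF word_gens_closed(2) nonweight[of u]] Nil 1 by auto
    qed
  next
    case (Cons i e)
    have i: "i \<in> idx D" and e: "e \<in> lists (idx D)" using Cons.prems by simp_all
    define t where "t = Ew e * Fw u"
    have t: "t \<in> carrier U.R" using e Cons.prems by (auto simp: t_def intro!: free_alg_closed(7) word_gens_closed)
    have Et: "gen (E i) * t \<in> carrier U.R" using t i by (intro free_alg_closed gen_in_qgens)
    have W: "Fw w \<in> carrier U.R" using Cons.prems by (intro word_gens_closed)
    define \<kappa> where "\<kappa> = v powi pairing D (- kt D i) a"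
    have k: "(gen (K (- kt D i)) - scal \<kappa>) * (gen (E i) * t) \<in> van a b"
      unfolding \<kappa>_def by (rule van_K(1)[OF Et])
    have split: "rho_gen D (F i) * t = scal (vi D i) * ((gen (K (- kt D i)) - scal \<kappa>) * (gen (E i) * t))
        + scal (vi D i * \<kappa>) * (gen (E i) * t)"
      by (simp add: Kt_kt left_diff_distrib right_diff_distrib mult.assoc free.s_assoc)
    have "\<Delta> a b (Fw w) (rho_gen D (F i) * t)
      = \<Delta> a b (Fw w) (scal (vi D i) * ((gen (K (- kt D i)) - scal \<kappa>) * (gen (E i) * t)))
      + \<Delta> a b (Fw w) (scal (vi D i * \<kappa>) * (gen (E i) * t))"
      unfolding split
      by (rule add_right[OF W van_carrier[OF van_scal[OF k]] free_alg_closed(7)[OF free_alg_closed(3) Et]])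
    also have "\<dots> = vi D i * \<kappa> * \<Delta> a b (Fw w) (gen (E i) * t)"
      using van_right[OF W van_scal[OF k]] scal_right[OF W Et] by simp
    finally have "vi D i * \<kappa> * \<Delta> a b (Fw w) (gen (E i) * t) = \<Delta> (a + gdeg D (F i)) b (gen (F i) * Fw w) t"
      using adjoint[OF gen_in_qgens(2)[OF i] W t, of a b] by simp
    also have "gen (F i) * Fw w = Fw (i # w)"
      by (rule Fw_Cons[symmetric])
    also have "\<Delta> (a + gdeg D (F i)) b (Fw (i # w)) t = 0"
      unfolding t_def using Cons.prems i e by (intro Cons.IH) auto
    finally have "\<Delta> a b (Fw w) (gen (E i) * t) = 0"
      by (simp add: \<kappa>_def v_nonzero vi_def)
    then show ?case
      unfolding t_def Ew_Cons by (simp only: mult.assoc)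
  qed
  have one: "Fw [] = 1" by (simp add: zero_word_def flip: single_one)
  have "\<Delta> a b 1 y = 0" if "normal b y" for a b y
    using that
  proof (induction rule: normal.induct)
    case (word e w c)
    have "\<Delta> a b (Fw []) (scal c * (Ew e * Fw w)) = c * \<Delta> a b (Fw []) (Ew e * Fw w)"
      using word by (intro scal_right free_alg_closed(7) word_gens_closed) auto
    then show ?case using EF[of e "[]" w a b] word unfolding one by simp
  next
    case (van p)
    then show ?case by (intro van_right free_alg_closed)
  next
    case (add p q)
    then show ?case using add_right[of 1 p q a b] by (simp add: normal_closed free_alg_closed)
  qed
  then have 1: "\<Delta> a b 1 y = 0" if "y \<in> carrier U.R" for a b y
    using normal_all[OF that] .
  have word: "\<Delta> a b (wmon w 1) y = 0" if "set w \<subseteq> qgens D" "y \<in> carrier U.R" for a b w y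
    using that
  proof (induction w arbitrary: a y)
    case Nil
    then show ?case using 1 by (simp add: zero_word_def[symmetric])
  next
    case (Cons g w)
    have "rho_gen D g * y \<in> carrier U.R"
      using Cons.prems by (cases g) (auto simp: Kt_kt qgens_def intro!: free_alg_closed)
    then show ?case
      using adjoint[of g "wmon w 1" y "a - gdeg D g" b] Cons free_alg_closed(9)[of w "qgens D" 1]
      by (simp only: single_Word_Cons[of g w 1]) simp
  qed
  from x show ?thesis
  proof (induction rule: monomial_induct)
    case zero
    show ?case using van_left[OF van_zero y] .
  next
    case (single w c)
    then show ?case using scal_left[OF free_alg_closed(9)[OF single, of 1] y, of a b c] word[OF single y]
      by (simp add: mult_single)
  qed (simp add: add_left y)
qed

lemma rho_single: "rho D (Poly_Mapping.single w c) = scal c * prod_list (rev (map (rho_gen D) (letters w)))"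
  by (simp add: rho_def free_antihom_word_sum free.word_sum_single)

lemma rho_add: "rho D (x + y) = rho D x + rho D y" and rho_diff: "rho D (x - y) = rho D x - rho D y" and rho_zero: "rho D 0 = 0"
  by (simp_all add: rho_def free_antihom_word_sum free.word_sum_add free.word_sum_diff)

lemma rho_gen_closed: "g \<in> qgens D \<Longrightarrow> rho_gen D g \<in> carrier U.R"
  by (cases g) (auto simp: Kt_kt qgens_def intro!: free_alg_closed)

lemma homogeneous_rho_gen: "homogeneous (- gdeg D g) (rho_gen D g)"
proof -
  have K: "homogeneous 0 (gen (K \<mu>))" for \<mu> using homogeneous_gen[of "K \<mu>"] by simp
  show ?thesis
    using homogeneous_mult[OF homogeneous_scal_mult[OF K] homogeneous_gen[of "F i" for i]]
      homogeneous_mult[OF homogeneous_scal_mult[OF K] homogeneous_gen[of "E i" for i]] K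
    by (cases g) (auto simp: Kt_kt)
qed

lemma rho_closed: "t \<in> carrier U.R \<Longrightarrow> rho D t \<in> carrier U.R"
proof (induction rule: monomial_induct)
  case (single w c)
  then have "prod_list (rev (map (rho_gen D) w)) \<in> carrier U.R"
    by (induction w rule: rev_induct) (auto intro!: free_alg_closed rho_gen_closed)
  then show ?case by (simp add: rho_single free_alg_closed)
qed (simp_all add: rho_add rho_zero free_alg_closed)

lemma homogeneous_rho: "homogeneous d t \<Longrightarrow> homogeneous (- d) (rho D t)"
proof -
  assume d: "homogeneous d t"
  have word: "homogeneous (- wdeg D (Word w)) (prod_list (rev (map (rho_gen D) w)))" for w
  proof (induction w)
    case (Cons g w)
    then show ?case
      using homogeneous_mult[OF Cons homogeneous_rho_gen[of g]] by (simp add: algebra_simps)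
  qed (simp add: homogeneous_one)
  have "homogeneous (- d) (rho D (hpart d t))"
  proof (induction t rule: monomial_induct[OF free_alg_UNIV])
    case (2 w c)
    then show ?case using homogeneous_scal_mult[OF word[of w]]
      by (auto simp: hpart_single rho_single rho_zero homogeneous_zero)
  qed (simp_all add: hpart_add rho_add rho_zero homogeneous_zero homogeneous_add)
  then show ?thesis using d by (simp add: homogeneous_iff)
qed

end

locale dot_datum = datum D for D :: "('i, 'y::ab_group_add, 'x::ab_group_add) rdatum" +
  fixes B
  assumes dot_form: "dot_form D B"
begin

lemma
  assumes "x \<in> carrier (Udot D)" "x' \<in> carrier (Udot D)" "y \<in> carrier (Udot D)"
  shows B_add_left: "B (x \<otimes>\<^bsub>Udot D\<^esub> x') y = B x y + B x' y"
    and B_add_right: "B y (x \<otimes>\<^bsub>Udot D\<^esub> x') = B y x + B y x'"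
  using dot_form assms unfolding dot_form_def by blast+

lemma dscale_\<pi>: "p \<in> carrier U.R \<Longrightarrow> dscale D c (\<pi> a b p) = \<pi> a b (scal c * p)"
  using lact_\<pi>[OF free_alg_closed(3) homogeneous_scal, of p c a b] by (simp add: dscale_def U_defs)

lemma
  assumes "p \<in> carrier U.R" "y \<in> carrier (Udot D)"
  shows B_scal_left: "B (\<pi> a b (scal c * p)) y = c * B (\<pi> a b p) y"
    and B_scal_right: "B y (\<pi> a b (scal c * p)) = c * B y (\<pi> a b p)"
proof -
  have "\<forall>c. \<forall>x\<in>carrier (Udot D). \<forall>y\<in>carrier (Udot D).
      B (dscale D c x) y = c * B x y \<and> B x (dscale D c y) = c * B x y"
    using dot_form unfolding dot_form_def by blast
  then show "B (\<pi> a b (scal c * p)) y = c * B (\<pi> a b p) y" "B y (\<pi> a b (scal c * p)) = c * B y (\<pi> a b p)"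
    using assms \<pi>_closed[OF assms(1), of a b] dscale_\<pi>[OF assms(1)] by metis+
qed

lemma B_zero: "y \<in> carrier (Udot D) \<Longrightarrow> B (\<pi> a b 0) y = 0" "y \<in> carrier (Udot D) \<Longrightarrow> B y (\<pi> a b 0) = 0"
  using B_scal_left[of 0 y a b 0] B_scal_right[of 0 y a b 0] by (simp_all add: free_alg_closed)

lemma B_orthogonal:
  assumes p: "p \<in> carrier U.R" and q: "q \<in> carrier U.R" and ab: "\<not> (a = a' \<and> b = b')"
  shows "B (\<pi> a b p) (\<pi> a' b' q) = 0"
proof -
  have "\<forall>u\<in>carrier (UQ D). \<forall>u'\<in>carrier (UQ D). \<forall>a b a' b'. \<not> (a = a' \<and> b = b') \<longrightarrow>
        B (dmult D (ract D (idem D a) u) (idem D b)) (dmult D (ract D (idem D a') u') (idem D b')) = 0"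
    using dot_form unfolding dot_form_def by blast
  then have "B (dmult D (ract D (idem D a) (U.cls p)) (idem D b)) (dmult D (ract D (idem D a') (U.cls q)) (idem D b')) = 0"
    using ab U.cls_closed[OF p] U.cls_closed[OF q] unfolding U_defs by blast
  then show ?thesis by (simp only: sandwich[OF p] sandwich[OF q])
qed

lemma B_adjoint:
  assumes t: "t \<in> carrier U.R" "homogeneous d t" and p: "p \<in> carrier U.R" and q: "q \<in> carrier U.R"
  shows "B (\<pi> (a + d) b (t * p)) (\<pi> (a + d) b q) = B (\<pi> a b p) (\<pi> a b (rho D t * q))"
proof -
  have "\<forall>p\<in>carrier (free_alg (qgens D)). \<forall>x\<in>carrier (Udot D). \<forall>y\<in>carrier (Udot D).
        B (lact D (ucls D p) x) y = B x (lact D (ucls D (rho D p)) y)"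
    using dot_form unfolding dot_form_def by blast
  then have "B (lact D (U.cls t) (\<pi> a b p)) (\<pi> (a + d) b q) = B (\<pi> a b p) (lact D (U.cls (rho D t)) (\<pi> (a + d) b q))"
    using t(1) \<pi>_closed[OF p] \<pi>_closed[OF q] unfolding U_defs by blast
  then show ?thesis
    using lact_\<pi>[OF t p] lact_\<pi>[OF rho_closed[OF t(1)] homogeneous_rho[OF t(2)] q, of "a + d" b] by simp
qed

lemma B_half:
  obtains Bf where "f_form D Bf"
    and "\<And>p q d b. p \<in> carrier (free_alg (idx D)) \<Longrightarrow> q \<in> carrier (free_alg (idx D)) \<Longrightarrow>
      homogeneous d (minus_emb p) \<Longrightarrow> homogeneous d (minus_emb q) \<Longrightarrow>
      B (\<pi> (b + d) b (minus_emb p)) (\<pi> (b + d) b (minus_emb q)) = Bf (fcls D p) (fcls D q)"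
proof -
  obtain Bf where Bf: "f_form D Bf" "\<forall>p\<in>carrier (free_alg (idx D)). \<forall>q\<in>carrier (free_alg (idx D)). \<forall>l.
           B (lact D (ucls D (minus_emb p)) (idem D l)) (lact D (ucls D (minus_emb q)) (idem D l))
             = Bf (fcls D p) (fcls D q)"
    using dot_form unfolding dot_form_def by blast
  show ?thesis
  proof (rule that[OF Bf(1)])
    fix p q :: "'i free" and d b
    assume p: "p \<in> carrier (free_alg (idx D))" and q: "q \<in> carrier (free_alg (idx D))"
      and d: "homogeneous d (minus_emb p)" "homogeneous d (minus_emb q)"
    have c: "minus_emb r \<in> carrier U.R" if "r \<in> carrier (free_alg (idx D))" for r
      unfolding minus_emb_def using that by (rule free_hom_closed) (intro free_alg_closed gen_in_qgens)
    have "lact D (U.cls (minus_emb r)) (idem D b) = \<pi> (b + d) b (minus_emb r)"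
      if "r \<in> carrier (free_alg (idx D))" "homogeneous d (minus_emb r)" for r
      using lact_\<pi>[OF c[OF that(1)] that(2) free_alg_closed(2), of b b] by (simp add: idem_\<pi>)
    then show "B (\<pi> (b + d) b (minus_emb p)) (\<pi> (b + d) b (minus_emb q)) = Bf (fcls D p) (fcls D q)"
      using Bf(2) p q d unfolding U_defs by metis
  qed
qed

end

section \<open>The embedding of the contracted quantum group\<close>

context contraction_datum
begin

sublocale D': datum D'
  by (rule datum_contraction)

abbreviation \<Psi> :: "int \<Rightarrow> ('i option, 'y) qgen free \<Rightarrow> ('i, 'y) qgen free" where
  "\<Psi> \<epsilon> \<equiv> free_hom (Psi_gen D p m \<epsilon>)"

lemma \<Psi>_simps: "\<Psi> \<epsilon> (x + y) = \<Psi> \<epsilon> x + \<Psi> \<epsilon> y" "\<Psi> \<epsilon> (x - y) = \<Psi> \<epsilon> x - \<Psi> \<epsilon> y" "\<Psi> \<epsilon> (x * y) = \<Psi> \<epsilon> x * \<Psi> \<epsilon> y"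
  "\<Psi> \<epsilon> (scal c) = scal c" "\<Psi> \<epsilon> (gen g) = Psi_gen D p m \<epsilon> g" "\<Psi> \<epsilon> 0 = 0" "\<Psi> \<epsilon> (- x) = - \<Psi> \<epsilon> x" "\<Psi> \<epsilon> 1 = 1"
  by (simp_all only: free_hom_evl free.evl_simps)

lemma Psi_gen_closed: "g \<in> qgens D' \<Longrightarrow> Psi_gen D p m \<epsilon> g \<in> carrier U.R"
  using pm(1,2) by (auto simp: qgens_def intro!: free_alg_closed)

lemma \<Psi>_closed: "x \<in> carrier D'.U.R \<Longrightarrow> \<Psi> \<epsilon> x \<in> carrier U.R"
  by (erule free_hom_closed) (rule Psi_gen_closed)

lemma homogeneous_Psi_gen: "homogeneous (gdeg D' g) (Psi_gen D p m \<epsilon> g)"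
proof -
  have EE: "homogeneous (root D i + root D j) (gen (E i) * gen (E j))" for i j
    using homogeneous_mult[OF homogeneous_gen[of "E i"] homogeneous_gen[of "E j"]] by simp
  have FF: "homogeneous (- root D i - root D j) (gen (F i) * gen (F j))" for i j
    using homogeneous_mult[OF homogeneous_gen[of "F i"] homogeneous_gen[of "F j"]] by simp
  have 1: "homogeneous (root D p + root D m) (Psi_gen D p m \<epsilon> (E None))"
    using homogeneous_diff[OF EE[of p m] homogeneous_scal_mult[OF EE[of m p, unfolded add.commute[of "root D m"]]]]
    by (simp add: mult.assoc)
  have "- root D p - root D m = - root D m - root D p" by simp
  with FF[of p m] have "homogeneous (- root D m - root D p) (gen (F p) * gen (F m))" by (simp only:)
  from homogeneous_diff[OF FF[of m p] homogeneous_scal_mult[OF this]]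
  have 2: "homogeneous (- root D m - root D p) (Psi_gen D p m \<epsilon> (F None))"
    by (simp add: mult.assoc)
  show ?thesis
  proof (cases g)
    case (E k)
    then show ?thesis using 1 homogeneous_gen[of "E i" for i] by (cases k) auto
  next
    case (F k)
    then show ?thesis using 2 homogeneous_gen[of "F i" for i] by (cases k) (auto simp: algebra_simps)
  next
    case (K \<mu>)
    then show ?thesis using homogeneous_gen[of "K \<mu>"] by auto
  qed
qed

lemma homogeneous_\<Psi>_word: "homogeneous (wdeg D' (Word w)) (\<Psi> \<epsilon> (wmon w 1))"
proof (induction w)
  case Nil
  then show ?case using homogeneous_one by (simp add: \<Psi>_simps(8) flip: zero_word_def)
next
  case (Cons g w)
  then show ?case
    unfolding single_Word_Cons[of g w 1] \<Psi>_simps using homogeneous_mult[OF homogeneous_Psi_gen Cons] by simp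
qed

text \<open>
  The images of the generators satisfy the relations in every ring in which those of \<open>D\<close> hold, hence
  in the quantum group.
\<close>

lemma \<Psi>_ideal:
  assumes \<epsilon>: "\<epsilon> \<in> {1, - 1}" and x: "x \<in> D'.U.I"
  shows "\<Psi> \<epsilon> x \<in> U.I"
  using x
proof (induction rule: D'.U.I_induct)
  case (rel r)
  show ?case
  proof (rule qideal_membership)
    show "\<Psi> \<epsilon> r \<in> carrier U.R" using rel qrels_carrier by (blast intro: \<Psi>_closed)
    fix s :: "Qv \<Rightarrow> ('i, 'y) qgen quotients" and X
    assume s: "central_scalars s" and "quantum_rep D s (\<lambda>i. X (E i)) (\<lambda>i. X (F i)) (\<lambda>\<mu>. X (K \<mu>))"
    then interpret contraction_rep D s "\<lambda>i. X (E i)" "\<lambda>i. X (F i)" "\<lambda>\<mu>. X (K \<mu>)" p m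
      using contraction_datum_axioms by (simp add: contraction_rep_def)
    define Y where "Y = evl s X \<circ> Psi_gen D p m \<epsilon>"
    have "quantum_rep D' s (\<lambda>k. Y (E k)) (\<lambda>k. Y (F k)) (\<lambda>\<mu>. X (K \<mu>))"
      by (rule quantum_rep_contraction[OF \<epsilon>]) (simp_all add: Y_def evl_simps scl_def mult.assoc)
    moreover have "(\<lambda>\<mu>. X (K \<mu>)) = (\<lambda>\<mu>. Y (K \<mu>))" by (simp add: Y_def evl_simps)
    ultimately have "\<forall>r\<in>qrels D'. evl s Y r = 0"
      using quantum_rep_iff[OF datum_contraction s, of Y] by simp
    then show "evl s X (\<Psi> \<epsilon> r) = 0"
      using rel by (simp add: evl_free_hom Y_def)
  qed
qed (simp_all add: \<Psi>_simps U.I_closed(1,2,4) U.I_closed(5) \<Psi>_closed)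

lemma \<Psi>_van:
  assumes \<epsilon>: "\<epsilon> \<in> {1, - 1}" and x: "x \<in> D'.van a b"
  shows "\<Psi> \<epsilon> x \<in> van a b"
  using x
proof (induction rule: D'.van_induct)
  case (ideal x)
  then show ?case by (intro I_van \<Psi>_ideal[OF \<epsilon>])
next
  case (left \<mu> x)
  then show ?case using van_K(1)[OF \<Psi>_closed[OF left]] by (simp add: \<Psi>_simps)
next
  case (right \<mu> x)
  then show ?case using van_K(2)[OF \<Psi>_closed[OF right]] by (simp add: \<Psi>_simps)
qed (simp_all add: \<Psi>_simps van_add van_uminus)

lemma Psi_dot_coset:
  assumes \<epsilon>: "\<epsilon> \<in> {1, - 1}" and x: "x \<in> carrier D'.U.R" and u: "u (a, b) = D'.coset a b x"
  shows "Psi_dot D p m \<epsilon> u (a, b) = coset a b (\<Psi> \<epsilon> x)"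
proof -
  obtain x' where x': "x' \<in> carrier D'.U.R" "rep (u (a, b)) = D'.U.cls x'" "x' - x \<in> D'.van a b"
    using D'.rep_coset[OF x] u by metis
  define r where "r = rep (D'.U.cls x')"
  have r: "r \<in> carrier D'.U.R" "D'.U.cls r = D'.U.cls x'"
    unfolding r_def using D'.U.rep_cls[OF x'(1)] by blast+
  then have "r - x' \<in> D'.U.I" using D'.U.cls_eq_iff x' by blast
  then have "\<Psi> \<epsilon> ((r - x') + (x' - x)) \<in> van a b"
    by (intro \<Psi>_van[OF \<epsilon>] D'.van_add[OF D'.I_van x'(3)])
  then have "\<Psi> \<epsilon> r - \<Psi> \<epsilon> x \<in> van a b" by (simp add: \<Psi>_simps)
  then show ?thesis
    using r(1) x by (simp add: Psi_dot_def Psi_def x' U_defs r_def[symmetric] coset_eq_iff \<Psi>_closed)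
qed

lemma Psi_dot_\<pi>:
  assumes \<epsilon>: "\<epsilon> \<in> {1, - 1}" and x: "x \<in> carrier D'.U.R"
  shows "Psi_dot D p m \<epsilon> (D'.\<pi> a b x) = \<pi> a b (\<Psi> \<epsilon> x)"
proof
  fix ab' :: "'x \<times> 'x"
  obtain a' b' where ab': "ab' = (a', b')" by (cases ab')
  show "Psi_dot D p m \<epsilon> (D'.\<pi> a b x) ab' = \<pi> a b (\<Psi> \<epsilon> x) ab'"
    using Psi_dot_coset[OF \<epsilon> x, of "D'.\<pi> a b x" a b] Psi_dot_coset[OF \<epsilon> free_alg_closed(1), of "D'.\<pi> a b x" a' b']
    by (auto simp: ab' \<pi>_apply D'.\<pi>_apply D'.coset_zero coset_zero \<Psi>_simps)
qed

lemma Psi_dot_closed: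
  assumes \<epsilon>: "\<epsilon> \<in> {1, - 1}" and u: "u \<in> carrier (Udot D')"
  shows "Psi_dot D p m \<epsilon> u \<in> carrier (Udot D)"
proof -
  have "\<exists>x\<in>carrier U.R. Psi_dot D p m \<epsilon> u (a, b) = coset a b x" for a b
  proof -
    obtain x where "x \<in> carrier D'.U.R" "u (a, b) = D'.coset a b x"
      using u unfolding D'.carrier_Udot by blast
    then show ?thesis using Psi_dot_coset[OF \<epsilon>] \<Psi>_closed by blast
  qed
  moreover have "{(a, b). Psi_dot D p m \<epsilon> u (a, b) \<noteq> wt_rel D a b} \<subseteq> {(a, b). u (a, b) \<noteq> wt_rel D' a b}"
  proof clarify
    fix a b assume "Psi_dot D p m \<epsilon> u (a, b) \<noteq> wt_rel D a b" "u (a, b) = wt_rel D' a b"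
    then show False
      using Psi_dot_coset[OF \<epsilon> free_alg_closed(1), of u a b] by (simp add: D'.coset_zero coset_zero \<Psi>_simps)
  qed
  then have "finite {(a, b). Psi_dot D p m \<epsilon> u (a, b) \<noteq> wt_rel D a b}"
    using u by (auto simp: D'.carrier_Udot intro: finite_subset)
  ultimately show ?thesis by (simp add: carrier_Udot)
qed

lemma Psi_dot_add:
  assumes \<epsilon>: "\<epsilon> \<in> {1, - 1}" and u: "u \<in> carrier (Udot D')" "u' \<in> carrier (Udot D')"
  shows "Psi_dot D p m \<epsilon> (u \<otimes>\<^bsub>Udot D'\<^esub> u') = Psi_dot D p m \<epsilon> u \<otimes>\<^bsub>Udot D\<^esub> Psi_dot D p m \<epsilon> u'"
proof
  fix ab :: "'x \<times> 'x"
  obtain a b where ab: "ab = (a, b)" by (cases ab)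
  obtain x x' where x: "x \<in> carrier D'.U.R" "u (a, b) = D'.coset a b x" "x' \<in> carrier D'.U.R" "u' (a, b) = D'.coset a b x'"
    using u unfolding D'.carrier_Udot by blast
  have "(u \<otimes>\<^bsub>Udot D'\<^esub> u') (a, b) = D'.coset a b (x + x')"
    using x by (simp add: D'.Udot_add D'.coset_add)
  then show "Psi_dot D p m \<epsilon> (u \<otimes>\<^bsub>Udot D'\<^esub> u') ab = (Psi_dot D p m \<epsilon> u \<otimes>\<^bsub>Udot D\<^esub> Psi_dot D p m \<epsilon> u') ab"
    using Psi_dot_coset[OF \<epsilon>, of "x + x'" "u \<otimes>\<^bsub>Udot D'\<^esub> u'" a b] Psi_dot_coset[OF \<epsilon> x(1), of u a b] Psi_dot_coset[OF \<epsilon> x(3), of u' a b] x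
    by (simp add: ab Udot_add coset_add \<Psi>_closed \<Psi>_simps free_alg_closed)
qed

text \<open>
  The antihomomorphism reverses the two products in the image of the new generator, and the powers of
  \<open>v\<close> from collecting the \<open>K\<close>'s are the same for both products.  The result has the twist with
  the opposite sign, which is why the two arguments of the form are mapped with opposite signs.
\<close>

lemma rho_\<Psi>:
  assumes g: "g \<in> qgens D'"
  shows "rho D (Psi_gen D p m \<epsilon> g) - \<Psi> (- \<epsilon>) (rho_gen D' g) \<in> U.I"
proof (rule qideal_membership)
  show "rho D (Psi_gen D p m \<epsilon> g) - \<Psi> (- \<epsilon>) (rho_gen D' g) \<in> carrier U.R"
    using g by (intro free_alg_closed rho_closed \<Psi>_closed Psi_gen_closed D'.rho_gen_closed)
  fix s :: "Qv \<Rightarrow> ('i, 'y) qgen quotients" and X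
  assume s: "central_scalars s" and "quantum_rep D s (\<lambda>i. X (E i)) (\<lambda>i. X (F i)) (\<lambda>\<mu>. X (K \<mu>))"
  then interpret contraction_rep D s "\<lambda>i. X (E i)" "\<lambda>i. X (F i)" "\<lambda>\<mu>. X (K \<mu>)" p m
    using contraction_datum_axioms by (simp add: contraction_rep_def)
  have rho1: "rho D (gen h) = rho_gen D h" for h
    by (simp add: rho_single)
  have rho2: "rho D (gen h * gen h') = rho_gen D h' * rho_gen D h" for h h'
    by (simp add: rho_single mult_single)
  have rho2': "rho D (scal c * gen h * gen h') = scal c * (rho_gen D h' * rho_gen D h)" for c h h'
    by (simp add: rho_single mult_single)
  note simps = evl_simps Kt_kt k_add[symmetric] scl_def[symmetric]
  show "evl s X (rho D (Psi_gen D p m \<epsilon> g) - \<Psi> (- \<epsilon>) (rho_gen D' g)) = 0"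
  proof (cases g)
    case (E k)
    show ?thesis
    proof (cases k)
      case None
      define c where "c = q powi (- \<epsilon>)"
      have "evl s X (rho D (Psi_gen D p m \<epsilon> g))
          = scl q (X (K (kt D m)) * X (F m)) * scl q (X (K (kt D p)) * X (F p))
          - scl c (scl q (X (K (kt D p)) * X (F p)) * scl q (X (K (kt D m)) * X (F m)))"
        by (simp only: E None Psi_gen.simps rho_diff rho2 rho2' rho_gen.simps contraction_vi c_def vi_pm)
          (simp add: evl_simps Kt_kt mult_ac flip: scl_def)
      also have "\<dots> = scl q (X (K (kt D p)) * X (K (kt D m)) * (X (F m) * X (F p) - scl c (X (F p) * X (F m))))"
        by (simp add: r.comm_rules right_diff_distrib scl_right mult_ac)
      also have "\<dots> = evl s X (\<Psi> (- \<epsilon>) (rho_gen D' g))"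
        by (simp only: E None rho_gen.simps \<Psi>_simps Psi_gen.simps Kt_kt contraction_vi contraction_kt c_def)
          (simp add: evl_simps k_add mult.assoc minus_diff_commute[of "kt D m"] flip: scl_def)
      finally show ?thesis by (simp add: evl_diff)
    qed (simp add: E rho1 \<Psi>_simps Kt_kt)
  next
    case (F k)
    show ?thesis
    proof (cases k)
      case None
      define c where "c = q powi \<epsilon>"
      have "evl s X (rho D (Psi_gen D p m \<epsilon> g))
          = scl q (X (K (- kt D p)) * X (E p)) * scl q (X (K (- kt D m)) * X (E m))
          - scl c (scl q (X (K (- kt D m)) * X (E m)) * scl q (X (K (- kt D p)) * X (E p)))"
        by (simp only: F None Psi_gen.simps rho_diff rho2 rho2' rho_gen.simps contraction_vi c_def vi_pm)
          (simp add: evl_simps Kt_kt mult_ac flip: scl_def)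
      also have "\<dots> = scl q (X (K (- kt D m)) * X (K (- kt D p)) * (X (E p) * X (E m) - scl c (X (E m) * X (E p))))"
        by (simp add: r.comm_rules right_diff_distrib scl_right mult_ac)
      also have "\<dots> = evl s X (\<Psi> (- \<epsilon>) (rho_gen D' g))"
        by (simp only: F None rho_gen.simps \<Psi>_simps Psi_gen.simps Kt_kt contraction_vi contraction_kt c_def)
          (simp add: evl_simps k_add mult.assoc minus_diff_commute[of "kt D m"] flip: scl_def)
      finally show ?thesis by (simp add: evl_diff)
    qed (simp add: F rho1 \<Psi>_simps Kt_kt)
  next
    case (K \<mu>)
    then show ?thesis by (simp add: rho1 \<Psi>_simps)
  qed
qed

lemma \<Psi>_minus_emb: "\<Psi> \<epsilon> (minus_emb x) = minus_emb (free_hom (\<psi> \<epsilon>) x)"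
proof -
  have "evl scal (Psi_gen D p m \<epsilon>) \<circ> (\<lambda>k. gen (F k)) = evl scal (\<lambda>i. gen (F i)) \<circ> \<psi> \<epsilon>"
  proof
    fix k
    show "(evl scal (Psi_gen D p m \<epsilon>) \<circ> (\<lambda>k. gen (F k))) k = (evl scal (\<lambda>i. gen (F i)) \<circ> \<psi> \<epsilon>) k"
      by (cases k) (simp_all only: comp_def \<psi>_def option.case free.evl_simps Psi_gen.simps contraction_vi)
  qed
  then show ?thesis
    unfolding minus_emb_def free_hom_evl
    using free.evl_free_hom[of "Psi_gen D p m \<epsilon>" "\<lambda>k. gen (F k)" x] free.evl_free_hom[of "\<lambda>i. gen (F i) :: ('i, 'y) qgen free" "\<psi> \<epsilon>" x]
    by (simp add: free_hom_evl)
qed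

text \<open>
  Pulling the form back along the two embeddings gives a form with the same adjunction and the same
  values on \<open>F\<close>-words.
\<close>

theorem form_contraction:
  assumes B: "dot_form D B" and Bhat: "dot_form D' Bhat" and \<epsilon>: "\<epsilon> \<in> {1, - 1}"
    and x: "x \<in> carrier D'.U.R" and y: "y \<in> carrier D'.U.R"
  shows "Bhat (D'.\<pi> a b x) (D'.\<pi> a b y) = B (\<pi> a b (\<Psi> \<epsilon> x)) (\<pi> a b (\<Psi> (- \<epsilon>) y))"
proof -
  interpret B: dot_datum D B using B by unfold_locales
  interpret H: dot_datum D' Bhat using Bhat by unfold_locales
  have \<epsilon>': "- \<epsilon> \<in> {1, - 1}" using \<epsilon> by auto
  obtain Bf where Bf: "f_form D Bf" "\<And>p q d b. p \<in> carrier (free_alg (idx D)) \<Longrightarrow> q \<in> carrier (free_alg (idx D)) \<Longrightarrow>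
      homogeneous d (minus_emb p) \<Longrightarrow> homogeneous d (minus_emb q) \<Longrightarrow>
      B (\<pi> (b + d) b (minus_emb p)) (\<pi> (b + d) b (minus_emb q)) = Bf (fcls D p) (fcls D q)"
    using B.B_half by blast
  obtain Bf' where Bf': "f_form D' Bf'" "\<And>p q d b. p \<in> carrier (free_alg (idx D')) \<Longrightarrow> q \<in> carrier (free_alg (idx D')) \<Longrightarrow>
      D'.homogeneous d (minus_emb p) \<Longrightarrow> D'.homogeneous d (minus_emb q) \<Longrightarrow>
      Bhat (D'.\<pi> (b + d) b (minus_emb p)) (D'.\<pi> (b + d) b (minus_emb q)) = Bf' (fcls D' p) (fcls D' q)"
    using H.B_half by blast
  define G where "G = (\<lambda>a b x y. B (\<pi> a b (\<Psi> \<epsilon> x)) (\<pi> a b (\<Psi> (- \<epsilon>) y)))"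
  define G' where "G' = (\<lambda>a b x y. Bhat (D'.\<pi> a b x) (D'.\<pi> a b y))"
  note c = \<Psi>_closed \<pi>_closed D'.\<pi>_closed free_alg_closed
  have van: "\<pi> a b (\<Psi> \<epsilon> x) = \<pi> a b 0" "D'.\<pi> a b x = D'.\<pi> a b 0"
    if "\<epsilon> \<in> {1, - 1}" "x \<in> D'.van a b" for \<epsilon> a b x
    using \<Psi>_van[OF that] that(2) by (auto intro!: \<pi>_eq D'.\<pi>_eq simp: van_carrier D'.van_carrier free_alg_closed)
  have minus_emb_word: "minus_emb (wmon w 1) = D'.Fw w" for w
  proof (induction w)
    case (Cons k w)
    show ?case
      unfolding minus_emb_def free_hom_Cons[of _ k w] Cons[unfolded minus_emb_def]
      by (simp add: mult_single plus_word_def)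
  qed (simp add: minus_emb_def free_hom_evl free.evl_one flip: zero_word_def)
  have "G' a b x y - G a b x y = 0"
  proof (rule D'.form_unique[where \<Delta> = "\<lambda>a b x y. G' a b x y - G a b x y"])
    fix a b x x' y assume "x \<in> carrier D'.U.R" "x' \<in> carrier D'.U.R" "y \<in> carrier D'.U.R"
    then show "G' a b (x + x') y - G a b (x + x') y = G' a b x y - G a b x y + (G' a b x' y - G a b x' y)"
      "G' a b y (x + x') - G a b y (x + x') = G' a b y x - G a b y x + (G' a b y x' - G a b y x')"
      by (simp_all add: G_def G'_def \<Psi>_simps \<pi>_add[symmetric] D'.\<pi>_add[symmetric] c
          B.B_add_left H.B_add_left B.B_add_right H.B_add_right)
  next
    fix a b d x y assume "x \<in> carrier D'.U.R" "y \<in> carrier D'.U.R"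
    then show "G' a b (scal d * x) y - G a b (scal d * x) y = d * (G' a b x y - G a b x y)"
      "G' a b x (scal d * y) - G a b x (scal d * y) = d * (G' a b x y - G a b x y)"
      by (simp_all add: G_def G'_def \<Psi>_simps B.B_scal_left B.B_scal_right H.B_scal_left H.B_scal_right c right_diff_distrib)
  next
    fix a b x y assume "x \<in> D'.van a b" "y \<in> carrier D'.U.R"
    then show "G' a b x y - G a b x y = 0" "G' a b y x - G a b y x = 0"
      using van(1)[OF \<epsilon>] van(1)[OF \<epsilon>'] van(2)[OF \<epsilon>]
      by (simp_all add: G_def G'_def B.B_zero H.B_zero c)
  next
    fix a b g x y assume g: "g \<in> qgens D'" and x: "x \<in> carrier D'.U.R" and y: "y \<in> carrier D'.U.R"
    have "G' (a + gdeg D' g) b (gen g * x) y = G' a b x (rho_gen D' g * y)"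
      using H.B_adjoint[OF free_alg_closed(4)[OF g] D'.homogeneous_gen x y, of a b]
      by (simp add: G'_def D'.rho_single)
    moreover have "G (a + gdeg D' g) b (gen g * x) y = G a b x (rho_gen D' g * y)"
    proof -
      have 1: "Psi_gen D p m \<epsilon> g \<in> carrier U.R" using g by (rule Psi_gen_closed)
      have 2: "\<Psi> (- \<epsilon>) (rho_gen D' g) \<in> carrier U.R" using g by (intro \<Psi>_closed D'.rho_gen_closed)
      have "(rho D (Psi_gen D p m \<epsilon> g) - \<Psi> (- \<epsilon>) (rho_gen D' g)) * \<Psi> (- \<epsilon>) y \<in> van a b"
        using rho_\<Psi>[OF g] y by (intro I_van U.I_closed(5) \<Psi>_closed)
      then have "\<pi> a b (rho D (Psi_gen D p m \<epsilon> g) * \<Psi> (- \<epsilon>) y) = \<pi> a b (\<Psi> (- \<epsilon>) (rho_gen D' g) * \<Psi> (- \<epsilon>) y)"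
        using 1 D'.rho_gen_closed[OF g] y by (intro \<pi>_eq free_alg_closed(7) rho_closed \<Psi>_closed) (auto simp: left_diff_distrib)
      then show ?thesis
        using B.B_adjoint[OF 1 homogeneous_Psi_gen \<Psi>_closed[OF x] \<Psi>_closed[OF y], of a b]
        by (simp add: G_def \<Psi>_simps)
    qed
    ultimately show "G' (a + gdeg D' g) b (gen g * x) y - G (a + gdeg D' g) b (gen g * x) y
        = G' a b x (rho_gen D' g * y) - G a b x (rho_gen D' g * y)" by simp
  next
    fix b w u
    assume w: "w \<in> lists (idx D')" and u: "u \<in> lists (idx D')"
      and deg: "wdeg D' (Word (map F w)) = wdeg D' (Word (map F u))"
    define d where "d = wdeg D' (Word (map F w))"
    let ?w = "wmon w 1 :: 'i option free" and ?u = "wmon u 1 :: 'i option free"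
    have wu: "?w \<in> carrier (free_alg (idx D'))" "?u \<in> carrier (free_alg (idx D'))"
      using w u by (auto intro!: free_alg_closed(9))
    have "G' (b + d) b (D'.Fw w) (D'.Fw u) = Bf' (fcls D' ?w) (fcls D' ?u)"
      using Bf'(2)[OF wu, of d b] D'.homogeneous_single[of "Word (map F w)" 1] D'.homogeneous_single[of "Word (map F u)" 1] deg
      by (simp add: G'_def minus_emb_word d_def)
    also have "\<dots> = Bf (fcls D (free_hom (\<psi> \<epsilon>) ?w)) (fcls D (free_hom (\<psi> (- \<epsilon>)) ?u))"
      by (rule half_form_contraction[OF Bf(1) Bf'(1) \<epsilon> wu])
    also have "\<dots> = G (b + d) b (D'.Fw w) (D'.Fw u)"
      using Bf(2)[OF free_hom_\<psi>_closed[OF wu(1)] free_hom_\<psi>_closed[OF wu(2)], of d \<epsilon> "- \<epsilon>" b]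
        homogeneous_\<Psi>_word[of "map F w" \<epsilon>] homogeneous_\<Psi>_word[of "map F u" "- \<epsilon>"] deg
      by (simp add: G_def d_def \<Psi>_minus_emb[symmetric] minus_emb_word)
    finally show "G' (b + wdeg D' (Word (map F w))) b (D'.Fw w) (D'.Fw u)
       - G (b + wdeg D' (Word (map F w))) b (D'.Fw w) (D'.Fw u) = 0"
      by (simp add: d_def)
  qed (use x y in auto)
  then show ?thesis by (simp add: G_def G'_def)
qed

end

theorem proposition4p6p1:
  fixes D :: "('i, 'y::ab_group_add, 'x::ab_group_add) rdatum"
    and ip im :: 'i
    and \<epsilon> :: int
    and B :: "('i, 'y, 'x) dot_elt \<Rightarrow> ('i, 'y, 'x) dot_elt \<Rightarrow> Qv"
    and Bhat :: "('i option, 'y, 'x) dot_elt \<Rightarrow> ('i option, 'y, 'x) dot_elt \<Rightarrow> Qv"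
  assumes "root_datum D"
    and "ip \<in> idx D" and "im \<in> idx D"
    and "dot D ip ip = dot D im im" and "dot D im im = - 2 * dot D ip im"
    and "dot_form D B"
    and "dot_form (contraction D ip im) Bhat"
    and "\<epsilon> \<in> {1, -1}"
    and "x \<in> carrier (Udot (contraction D ip im))"
    and "y \<in> carrier (Udot (contraction D ip im))"
  shows "Bhat x y = B (Psi_dot D ip im \<epsilon> x) (Psi_dot D ip im (- \<epsilon>) y)"
proof -
  interpret contraction_datum D ip im
    using root_datum_datum[OF assms(1)] assms(2-5) by (intro contraction_datum.intro contraction_datum_axioms.intro)
  interpret B: dot_datum D B using assms(6) by unfold_locales
  interpret H: dot_datum D' Bhat using assms(7) by unfold_locales
  have \<epsilon>: "\<epsilon> \<in> {1, - 1}" "- \<epsilon> \<in> {1, - 1}" using assms(8) by auto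
  note c = Psi_dot_closed[OF \<epsilon>(1)] Psi_dot_closed[OF \<epsilon>(2)] \<pi>_closed D'.\<pi>_closed \<Psi>_closed free_alg_closed(1)
  note psi = Psi_dot_\<pi>[OF \<epsilon>(1)] Psi_dot_\<pi>[OF \<epsilon>(2)] Psi_dot_add[OF \<epsilon>(1)] Psi_dot_add[OF \<epsilon>(2)]
  from assms(9) show ?thesis
  proof (induction x rule: D'.Udot_induct)
    case zero
    show ?case using assms(10) by (simp add: psi c H.B_zero B.B_zero \<Psi>_simps)
  next
    case (add x a b t)
    have "Bhat (D'.\<pi> a b t) y = B (Psi_dot D ip im \<epsilon> (D'.\<pi> a b t)) (Psi_dot D ip im (- \<epsilon>) y)"
      using assms(10)
    proof (induction y rule: D'.Udot_induct)
      case zero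
      show ?case using add by (simp add: psi c H.B_zero B.B_zero \<Psi>_simps)
    next
      case (add y a' b' t')
      have "Bhat (D'.\<pi> a b t) (D'.\<pi> a' b' t') = B (\<pi> a b (\<Psi> \<epsilon> t)) (\<pi> a' b' (\<Psi> (- \<epsilon>) t'))"
      proof (cases "a = a' \<and> b = b'")
        case True
        then show ?thesis
          using form_contraction[OF assms(6,7) \<epsilon>(1) \<open>t \<in> carrier D'.U.R\<close> add(2)] by simp
      next
        case False
        then show ?thesis
          using H.B_orthogonal[OF \<open>t \<in> carrier D'.U.R\<close> add(2)] B.B_orthogonal[OF \<Psi>_closed \<Psi>_closed, OF \<open>t \<in> carrier D'.U.R\<close> add(2)] by simp
      qed
      then show ?case
        using add \<open>t \<in> carrier D'.U.R\<close> by (simp add: psi c H.B_add_right B.B_add_right)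
    qed
    then show ?case
      using add assms(10) by (simp add: psi(3) c H.B_add_left B.B_add_left)
  qed
qed

end
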